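(* Let $\lambda>0$. As $p\to0$ (with $p\in(0,1]$) and $np\to\lambda$, the random variable $X_{n,p}=I(n,p)/(n^2p)$ converges in distribution to $X(\lambda)$. The family $\{X(\lambda)\}_{\lambda>0}$ satisfies, for every $\lambda>0$, the distributional identity $$X(\lambda)\overset{\text{law}}{=}U^2X(\lambda U)+(1-U)^2\widetilde X(\lambda(1-U))+\Theta(\lambda,U),$$ in which $U$ is uniform on $[0,1]$ and, conditionally given that $U=u$, the variables $X(\lambda U)$, $\widetilde X(\lambda(1-U))$ and $\Theta(\lambda,U)$ are independent, $X(\lambda U)$ and $\widetilde X(\lambda(1-U))$ are distributed as $X(\lambda u)$ and $X(\lambda(1-u))$, respectively, and $\Theta(\lambda,U)$ is distributed as $$\Theta(\lambda,u)\overset{\text{law}}{=}\frac1\lambda\sum_{i=1}^{N_\lambda}|u-V_i|,$$ where $N_\lambda$ is a Poisson random variable with mean $\lambda$, the $V_i$ are uniformly distributed on $[0,1]$, and $N_\lambda$ and the $V_i$'s are independent. Furthermore, $$\mathbb E[X(\lambda)]=1,\qquad \mathrm{Var}(X(\lambda))=\frac1{12}+\frac1{3\lambda}.$$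
   Context: Quicksort with errors: the input is a list of $n$ distinct numbers presented in uniformly random order (each of the $n!$ orders equiprobable). An empty list is returned as is. For a nonempty list, its first element is the pivot, and every other element is compared with the pivot; each comparison gives the wrong answer with probability $p$ (and the right answer with probability $1-p$), independently of all other comparisons, of positions and of values. The elements declared smaller than the pivot form the left sublist, those declared larger form the right sublist (each kept in its original relative order). The same procedure is applied recursively, with independent new errors, to the two sublists, and the output is the concatenation of the output of the left sublist, the pivot, and the output of the right sublist. For a sequence $y=(y_1,\dots,y_n)$ the number of inversions is $I(y)=\#\{(i,j):1\le i<j\le n,\ y_i>y_j\}$. $I(n,p)$ denotes the random number of inversions of the output on an input of length $n$ with error probability $p$. Definition of $X(\lambda)$: Let $\Pi$ be a Poisson point process with intensity $\lambda$ on $\{1,2,\dots\}\times[0,1]$ (for each $n$ the number of points of $\Pi$ in $\{n\}\times[0,1]$ is Poisson with mean $\lambda$, the second coordinates of the points are uniform on $[0,1]$, everything independent). Let $\{U_{k,j}:k\ge0,1\le j\le2^k\}$ be independent uniform random variables on $[0,1]$, independent of $\Pi$. Define recursively $Y_{0,0}=0$, $Y_{0,1}=1$, $Y_{k+1,2j}=Y_{k,j}$ for $0\le j\le2^k$, $Y_{k+1,2j-1}=(1-U_{k,j})Y_{k,j-1}+U_{k,j}Y_{k,j}$ for $1\le j\le2^k$. For $x\in[0,1]$ and $k\ge1$, put $J_k(x)=2j-1$ if $Y_{k-1,j-1}\le x<Y_{k-1,j}$. Then $$X(\lambda)=\frac1\lambda\sum_{(k,x)\in\Pi}\bigl|x-Y_{k,J_k(x)}\bigr|$$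 (the sum is a.s. finite). The distributional identity is an equation between distributions: it says that the law of $X(\lambda)$ is the mixture over $u$ uniform in $[0,1]$ of the laws of $u^2X(\lambda u)+(1-u)^2\widetilde X(\lambda(1-u))+\Theta(\lambda,u)$ with independent summands; it is understood that the family is realized by a measurable process $(\lambda,\omega)\mapsto X(\lambda,\omega)$. *)

theory Defs
  imports "HOL-Probability.Probability" "HOL-Combinatorics.Multiset_Permutations"
begin

section \<open>Quicksort with errors\<close>

text \<open>
  \<open>declared smaller x ys es\<close> lists, in their original order, the \<open>y\<close> in \<open>ys\<close> for which the
  comparison with the pivot \<open>x\<close> returned the answer \<open>(y < x) = smaller\<close>; \<open>es\<close> marks the
  comparisons that came out wrong.
\<close>

definition declared :: "bool \<Rightarrow> 'a::linorder \<Rightarrow> 'a list \<Rightarrow> bool list \<Rightarrow> 'a list" where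
  "declared smaller x ys es =
     map fst (filter (\<lambda>(y, e). ((y < x) \<noteq> e) = smaller) (zip ys es))"

lemma length_declared: "length (declared b x ys es) < Suc (length ys)"
proof -
  have "length (declared b x ys es) \<le> length (zip ys es)"
    unfolding declared_def length_map by (rule length_filter_le)
  then show ?thesis by simp
qed

function quicksort_err :: "real \<Rightarrow> 'a::linorder list \<Rightarrow> 'a list pmf" where
  "quicksort_err p [] = return_pmf []"
| "quicksort_err p (x # ys) =
     do {
       es \<leftarrow> replicate_pmf (length ys) (bernoulli_pmf p);
       ls \<leftarrow> quicksort_err p (declared True x ys es);
       rs \<leftarrow> quicksort_err p (declared False x ys es);
       return_pmf (ls @ x # rs)
     }"
  by pat_completeness auto
termination
  by (relation "Wellfounded.measure (\<lambda>(p, xs). length xs)") (auto simp: length_declared)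

definition inversions :: "'a::linorder list \<Rightarrow> nat" where
  "inversions ys = card {(i, j). i < j \<and> j < length ys \<and> ys ! i > ys ! j}"

text \<open>
  The law of \<open>I(n,p)\<close>, where \<open>A\<close> is the set of the \<open>n\<close> distinct numbers in the input list.
\<close>

definition inversions_pmf :: "'a::linorder set \<Rightarrow> real \<Rightarrow> nat pmf" where
  "inversions_pmf A p =
     map_pmf inversions (pmf_of_set (permutations_of_set A) \<bind> quicksort_err p)"

definition normalized_inversions_law :: "'a::linorder set \<Rightarrow> real \<Rightarrow> real measure" where
  "normalized_inversions_law A p =
     distr (measure_pmf (inversions_pmf A p)) borel (\<lambda>k. real k / ((real (card A))\<^sup>2 * p))"

section \<open>The limit variables\<close>

abbreviation unif01 :: "real measure" where
  "unif01 \<equiv> restrict_space lborel {0..1}"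

text \<open>
  Outside \<open>j \<le> 2 ^ k\<close> the value of \<open>Ypt u k j\<close> is irrelevant. In the odd case
  \<open>m = 2 * j - 1\<close> one has \<open>j - 1 = m div 2\<close> and \<open>j = Suc (m div 2)\<close>.
\<close>

fun Ypt :: "(nat \<times> nat \<Rightarrow> real) \<Rightarrow> nat \<Rightarrow> nat \<Rightarrow> real" where
  "Ypt u 0 m = (if m = 0 then 0 else 1)"
| "Ypt u (Suc k) m =
     (if even m then Ypt u k (m div 2)
      else (1 - u (k, Suc (m div 2))) * Ypt u k (m div 2)
           + u (k, Suc (m div 2)) * Ypt u k (Suc (m div 2)))"

text \<open>
  For \<open>x = 1\<close>, an event of probability zero below, no \<open>j\<close> qualifies.
\<close>

definition Jidx :: "(nat \<times> nat \<Rightarrow> real) \<Rightarrow> nat \<Rightarrow> real \<Rightarrow> nat" where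
  "Jidx u k x =
     2 * (THE j. 1 \<le> j \<and> j \<le> 2 ^ (k - 1) \<and> Ypt u (k - 1) (j - 1) \<le> x \<and> x < Ypt u (k - 1) j) - 1"

text \<open>
  An outcome is \<open>(N, V, u)\<close>: the Poisson process has the points \<open>(k, V (k, i))\<close> for
  \<open>k \<ge> 1\<close> and \<open>i < N k\<close>, and \<open>u (k, j)\<close> is the value of \<open>U\<^sub>k\<^sub>,\<^sub>j\<close>.
  All coordinates are independent.
\<close>

definition X_space ::
    "real \<Rightarrow> ((nat \<Rightarrow> nat) \<times> (nat \<times> nat \<Rightarrow> real) \<times> (nat \<times> nat \<Rightarrow> real)) measure" where
  "X_space lam =
     (\<Pi>\<^sub>M k\<in>{1..}. measure_pmf (poisson_pmf lam))
     \<Otimes>\<^sub>M ((\<Pi>\<^sub>M ki\<in>{1..} \<times> UNIV. unif01)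
     \<Otimes>\<^sub>M (\<Pi>\<^sub>M kj\<in>{(k, j). 1 \<le> j \<and> j \<le> 2 ^ k}. unif01))"

definition X_var ::
    "real \<Rightarrow> (nat \<Rightarrow> nat) \<times> (nat \<times> nat \<Rightarrow> real) \<times> (nat \<times> nat \<Rightarrow> real) \<Rightarrow> real" where
  "X_var lam = (\<lambda>(N, V, u).
     (1 / lam) *
       (\<Sum>k. \<Sum>i<N (Suc k).
          \<bar>V (Suc k, i) - Ypt u (Suc k) (Jidx u (Suc k) (V (Suc k, i)))\<bar>))"

definition X_law :: "real \<Rightarrow> real measure" where
  "X_law lam = distr (X_space lam) borel (X_var lam)"

definition Theta_law :: "real \<Rightarrow> real \<Rightarrow> real measure" where
  "Theta_law lam u =
     distr (measure_pmf (poisson_pmf lam) \<Otimes>\<^sub>M (\<Pi>\<^sub>M i\<in>(UNIV :: nat set). unif01)) borel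
       (\<lambda>(N, V). (1 / lam) * (\<Sum>i<N. \<bar>u - V i\<bar>))"

text \<open>
  The conditional law, given \<open>U = u\<close>, of the right-hand side of the distributional identity.
\<close>

definition split_law :: "real \<Rightarrow> real \<Rightarrow> real measure" where
  "split_law lam u =
     distr (X_law (lam * u) \<Otimes>\<^sub>M (X_law (lam * (1 - u)) \<Otimes>\<^sub>M Theta_law lam u)) borel
       (\<lambda>(x, x', t). u\<^sup>2 * x + (1 - u)\<^sup>2 * x' + t)"

text \<open>
  The law of \<open>U\<close>. The null set \<open>{0, 1}\<close> is left out because \<open>X_law\<close> is only meaningful for
  positive parameters.
\<close>

abbreviation unif_open :: "real measure" where
  "unif_open \<equiv> restrict_space lborel {0<..<1}"

end

theory Submission
  imports Defs
begin

text \<open>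
  All laws are compared through their characteristic functions, and the natural normalization is
  the one in which quicksort is additive: with \<open>p\<close> times the number of inversions in place of the
  quotient by \<open>n\<^sup>2 p\<close>, the recursion reads \<open>inversions of the left output + inversions of the right
  output + inversions created by the errors of the first round\<close>, with no weights. Its limit is
  \<open>lam\<^sup>2 X(lam)\<close>, since \<open>n p\<close> tends to \<open>lam\<close>.

  For the algorithm, the sublists produced by the first round are again in random order, given the
  pivot and the set of the elements whose comparison failed (\<open>inversions_pmf_rec\<close>). An element at
  distance \<open>d\<close> from the pivot whose comparison fails creates \<open>d\<close> inversions up to an error that is
  at most the number of failures (\<open>new_inversions_approx\<close>). As there are about \<open>n p\<close> failures, the
  new inversions are, after multiplication by \<open>p\<close>, close to a sum of distances over a Poisson
  process.

  For the limit, condition on the division points. Then the contribution of each level is a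
  compound Poisson variable, so that the sum of the first \<open>K\<close> levels has the characteristic function
  \<open>E exp (lam * (sum of gap_char - 1))\<close>, the expectation being over the tree of division points
  (\<open>char_X_part_law\<close>). The tree consists of a uniform root and two independent copies of itself
  (\<open>distr_join_trees\<close>), and the exponent splits at the root because the integral over the unit
  interval does (\<open>gap_char_Suc\<close>). This gives the recursion \<open>Phi_Suc\<close> without any thinning of point
  processes. By uniqueness of characteristic functions it is an identity between laws, and it yields
  the first two moments level by level (\<open>has_moments_X_part\<close>). The means are bounded by 1, hence the
  sum over all levels is finite almost surely, and monotone and dominated convergence give the
  moments of the limit variable and the distributional identity (\<open>X_var_moments\<close>, \<open>X_law_split\<close>).

  For the convergence, let \<open>Delta(n)\<close> be the distance between the characteristic function of \<open>p\<close>
  times the number of inversions and that of the limit variable for the parameter \<open>n p\<close>. The two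
  recursions give \<open>Delta(n) \<le> E (Delta(left) + Delta(right)) + C p\<close>. This is no contraction on
  functions bounded by a multiple of \<open>n p\<close>, because the two lengths add up to \<open>n - 1\<close>. But both
  characteristic functions differ from 1 by \<open>O((n p)\<^sup>2)\<close>, and the mean of \<open>u\<^sup>2 + (1 - u)\<^sup>2\<close> for a uniform
  \<open>u\<close> is \<open>2/3\<close>, so quadratic bounds do contract; iterating the inequality \<open>K\<close> times, then letting \<open>p\<close>
  tend to \<open>0\<close> and finally \<open>K\<close> to infinity proves the convergence (\<open>inv_char_approx\<close>). The limit
  variables for nearby parameters are compared by the same contraction (\<open>Psi_part_lipschitz\<close>).
\<close>

section \<open>Quicksort and the inversions of its output\<close>

lemma set_declared_subset: "set (declared b x ys es) \<subseteq> set ys"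
  by (auto simp: declared_def dest: set_zip_leftD)

lemma declared_map:
  assumes "strict_mono_on S f" "x \<in> S" "set ys \<subseteq> S"
  shows "declared b (f x) (map f ys) es = map f (declared b x ys es)"
  using assms(3)
proof (induction ys arbitrary: es)
  case (Cons y ys)
  show ?case
  proof (cases es)
    case (Cons e es')
    have "f y < f x \<longleftrightarrow> y < x"
      using Cons.prems assms(1,2) by (auto simp: strict_mono_on_less)
    then show ?thesis using Cons.IH[of es'] Cons.prems Cons
      by (simp add: declared_def)
  qed (simp add: declared_def)
qed (simp add: declared_def)

text \<open>
  Comparisons and errors see only the relative order of the entries, so the law of the number of
  inversions will depend on the input set through its cardinality alone.
\<close>

lemma quicksort_err_map:
  assumes f: "strict_mono_on S f" and "set xs \<subseteq> S"
  shows "quicksort_err p (map f xs) = map_pmf (map f) (quicksort_err p xs)"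
  using assms(2)
proof (induction p xs rule: quicksort_err.induct)
  case (2 p x ys)
  have sub: "set (declared b x ys es) \<subseteq> S" for b es
    using set_declared_subset[of b x ys es] 2 by auto
  have x: "x \<in> S" and ys: "set ys \<subseteq> S" using 2 by auto
  show ?case
    by (simp add: declared_map[OF f x ys] 2(1,2) sub map_bind_pmf bind_map_pmf
        cong: bind_pmf_cong)
qed simp

lemma mset_quicksort_err: "zs \<in> set_pmf (quicksort_err p xs) \<Longrightarrow> mset zs = mset xs"
proof (induction p xs arbitrary: zs rule: quicksort_err.induct)
  case (2 p x ys)
  from 2(3) obtain es ls rs where es: "es \<in> set_pmf (replicate_pmf (length ys) (bernoulli_pmf p))"
    and "ls \<in> set_pmf (quicksort_err p (declared True x ys es))"
      "rs \<in> set_pmf (quicksort_err p (declared False x ys es))" and zs: "zs = ls @ x # rs"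
    by auto
  then have l: "mset ls = mset (declared True x ys es)" and r: "mset rs = mset (declared False x ys es)"
    using 2 by auto
  have len: "length es = length ys" using es by (auto simp: set_replicate_pmf)
  have "mset (declared True x ys es) + mset (declared False x ys es) = mset ys"
    using len by (induction ys es rule: list_induct2') (auto simp: declared_def)
  then show ?case by (simp add: zs l r)
qed simp

lemma inversions_Cons: "inversions (x # ys) = card {j. j < length ys \<and> ys ! j < x} + inversions ys"
proof -
  let ?S = "{(i, j). i < j \<and> j < length ys \<and> ys ! i > ys ! j}"
  let ?C = "{j. j < length ys \<and> ys ! j < x}"
  have "{(i, j). i < j \<and> j < length (x # ys) \<and> (x # ys) ! i > (x # ys) ! j}
      = (\<lambda>j. (0, Suc j)) ` ?C \<union> (\<lambda>(i, j). (Suc i, Suc j)) ` ?S" (is "?A = ?B \<union> ?D")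
  proof (intro equalityI subsetI; clarify)
    fix i j assume a: "(i::nat) < j" "j < length (x # ys)" "(x # ys) ! i > (x # ys) ! j"
      "(i, j) \<notin> ?D"
    then obtain j' where "j = Suc j'" by (cases j) auto
    with a show "(i, j) \<in> ?B" by (cases i) auto
  qed auto
  moreover have "finite ?S" by (rule finite_subset[of _ "{..length ys} \<times> {..length ys}"]) auto
  then have "card (?B \<union> ?D) = card ?B + card ?D" by (intro card_Un_disjoint) auto
  moreover have "card ?B = card ?C" by (intro card_image) (auto simp: inj_on_def)
  moreover have "card ?D = card ?S" by (intro card_image) (auto simp: inj_on_def)
  ultimately show ?thesis by (simp add: inversions_def)
qed

lemma inversions_Nil [simp]: "inversions [] = 0"
  by (simp add: inversions_def)

lemma inversions_Cons_distinct:
  assumes "distinct ys"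
  shows "inversions (x # ys) = card {y \<in> set ys. y < x} + inversions ys"
proof -
  have "{y \<in> set ys. y < x} = (!) ys ` {j. j < length ys \<and> ys ! j < x}"
    by (auto simp: in_set_conv_nth)
  moreover have "inj_on ((!) ys) {j. j < length ys \<and> ys ! j < x}"
    using assms by (auto simp: inj_on_def nth_eq_iff_index_eq)
  ultimately show ?thesis by (simp add: inversions_Cons card_image)
qed

lemma inversions_append:
  assumes "distinct (xs @ ys)"
  shows "inversions (xs @ ys)
       = inversions xs + inversions ys + card {(a, b). a \<in> set xs \<and> b \<in> set ys \<and> b < a}"
  using assms
proof (induction xs)
  case (Cons x xs)
  have "{(a, b). a \<in> set (x # xs) \<and> b \<in> set ys \<and> b < a}
      = Pair x ` {b \<in> set ys. b < x} \<union> {(a, b). a \<in> set xs \<and> b \<in> set ys \<and> b < a}"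
    by auto
  moreover have "card \<dots> = card (Pair x ` {b \<in> set ys. b < x})
      + card {(a, b). a \<in> set xs \<and> b \<in> set ys \<and> b < a}"
    using Cons.prems
    by (intro card_Un_disjoint) (auto intro: finite_subset[of _ "set xs \<times> set ys"])
  moreover have "card (Pair x ` {b \<in> set ys. b < x}) = card {b \<in> set ys. b < x}"
    by (intro card_image) (auto simp: inj_on_def)
  moreover have "{y \<in> set (xs @ ys). y < x} = {y \<in> set xs. y < x} \<union> {b \<in> set ys. b < x}" by auto
  moreover have "card \<dots> = card {y \<in> set xs. y < x} + card {b \<in> set ys. b < x}"
    using Cons.prems by (intro card_Un_disjoint) auto
  ultimately show ?case using Cons.IH Cons.prems inversions_Cons_distinct[of "xs @ ys" x]
     inversions_Cons_distinct[of xs x]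
    by (simp del: append_Cons add: append_Cons[symmetric, of x])
qed simp

text \<open>
  The pivot belongs to both sides here: it may be preceded by a larger element of the left list and
  followed by a smaller element of the right list.
\<close>

definition cross_inversions :: "'a::linorder \<Rightarrow> 'a set \<Rightarrow> 'a set \<Rightarrow> nat" where
  "cross_inversions x L R = card {(a, b). a \<in> insert x L \<and> b \<in> insert x R \<and> b < a}"

text \<open>
  The inversions that are not internal to one of the two sublists are determined by the sets of
  their elements, whatever the recursive calls do with their order.
\<close>

lemma inversions_around_pivot:
  assumes "distinct (ls @ x # rs)"
  shows "inversions (ls @ x # rs)
       = inversions ls + inversions rs + cross_inversions x (set ls) (set rs)"
proof -
  have "{(a, b). a \<in> insert x (set ls) \<and> b \<in> insert x (set rs) \<and> b < a}
      = {(a, b). a \<in> set ls \<and> b \<in> set (x # rs) \<and> b < a} \<union> Pair x ` {b \<in> set rs. b < x}"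
    by auto
  moreover have "card \<dots> = card {(a, b). a \<in> set ls \<and> b \<in> set (x # rs) \<and> b < a}
     + card (Pair x ` {b \<in> set rs. b < x})"
    using assms
    by (intro card_Un_disjoint) (auto intro: finite_subset[of _ "set ls \<times> set (x # rs)"])
  moreover have "card (Pair x ` {b \<in> set rs. b < x}) = card {b \<in> set rs. b < x}"
    by (intro card_image) (auto simp: inj_on_def)
  ultimately show ?thesis
    using inversions_append[OF assms] inversions_Cons_distinct[of rs x] assms
    by (simp add: cross_inversions_def)
qed

lemma inversions_map:
  assumes "strict_mono_on S f" "set ys \<subseteq> S"
  shows "inversions (map f ys) = inversions ys"
proof -
  have "f (ys ! j) < f (ys ! i) \<longleftrightarrow> ys ! j < ys ! i" if "i < length ys" "j < length ys" for i j
    using assms that by (intro strict_mono_on_less[where S = S]) auto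
  then show ?thesis unfolding inversions_def
    by (intro arg_cong[where f = card]) auto
qed

text \<open>
  Errors are attached to elements rather than to positions: then they are independent of the random
  order of the list.
\<close>

definition err_pattern :: "'a list \<Rightarrow> bool list \<Rightarrow> 'a \<Rightarrow> bool" where
  "err_pattern ys es y \<longleftrightarrow> map_of (zip ys es) y = Some True"

lemma err_pattern_bernoulli:
  assumes "distinct ys"
  shows "map_pmf (err_pattern ys) (replicate_pmf (length ys) q) = Pi_pmf (set ys) False (\<lambda>_. q)"
  using assms
proof (induction ys)
  case Nil
  then show ?case by (simp add: err_pattern_def fun_eq_iff)
next
  case (Cons y ys)
  have *: "err_pattern (y # ys) (e # es) = (err_pattern ys es)(y := e)" if "y \<notin> set ys" for e es
    using that by (auto simp: err_pattern_def fun_eq_iff)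
  have "Pi_pmf (set (y # ys)) False (\<lambda>_. q)
     = q \<bind> (\<lambda>e. map_pmf (err_pattern ys) (replicate_pmf (length ys) q) \<bind> (\<lambda>f. return_pmf (f(y := e))))"
    using Cons by (simp add: Pi_pmf_insert')
  also have "\<dots> = map_pmf (err_pattern (y # ys)) (replicate_pmf (length (y # ys)) q)"
    using Cons.prems by (simp add: bind_map_pmf map_bind_pmf * cong: bind_pmf_cong)
  finally show ?case by simp
qed

lemma declared_conv_filter:
  assumes "distinct ys" "length es = length ys"
  shows "declared b x ys es = filter (\<lambda>y. ((y < x) \<noteq> err_pattern ys es y) = b) ys"
  using assms(2,1)
proof (induction es ys rule: list_induct2)
  case (Cons e es y ys)
  have "filter (\<lambda>z. ((z < x) \<noteq> err_pattern (y # ys) (e # es) z) = b) ys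
      = filter (\<lambda>z. ((z < x) \<noteq> err_pattern ys es z) = b) ys"
    using Cons.prems by (intro filter_cong) (auto simp: err_pattern_def)
  moreover have "err_pattern (y # ys) (e # es) y = e" by (simp add: err_pattern_def)
  ultimately show ?case using Cons by (simp add: declared_def)
qed (simp add: declared_def)

definition declared_set :: "bool \<Rightarrow> 'a::linorder \<Rightarrow> 'a set \<Rightarrow> ('a \<Rightarrow> bool) \<Rightarrow> 'a set" where
  "declared_set b x A e = {y \<in> A - {x}. ((y < x) \<noteq> e y) = b}"

text \<open>
  Given the pivot and the failed comparisons, a uniformly random order of the other elements is cut
  into two independent uniformly random orders of the elements declared smaller and larger.
\<close>

lemma inversions_pmf_rec:
  assumes fin: "finite A" and ne: "A \<noteq> {}"
  shows "inversions_pmf A p =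
     do {
       x \<leftarrow> pmf_of_set A;
       e \<leftarrow> Pi_pmf (A - {x}) False (\<lambda>_. bernoulli_pmf p);
       i \<leftarrow> inversions_pmf (declared_set True x A e) p;
       j \<leftarrow> inversions_pmf (declared_set False x A e) p;
       return_pmf (i + j + cross_inversions x (declared_set True x A e) (declared_set False x A e))
     }"
proof -
  have *: "pmf_of_set (permutations_of_set (A - {x})) \<bind>
          (\<lambda>xs. map_pmf inversions (quicksort_err p (x # xs)))
      = Pi_pmf (A - {x}) False (\<lambda>_. bernoulli_pmf p) \<bind> (\<lambda>e.
          inversions_pmf (declared_set True x A e) p \<bind> (\<lambda>i.
          inversions_pmf (declared_set False x A e) p \<bind> (\<lambda>j.
          return_pmf (i + j + cross_inversions x (declared_set True x A e) (declared_set False x A e)))))"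
    (is "?l = ?r") if x: "x \<in> A" for x
  proof -
    let ?P = "\<lambda>e y. (y < x) \<noteq> e y"
    let ?D = "pmf_of_set (permutations_of_set (A - {x}))"
    let ?E = "Pi_pmf (A - {x}) False (\<lambda>_. bernoulli_pmf p)"
    define F where "F = (\<lambda>(l, r). quicksort_err p l \<bind> (\<lambda>ls. quicksort_err p r \<bind>
              (\<lambda>rs. return_pmf (inversions (ls @ x # rs)))))"
    have fA: "finite (A - {x})" using fin by simp
    have "?l = ?D \<bind> (\<lambda>xs. ?E \<bind> (\<lambda>e. F (partition (?P e) xs)))"
    proof (intro bind_pmf_cong refl)
      fix xs assume "xs \<in> set_pmf ?D"
      then have "xs \<in> permutations_of_set (A - {x})" using fA by simp
      then have xs: "set xs = A - {x}" "distinct xs" by (auto simp: permutations_of_set_def)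
      have "?E \<bind> (\<lambda>e. F (partition (?P e) xs))
          = replicate_pmf (length xs) (bernoulli_pmf p) \<bind> (\<lambda>es. F (partition (?P (err_pattern xs es)) xs))"
        unfolding xs(1)[symmetric] err_pattern_bernoulli[OF xs(2), symmetric]
        by (simp add: bind_map_pmf)
      also have "\<dots> = replicate_pmf (length xs) (bernoulli_pmf p) \<bind>
          (\<lambda>es. F (declared True x xs es, declared False x xs es))"
        using xs by (intro bind_pmf_cong refl) (auto simp: set_replicate_pmf declared_conv_filter o_def)
      finally show "map_pmf inversions (quicksort_err p (x # xs)) = ?E \<bind> (\<lambda>e. F (partition (?P e) xs))"
        by (simp add: F_def map_bind_pmf)
    qed
    \<comment> \<open>Drawing the errors before the order makes the partition a function of a random permutation.\<close>
    also have "\<dots> = ?E \<bind> (\<lambda>e. map_pmf (partition (?P e)) ?D \<bind> F)"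
      by (subst bind_commute_pmf) (simp add: bind_map_pmf)
    also have "\<dots> = ?r"
    proof (intro bind_pmf_cong refl)
      fix e
      let ?L = "declared_set True x A e" and ?R = "declared_set False x A e"
      have fL: "finite ?L" "finite ?R" using fin by (auto simp: declared_set_def)
      have L: "{y \<in> A - {x}. ?P e y} = ?L" and R: "{y \<in> A - {x}. \<not> ?P e y} = ?R"
        by (auto simp: declared_set_def)
      have "map_pmf (partition (?P e)) ?D \<bind> F
         = pmf_of_set (permutations_of_set ?L) \<bind> (\<lambda>l. pmf_of_set (permutations_of_set ?R) \<bind>
            (\<lambda>r. F (l, r)))"
        unfolding partition_random_permutations[OF fA] L R
        by (simp add: pair_pmf_def bind_assoc_pmf bind_return_pmf)
      also have "\<dots> = pmf_of_set (permutations_of_set ?L) \<bind> (\<lambda>l. pmf_of_set (permutations_of_set ?R) \<bind>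
            (\<lambda>r. quicksort_err p l \<bind> (\<lambda>ls. quicksort_err p r \<bind>
              (\<lambda>rs. return_pmf (inversions ls + inversions rs + cross_inversions x ?L ?R)))))"
      proof (unfold F_def prod.case, intro bind_pmf_cong refl)
        fix l r ls rs
        assume "l \<in> set_pmf (pmf_of_set (permutations_of_set ?L))"
          and "r \<in> set_pmf (pmf_of_set (permutations_of_set ?R))"
        then have "l \<in> permutations_of_set ?L" "r \<in> permutations_of_set ?R" using fL by simp_all
        then have l: "set l = ?L" "distinct l" and r: "set r = ?R" "distinct r"
          by (auto simp: permutations_of_set_def)
        assume "ls \<in> set_pmf (quicksort_err p l)" "rs \<in> set_pmf (quicksort_err p r)"
        then have m: "mset ls = mset l" "mset rs = mset r" by (auto dest: mset_quicksort_err)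
        have s: "set ls = ?L" "set rs = ?R" "distinct ls" "distinct rs"
          using m l r mset_eq_setD mset_eq_imp_distinct_iff by metis+
        have "distinct (ls @ x # rs)" using s by (auto simp: declared_set_def)
        from inversions_around_pivot[OF this]
        show "return_pmf (inversions (ls @ x # rs))
          = return_pmf (inversions ls + inversions rs + cross_inversions x ?L ?R)" by (simp add: s)
      qed
      also have "\<dots> = inversions_pmf ?L p \<bind> (\<lambda>i. inversions_pmf ?R p \<bind> (\<lambda>j.
          return_pmf (i + j + cross_inversions x ?L ?R)))"
        unfolding inversions_pmf_def bind_map_pmf bind_assoc_pmf
        by (rule bind_pmf_cong[OF refl], rule bind_commute_pmf)
      finally show "map_pmf (partition (?P e)) ?D \<bind> F = \<dots>" .
    qed
    finally show ?thesis .
  qed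
  have "inversions_pmf A p = pmf_of_set A \<bind> (\<lambda>x. pmf_of_set (permutations_of_set (A - {x})) \<bind>
          (\<lambda>xs. map_pmf inversions (quicksort_err p (x # xs))))"
    unfolding inversions_pmf_def random_permutation_of_set[OF fin ne]
    by (simp only: map_bind_pmf bind_assoc_pmf bind_return_pmf)
  also have "\<dots> = pmf_of_set A \<bind> (\<lambda>x. Pi_pmf (A - {x}) False (\<lambda>_. bernoulli_pmf p) \<bind> (\<lambda>e.
          inversions_pmf (declared_set True x A e) p \<bind> (\<lambda>i.
          inversions_pmf (declared_set False x A e) p \<bind> (\<lambda>j.
          return_pmf (i + j + cross_inversions x (declared_set True x A e) (declared_set False x A e))))))"
    using fin ne by (intro bind_pmf_cong refl *) auto
  finally show ?thesis .
qed

lemma inversions_pmf_empty: "inversions_pmf {} p = return_pmf 0"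
  by (simp add: inversions_pmf_def pmf_of_set_singleton bind_return_pmf)

lemma inversions_pmf_image:
  assumes f: "strict_mono_on A f" and fin: "finite A"
  shows "inversions_pmf (f ` A) p = inversions_pmf A p"
proof -
  have inj: "inj_on f A" using f by (rule strict_mono_on_imp_inj_on)
  have "inj_on (map f) (permutations_of_set A)"
    using inj by (intro inj_on_mapI) (auto simp: permutations_of_set_def intro: inj_on_subset)
  then have "pmf_of_set (permutations_of_set (f ` A)) = map_pmf (map f) (pmf_of_set (permutations_of_set A))"
    unfolding permutations_of_set_image_inj[OF inj]
    using fin by (subst map_pmf_of_set_inj) auto
  then have "inversions_pmf (f ` A) p = pmf_of_set (permutations_of_set A) \<bind>
       (\<lambda>xs. map_pmf inversions (quicksort_err p (map f xs)))"
    by (simp add: inversions_pmf_def map_bind_pmf bind_map_pmf)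
  also have "\<dots> = pmf_of_set (permutations_of_set A) \<bind> (\<lambda>xs. map_pmf inversions (quicksort_err p xs))"
  proof (intro bind_pmf_cong refl)
    fix xs assume "xs \<in> set_pmf (pmf_of_set (permutations_of_set A))"
    then have "xs \<in> permutations_of_set A" using fin by simp
    then have xs: "set xs = A" by (auto simp: permutations_of_set_def)
    show "map_pmf inversions (quicksort_err p (map f xs)) = map_pmf inversions (quicksort_err p xs)"
      unfolding quicksort_err_map[OF f, of xs, unfolded xs, OF order.refl] pmf.map_comp
    proof (intro pmf.map_cong refl)
      fix zs assume "zs \<in> set_pmf (quicksort_err p xs)"
      then have "set zs = A" using mset_quicksort_err mset_eq_setD xs by metis
      then show "(inversions \<circ> map f) zs = inversions zs" by (simp add: inversions_map[OF f])
    qed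
  qed
  finally show ?thesis by (simp add: inversions_pmf_def map_bind_pmf)
qed

lemma inversions_pmf_card:
  fixes A :: "'a::linorder set"
  assumes fin: "finite A"
  shows "inversions_pmf A p = inversions_pmf {..<card A} p"
proof -
  define f where "f i = sorted_list_of_set A ! i" for i
  have "strict_mono_on {..<card A} f"
    unfolding f_def using fin strict_sorted_list_of_set[of A]
    by (auto simp: strict_mono_on_def sorted_wrt_iff_nth_less)
  moreover have "f ` {..<card A} = A"
    using fin set_sorted_list_of_set[OF fin] by (force simp: f_def in_set_conv_nth set_conv_nth)
  ultimately show ?thesis using inversions_pmf_image[of "{..<card A}" f p] by simp
qed

section \<open>The first step of the algorithm\<close>

lemma expectation_bind_pmf_finite:
  fixes h :: "'b \<Rightarrow> 'c::{banach, second_countable_topology}"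
  assumes "finite (set_pmf p)" "\<And>x. x \<in> set_pmf p \<Longrightarrow> finite (set_pmf (f x))"
  shows "measure_pmf.expectation (p \<bind> f) h
       = measure_pmf.expectation p (\<lambda>x. measure_pmf.expectation (f x) h)"
  using assms by (subst pmf_expectation_bind[where A = "set_pmf p"])
     (auto simp: integral_measure_pmf[where A = "set_pmf p"])

lemma expectation_prod_Pi_pmf_field:
  fixes f :: "'a \<Rightarrow> 'b \<Rightarrow> 'c::{real_normed_field, banach, second_countable_topology}"
  assumes A: "finite A" and fin: "\<And>x. x \<in> A \<Longrightarrow> finite (set_pmf (p x))"
  shows "measure_pmf.expectation (Pi_pmf A d p) (\<lambda>y. \<Prod>x\<in>A. f x (y x))
       = (\<Prod>x\<in>A. measure_pmf.expectation (p x) (f x))"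
  using A fin
proof (induction A rule: finite_induct)
  case (insert x A)
  have "finite (set_pmf (Pi_pmf A d p))"
    using insert by (auto simp: set_Pi_pmf intro!: finite_PiE_dflt)
  moreover have "(\<Prod>z\<in>A. f z ((g(x := y)) z)) = (\<Prod>z\<in>A. f z (g z))" for g y
    using insert.hyps by (intro prod.cong) auto
  ultimately show ?case using insert
    by (subst Pi_pmf_insert') (simp_all add: expectation_bind_pmf_finite del: fun_upd_apply, simp)
qed simp

lemma finite_set_inversions_pmf:
  assumes "finite A"
  shows "finite (set_pmf (inversions_pmf A p))"
proof -
  have "finite (set_pmf (quicksort_err p xs))" for xs :: "'a list"
  proof (rule finite_subset[OF _ finite_lists_length_eq[of "set xs" "length xs"]])
    show "set_pmf (quicksort_err p xs) \<subseteq> {zs. set zs \<subseteq> set xs \<and> length zs = length xs}"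
      using mset_quicksort_err[of _ p xs] by (auto dest: mset_eq_setD mset_eq_length)
  qed simp
  then show ?thesis using assms by (simp add: inversions_pmf_def)
qed

text \<open>
  The rank of the pivot among \<open>{..<n}\<close> and the indicator of the failed comparisons.
\<close>

definition first_step :: "nat \<Rightarrow> real \<Rightarrow> (nat \<times> (nat \<Rightarrow> bool)) pmf" where
  "first_step n p = pmf_of_set {..<n} \<bind>
     (\<lambda>x. map_pmf (Pair x) (Pi_pmf ({..<n} - {x}) False (\<lambda>_. bernoulli_pmf p)))"

lemma finite_set_Pi_bernoulli: "finite A \<Longrightarrow> finite (set_pmf (Pi_pmf A False (\<lambda>_. bernoulli_pmf p)))"
  by (auto simp: set_Pi_pmf intro!: finite_PiE_dflt)

lemma finite_set_first_step: "0 < n \<Longrightarrow> finite (set_pmf (first_step n p))"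
  by (auto simp: first_step_def set_pmf_of_set lessThan_empty_iff finite_set_Pi_bernoulli)

lemma set_first_step: "0 < n \<Longrightarrow> (x, e) \<in> set_pmf (first_step n p) \<Longrightarrow> x < n"
  by (auto simp: first_step_def lessThan_empty_iff)

lemma expectation_first_step:
  fixes h :: "_ \<Rightarrow> 'c::{banach, second_countable_topology}"
  assumes "0 < n"
  shows "measure_pmf.expectation (first_step n p) h = (\<Sum>x<n. measure_pmf.expectation
     (Pi_pmf ({..<n} - {x}) False (\<lambda>_. bernoulli_pmf p)) (\<lambda>e. h (x, e))) /\<^sub>R real n"
proof -
  have "{..<n} \<noteq> {}" using assms by auto
  then have "measure_pmf.expectation (pmf_of_set {..<n}) g = (\<Sum>x<n. g x) /\<^sub>R real n"
    for g :: "nat \<Rightarrow> 'c"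
    by (subst integral_measure_pmf[where A = "{..<n}"]) (auto simp: scaleR_sum_right divide_inverse)
  with \<open>{..<n} \<noteq> {}\<close> show ?thesis
    unfolding first_step_def
    by (subst expectation_bind_pmf_finite) (simp_all add: finite_set_Pi_bernoulli)
qed

text \<open>
  The characteristic function of \<open>p\<close> times the number of inversions. With the factor \<open>p\<close>, which does
  not depend on the length of the list, the recursion \<open>inv_char_rec\<close> needs no rescaling.
\<close>

definition inv_char :: "real \<Rightarrow> real \<Rightarrow> nat \<Rightarrow> complex" where
  "inv_char s p n = measure_pmf.expectation (inversions_pmf {..<n} p) (\<lambda>k. iexp (s * p * real k))"

definition left_size :: "nat \<Rightarrow> nat \<times> (nat \<Rightarrow> bool) \<Rightarrow> nat" where
  "left_size n = (\<lambda>(x, e). card (declared_set True x {..<n} e))"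

definition right_size :: "nat \<Rightarrow> nat \<times> (nat \<Rightarrow> bool) \<Rightarrow> nat" where
  "right_size n = (\<lambda>(x, e). card (declared_set False x {..<n} e))"

definition new_inversions :: "nat \<Rightarrow> nat \<times> (nat \<Rightarrow> bool) \<Rightarrow> nat" where
  "new_inversions n =
     (\<lambda>(x, e). cross_inversions x (declared_set True x {..<n} e) (declared_set False x {..<n} e))"

definition err_set :: "nat \<Rightarrow> nat \<times> (nat \<Rightarrow> bool) \<Rightarrow> nat set" where
  "err_set n = (\<lambda>(x, e). {y \<in> {..<n} - {x}. e y})"

text \<open>
  If the comparison of \<open>y\<close> fails and no other one does, then exactly the elements between \<open>y\<close> and the
  pivot, and the pivot itself, form an inversion with \<open>y\<close>.
\<close>

definition err_dist :: "nat \<Rightarrow> nat \<times> (nat \<Rightarrow> bool) \<Rightarrow> real" where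
  "err_dist n w = (\<Sum>y\<in>err_set n w. \<bar>real y - real (fst w)\<bar>)"

lemma inv_char_0 [simp]: "inv_char s p 0 = 1"
  by (simp add: inv_char_def inversions_pmf_empty)

lemma cmod_inv_char_le: "cmod (inv_char s p n) \<le> 1"
  unfolding inv_char_def
  by (rule order.trans[OF integral_norm_bound]) simp

lemma inv_char_rec:
  assumes "0 < n"
  shows "inv_char s p n = measure_pmf.expectation (first_step n p)
     (\<lambda>w. iexp (s * p * real (new_inversions n w)) * inv_char s p (left_size n w) * inv_char s p (right_size n w))"
proof -
  have ne: "{..<n} \<noteq> {}" using assms by auto
  have fin: "finite (declared_set b x {..<n} e)" for b x e by (auto simp: declared_set_def)
  note card = inversions_pmf_card[OF fin]
  note fin' = finite_set_inversions_pmf[OF fin] finite_set_Pi_bernoulli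
  have E: "measure_pmf.expectation (inversions_pmf (declared_set True x {..<n} e) p) (\<lambda>i.
      measure_pmf.expectation (inversions_pmf (declared_set False x {..<n} e) p)
        (\<lambda>j. iexp (s * p * real (i + j + new_inversions n (x, e)))))
     = iexp (s * p * real (new_inversions n (x, e))) * inv_char s p (left_size n (x, e)) * inv_char s p (right_size n (x, e))"
    for x e
  proof -
    have "iexp (s * p * real (i + j + k)) = iexp (s * p * real k) * iexp (s * p * real i) * iexp (s * p * real j)"
      for i j k
      by (simp add: ring_distribs exp_add)
    then show ?thesis
      by (simp only: card) (simp add: inv_char_def left_size_def right_size_def)
  qed
  have "inv_char s p n = measure_pmf.expectation (pmf_of_set {..<n}) (\<lambda>x.
     measure_pmf.expectation (Pi_pmf ({..<n} - {x}) False (\<lambda>_. bernoulli_pmf p)) (\<lambda>e.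
      measure_pmf.expectation (inversions_pmf (declared_set True x {..<n} e) p) (\<lambda>i.
      measure_pmf.expectation (inversions_pmf (declared_set False x {..<n} e) p)
        (\<lambda>j. iexp (s * p * real (i + j + new_inversions n (x, e)))))))"
    unfolding inv_char_def[of s p n] using ne
    by (subst inversions_pmf_rec)
       (simp_all add: expectation_bind_pmf_finite fin' new_inversions_def)
  then show ?thesis unfolding E using ne
    by (simp add: first_step_def expectation_bind_pmf_finite fin')
qed

lemma card_err_set_le: "card (err_set n w) \<le> n"
proof -
  have "err_set n w \<subseteq> {..<n}" by (auto simp: err_set_def split: prod.splits)
  then show ?thesis using card_mono[of "{..<n}"] by force
qed

lemma finite_err_set [simp, intro]: "finite (err_set n w)"
  by (auto simp: err_set_def split: prod.splits)

lemma size_le: "left_size n w \<le> n" "right_size n w \<le> n"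
proof -
  have "declared_set b x {..<n} e \<subseteq> {..<n}" for b x e by (auto simp: declared_set_def)
  from card_mono[OF _ this] show "left_size n w \<le> n" "right_size n w \<le> n"
    by (auto simp: left_size_def right_size_def split: prod.splits)
qed

lemma abs_card_diff_le:
  assumes "finite A" "finite B" "finite C" "A - B \<subseteq> C" "B - A \<subseteq> C"
  shows "\<bar>real (card A) - real (card B)\<bar> \<le> real (card C)"
proof -
  have "card A \<le> card B + card C"
    using card_mono[of "B \<union> C" A] card_Un_le[of B C] assms by fastforce
  moreover have "card B \<le> card A + card C"
    using card_mono[of "A \<union> C" B] card_Un_le[of A C] assms by fastforce
  ultimately show ?thesis by linarith
qed

lemma left_size_approx:
  assumes "x < n"
  shows "\<bar>real (left_size n (x, e)) - real x\<bar> \<le> real (card (err_set n (x, e)))"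
proof -
  have "\<bar>real (card (declared_set True x {..<n} e)) - real (card {..<x})\<bar> \<le> real (card (err_set n (x, e)))"
    using assms by (intro abs_card_diff_le) (auto simp: declared_set_def err_set_def)
  then show ?thesis by (simp add: left_size_def)
qed

lemma right_size_approx:
  assumes "x < n"
  shows "\<bar>real (right_size n (x, e)) - (real n - 1 - real x)\<bar> \<le> real (card (err_set n (x, e)))"
proof -
  have "\<bar>real (card (declared_set False x {..<n} e)) - real (card {x<..<n})\<bar> \<le> real (card (err_set n (x, e)))"
    using assms by (intro abs_card_diff_le) (auto simp: declared_set_def err_set_def)
  then show ?thesis using assms by (simp add: right_size_def)
qed

text \<open>
  A pair that is an inversion with the actual failures but is not counted by \<open>err_dist\<close>, or the other
  way round, consists of two elements whose comparisons both failed.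
\<close>

lemma new_inversions_approx:
  assumes "x < n"
  shows "\<bar>real (new_inversions n (x, e)) - err_dist n (x, e)\<bar> \<le> (real (card (err_set n (x, e))))\<^sup>2"
proof -
  let ?E = "err_set n (x, e)"
  let ?L = "declared_set True x {..<n} e" and ?R = "declared_set False x {..<n} e"
  \<comment> \<open>\<open>Q1\<close> and \<open>Q2\<close> list the inversions that single failures below and above the pivot would create.\<close>
  define P where "P = {(a, b). a \<in> insert x ?L \<and> b \<in> insert x ?R \<and> b < a}"
  define Q1 where "Q1 = (SIGMA b:{b \<in> ?E. b < x}. {b<..x})"
  define Q2 where "Q2 = (SIGMA a:{a \<in> ?E. x < a}. {x..<a})"
  define Q where "Q = prod.swap ` Q1 \<union> Q2"
  have fP: "finite P"
    by (rule finite_subset[of _ "insert x ?L \<times> insert x ?R"]) (auto simp: P_def declared_set_def)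
  have fQ: "finite Q1" "finite Q2"
    by (auto simp: Q1_def Q2_def intro!: finite_SigmaI)
  have "real (card Q1) = (\<Sum>b\<in>{b \<in> ?E. b < x}. real x - real b)"
    unfolding Q1_def by (simp add: card_SigmaI of_nat_sum of_nat_diff less_imp_le cong: sum.cong_simp)
  moreover have "real (card Q2) = (\<Sum>a\<in>{a \<in> ?E. x < a}. real a - real x)"
    unfolding Q2_def by (simp add: card_SigmaI of_nat_sum of_nat_diff less_imp_le cong: sum.cong_simp)
  moreover have "card Q = card (prod.swap ` Q1) + card Q2"
    unfolding Q_def using fQ by (intro card_Un_disjoint) (auto simp: Q1_def Q2_def)
  moreover have "card (prod.swap ` Q1) = card Q1" by (intro card_image) auto
  moreover have "err_dist n (x, e) = (\<Sum>b\<in>{b \<in> ?E. b < x}. real x - real b) + (\<Sum>a\<in>{a \<in> ?E. x < a}. real a - real x)"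
  proof -
    have "?E = {b \<in> ?E. b < x} \<union> {a \<in> ?E. x < a}" by (auto simp: err_set_def)
    then have "err_dist n (x, e) = (\<Sum>y\<in>{b \<in> ?E. b < x} \<union> {a \<in> ?E. x < a}. \<bar>real y - real x\<bar>)"
      by (simp add: err_dist_def)
    also have "\<dots> = (\<Sum>y\<in>{b \<in> ?E. b < x}. \<bar>real y - real x\<bar>) + (\<Sum>y\<in>{a \<in> ?E. x < a}. \<bar>real y - real x\<bar>)"
      by (intro sum.union_disjoint) auto
    finally show ?thesis by simp
  qed
  ultimately have Q: "err_dist n (x, e) = real (card Q)" by simp
  have "\<bar>real (card P) - real (card Q)\<bar> \<le> real (card (?E \<times> ?E))"
  proof (rule abs_card_diff_le)
    show "P - Q \<subseteq> ?E \<times> ?E"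
      using assms by (fastforce simp: P_def Q_def Q1_def Q2_def err_set_def declared_set_def image_iff)
    show "Q - P \<subseteq> ?E \<times> ?E"
      using assms by (fastforce simp: P_def Q_def Q1_def Q2_def err_set_def declared_set_def)
  qed (use fP fQ in \<open>auto simp: Q_def\<close>)
  then show ?thesis
    by (simp add: Q new_inversions_def cross_inversions_def P_def power2_eq_square card_cartesian_product)
qed

lemma err_dist_le:
  assumes "x < n"
  shows "err_dist n (x, e) \<le> real n * real (card (err_set n (x, e)))"
proof -
  have "err_dist n (x, e) \<le> (\<Sum>y\<in>err_set n (x, e). real n)"
    unfolding err_dist_def using assms by (intro sum_mono) (auto simp: err_set_def)
  then show ?thesis by (simp add: mult.commute)
qed

lemma new_inversions_le:
  assumes "x < n"
  shows "real (new_inversions n (x, e)) \<le> 2 * real n * real (card (err_set n (x, e)))"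
proof -
  have "(real (card (err_set n (x, e))))\<^sup>2 \<le> real n * real (card (err_set n (x, e)))"
    unfolding power2_eq_square using card_err_set_le[of n "(x, e)"] by (intro mult_right_mono) auto
  then show ?thesis
    using new_inversions_approx[OF assms, of e] err_dist_le[OF assms, of e] by linarith
qed

text \<open>
  Each failed comparison changes each of the two lengths by at most one.
\<close>

lemma sizes_squared_le:
  assumes "x < n"
  shows "(real (left_size n (x, e)))\<^sup>2 + (real (right_size n (x, e)))\<^sup>2
       \<le> (real x)\<^sup>2 + (real n - 1 - real x)\<^sup>2 + 4 * real n * real (card (err_set n (x, e)))"
proof -
  have *: "a\<^sup>2 \<le> b\<^sup>2 + 2 * real n * k" if "\<bar>a - b\<bar> \<le> k" "0 \<le> a" "a \<le> n" "0 \<le> b" "b \<le> n" for a b k :: real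
  proof -
    have "a\<^sup>2 - b\<^sup>2 = (a - b) * (a + b)" by (simp add: power2_eq_square algebra_simps)
    also have "\<dots> \<le> k * (2 * real n)"
      using that by (intro mult_mono) auto
    finally show ?thesis by (simp add: algebra_simps)
  qed
  have "(real (left_size n (x, e)))\<^sup>2 \<le> (real x)\<^sup>2 + 2 * real n * real (card (err_set n (x, e)))"
    using left_size_approx[OF assms, of e] size_le[of n "(x, e)"] assms by (intro *) auto
  moreover have "(real (right_size n (x, e)))\<^sup>2 \<le> (real n - 1 - real x)\<^sup>2 + 2 * real n * real (card (err_set n (x, e)))"
    using right_size_approx[OF assms, of e] size_le[of n "(x, e)"] assms by (intro *) auto
  ultimately show ?thesis by linarith
qed

context
  fixes n :: nat and p :: real
  assumes n: "0 < n" and p: "0 \<le> p" "p \<le> 1"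
begin

lemma integrable_first_step [simp]:
  fixes f :: "_ \<Rightarrow> 'c::{banach, second_countable_topology}"
  shows "integrable (measure_pmf (first_step n p)) f"
  by (intro integrable_measure_pmf_finite finite_set_first_step n)

lemma expectation_card_err:
  fixes f :: "real \<Rightarrow> real"
  assumes "x < n"
  shows "measure_pmf.expectation (Pi_pmf ({..<n} - {x}) False (\<lambda>_. bernoulli_pmf p))
       (\<lambda>e. f (real (card (err_set n (x, e))))) = (\<Sum>k\<le>n - 1. f (real k) * Bernstein (n - 1) k p)"
proof -
  have "measure_pmf.expectation (Pi_pmf ({..<n} - {x}) False (\<lambda>_. bernoulli_pmf p))
       (\<lambda>e. f (real (card (err_set n (x, e)))))
     = measure_pmf.expectation (binomial_pmf (n - 1) p) (\<lambda>k. f (real k))"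
    using p assms
    by (subst binomial_pmf_altdef'[where A = "{..<n} - {x}" and dflt = False]) (auto simp: err_set_def)
  also have "\<dots> = (\<Sum>k\<le>n - 1. f (real k) * Bernstein (n - 1) k p)"
    using p by (subst expectation_binomial_pmf') (auto simp: Bernstein_def mult_ac)
  finally show ?thesis .
qed

lemma expectation_errs: "measure_pmf.expectation (first_step n p) (\<lambda>w. real (card (err_set n w))) \<le> real n * p"
proof -
  have "measure_pmf.expectation (first_step n p) (\<lambda>w. real (card (err_set n w))) = real (n - 1) * p"
    using n by (simp add: expectation_first_step expectation_card_err[where f = "\<lambda>x. x"] sum_k_Bernstein)
  also have "\<dots> \<le> real n * p" using p by (intro mult_right_mono) auto
  finally show ?thesis .
qed

lemma expectation_errs_squared:
  "measure_pmf.expectation (first_step n p) (\<lambda>w. (real (card (err_set n w)))\<^sup>2) \<le> real n * p + (real n * p)\<^sup>2"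
proof -
  have "(\<Sum>k\<le>n - 1. (real k)\<^sup>2 * Bernstein (n - 1) k p)
      = (\<Sum>k\<le>n - 1. real k * (real k - 1) * Bernstein (n - 1) k p) + (\<Sum>k\<le>n - 1. real k * Bernstein (n - 1) k p)"
    unfolding sum.distrib[symmetric] by (intro sum.cong refl) (simp add: algebra_simps power2_eq_square)
  also have "\<dots> = real (n - 1) * (real (n - 1) - 1) * p\<^sup>2 + real (n - 1) * p"
    by (simp add: sum_k_Bernstein sum_kk_Bernstein)
  also have "\<dots> \<le> real n * p + (real n * p)\<^sup>2"
  proof -
    have "real (n - 1) * (real (n - 1) - 1) * p\<^sup>2 \<le> (real n * real n) * p\<^sup>2"
    proof (cases "n = 1")
      case False
      then show ?thesis using n by (intro mult_right_mono mult_mono) auto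
    qed simp
    moreover have "real (n - 1) * p \<le> real n * p" using p by (intro mult_right_mono) auto
    ultimately show ?thesis by (simp add: power2_eq_square algebra_simps)
  qed
  finally show ?thesis
    using n by (simp add: expectation_first_step expectation_card_err[where f = "\<lambda>x. x\<^sup>2"] field_simps)
qed

lemma sum_squares_le: "(\<Sum>x<m. (real x)\<^sup>2) \<le> (real m) ^ 3 / 3"
proof (induction m)
  case (Suc m)
  have "(real (Suc m))^3 / 3 = real m ^ 3 / 3 + (real m)\<^sup>2 + real m + 1 / 3"
    by (simp add: power2_eq_square power3_eq_cube field_simps)
  then show ?case using Suc by simp
qed simp

text \<open>
  The constant \<open>2/3\<close> is the mean of \<open>u\<^sup>2 + (1 - u)\<^sup>2\<close> for a uniform \<open>u\<close>. That it is less than 1 drives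
  all contraction arguments below; sums of first powers of the lengths would not contract.
\<close>

lemma expectation_sizes_squared:
  "measure_pmf.expectation (first_step n p) (\<lambda>w. (real (left_size n w))\<^sup>2 + (real (right_size n w))\<^sup>2)
     \<le> (2 / 3 + 4 * p) * (real n)\<^sup>2"
proof -
  have "measure_pmf.expectation (first_step n p) (\<lambda>w. (real (left_size n w))\<^sup>2 + (real (right_size n w))\<^sup>2)
     \<le> measure_pmf.expectation (first_step n p) (\<lambda>w. ((real (fst w))\<^sup>2 + (real n - 1 - real (fst w))\<^sup>2)
         + 4 * real n * real (card (err_set n w)))"
    using sizes_squared_le set_first_step[OF n]
    by (intro integral_mono_AE integrable_first_step AE_pmfI) (auto split: prod.splits)
  also have "\<dots> = measure_pmf.expectation (first_step n p) (\<lambda>w. (real (fst w))\<^sup>2 + (real n - 1 - real (fst w))\<^sup>2)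
         + 4 * real n * measure_pmf.expectation (first_step n p) (\<lambda>w. real (card (err_set n w)))"
    by (subst Bochner_Integration.integral_add) auto
  also have "measure_pmf.expectation (first_step n p) (\<lambda>w. (real (fst w))\<^sup>2 + (real n - 1 - real (fst w))\<^sup>2)
     = (\<Sum>x<n. (real x)\<^sup>2 + (real n - 1 - real x)\<^sup>2) / real n"
    using n by (simp add: expectation_first_step divide_inverse_commute sum.distrib algebra_simps)
  also have "(\<Sum>x<n. (real x)\<^sup>2 + (real n - 1 - real x)\<^sup>2) = (\<Sum>x<n. (real x)\<^sup>2) + (\<Sum>x<n. (real (n - Suc x))\<^sup>2)"
    unfolding sum.distrib by (intro arg_cong2[where f = "(+)"] sum.cong refl) (auto simp: of_nat_diff algebra_simps)
  also have "(\<Sum>x<n. (real (n - Suc x))\<^sup>2) = (\<Sum>x<n. (real x)\<^sup>2)"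
    by (rule sum.nat_diff_reindex)
  also have "((\<Sum>x<n. (real x)\<^sup>2) + (\<Sum>x<n. (real x)\<^sup>2)) / real n \<le> 2 / 3 * (real n)\<^sup>2"
    using sum_squares_le[of n] n by (simp add: field_simps power2_eq_square power3_eq_cube)
  also have "4 * real n * measure_pmf.expectation (first_step n p) (\<lambda>w. real (card (err_set n w))) \<le> 4 * real n * (real n * p)"
    using expectation_errs by (intro mult_left_mono) auto
  finally show ?thesis by (simp add: algebra_simps power2_eq_square)
qed

end

section \<open>Approximating the characteristic functions of the inversion numbers\<close>

text \<open>
  On the left half-plane the derivative of the exponential function is bounded by 1.
\<close>

lemma cmod_exp_diff_le:
  assumes "Re a \<le> 0" "Re b \<le> 0"
  shows "cmod (exp a - exp b) \<le> cmod (a - b)"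
proof -
  have "cmod (exp a - exp b) \<le> 1 * cmod (a - b)"
  proof (rule field_differentiable_bound[where S = "{z. Re z \<le> 0}" and f' = exp])
    show "convex {z. Re z \<le> 0}" by (rule convex_halfspace_Re_le)
  qed (use assms in \<open>auto intro!: derivative_eq_intros\<close>)
  then show ?thesis by simp
qed

lemma cmod_iexp_diff_le:
  fixes a b :: real
  shows "cmod (iexp a - iexp b) \<le> \<bar>a - b\<bar>"
proof -
  have "cmod (iexp a - iexp b) \<le> cmod (\<i> * complex_of_real a - \<i> * complex_of_real b)"
    by (rule cmod_exp_diff_le) auto
  also have "\<dots> = \<bar>a - b\<bar>"
    by (simp flip: right_diff_distrib of_real_diff add: norm_mult)
  finally show ?thesis .
qed

lemma cmod_mult3_diff_le:
  fixes a b c :: complex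
  assumes "cmod a \<le> 1" "cmod a' \<le> 1" "cmod b \<le> 1" "cmod b' \<le> 1" "cmod c \<le> 1" "cmod c' \<le> 1"
  shows "cmod (a * b * c - a' * b' * c') \<le> cmod (a - a') + cmod (b - b') + cmod (c - c')"
proof -
  have *: "cmod (x * y - x' * y') \<le> cmod (x - x') + cmod (y - y')"
    if "cmod y \<le> 1" "cmod x' \<le> 1" for x y x' y' :: complex
  proof -
    have "cmod (x * y - x' * y') = cmod ((x - x') * y + x' * (y - y'))" by (simp add: algebra_simps)
    also have "\<dots> \<le> cmod (x - x') * cmod y + cmod x' * cmod (y - y')"
      by (metis norm_triangle_ineq norm_mult)
    also have "\<dots> \<le> cmod (x - x') * 1 + 1 * cmod (y - y')"
      using that by (intro add_mono mult_left_mono mult_right_mono) auto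
    finally show ?thesis by simp
  qed
  have "cmod (a' * b') \<le> 1" using assms by (simp add: norm_mult mult_le_one)
  then have "cmod (a * b * c - a' * b' * c') \<le> cmod (a * b - a' * b') + cmod (c - c')"
    using assms by (intro *)
  also have "cmod (a * b - a' * b') \<le> cmod (a - a') + cmod (b - b')"
    using assms by (intro *)
  finally show ?thesis by simp
qed

lemma prob_space_unif01: "prob_space unif01"
  by (rule prob_spaceI) (simp add: emeasure_restrict_space space_restrict_space)

interpretation unif01: prob_space unif01
  by (rule prob_space_unif01)

lemma measure_unif01_Icc [simp]: "measure unif01 {0..1} = 1"
  using unif01.prob_space by (simp add: space_restrict_space)

lemma integral_unif01_eq:
  fixes f :: "real \<Rightarrow> 'a::euclidean_space"
  assumes "continuous_on {0..1} f"
  shows "(LINT x|unif01. f x) = integral {0..1} f"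
proof -
  have "set_integrable lborel {0..1} f"
    unfolding set_integrable_def using assms by (intro borel_integrable_compact) auto
  from set_borel_integral_eq_integral(2)[OF this] show ?thesis
    by (simp add: integral_restrict_space set_lebesgue_integral_def)
qed

lemma riemann_sum_error:
  fixes f :: "real \<Rightarrow> complex" and c :: real
  assumes n: "0 < n" and c: "0 \<le> c"
    and lip: "\<And>u v. u \<in> {0..1} \<Longrightarrow> v \<in> {0..1} \<Longrightarrow> cmod (f u - f v) \<le> c * \<bar>u - v\<bar>"
  shows "cmod ((\<Sum>y<n. f (real y / real n)) / of_nat n - (LINT x|unif01. f x)) \<le> c / real n"
proof -
  have "c-lipschitz_on {0..1} f"
    using lip c by (intro lipschitz_onI) (auto simp: dist_norm)
  then have cont: "continuous_on {0..1} f" by (rule lipschitz_on_continuous_on)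
  let ?a = "\<lambda>y. real y / real n"
  have sub: "{?a y..?a (Suc y)} \<subseteq> {0..1}" if "y < n" for y
    using that by (auto simp: field_simps intro: order.trans[of _ "real (Suc y) / real n"])
  have split: "m \<le> n \<Longrightarrow> integral {0..?a m} f = (\<Sum>y<m. integral {?a y..?a (Suc y)} f)" for m
  proof (induction m)
    case (Suc m)
    have "integral {0..?a m} f + integral {?a m..?a (Suc m)} f = integral {0..?a (Suc m)} f"
    proof (rule Henstock_Kurzweil_Integration.integral_combine)
      show "f integrable_on {0..?a (Suc m)}"
        using Suc.prems n by (intro integrable_continuous_real continuous_on_subset[OF cont]) (auto simp: field_simps)
    qed (auto simp: divide_right_mono)
    then show ?case using Suc by simp
  qed simp
  have each: "cmod (f (?a y) / of_nat n - integral {?a y..?a (Suc y)} f) \<le> c / real n * (1 / real n)"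
    if y: "y < n" for y
  proof -
    have int: "f integrable_on {?a y..?a (Suc y)}"
      using sub[OF y] cont by (intro integrable_continuous_real continuous_on_subset[OF cont])
    have le: "?a y \<le> ?a (Suc y)" by (simp add: divide_right_mono)
    have len: "?a (Suc y) - ?a y = 1 / real n" using n by (simp add: field_simps)
    have "f (?a y) / of_nat n - integral {?a y..?a (Suc y)} f = integral {?a y..?a (Suc y)} (\<lambda>x. f (?a y) - f x)"
      using int le len by (subst Henstock_Kurzweil_Integration.integral_diff) (auto simp: scaleR_conv_of_real)
    also have "cmod \<dots> \<le> c / real n * (?a (Suc y) - ?a y)"
    proof (rule integral_bound[OF le])
      show "continuous_on {?a y..?a (Suc y)} (\<lambda>x. f (?a y) - f x)"
        using sub[OF y] by (intro continuous_intros continuous_on_subset[OF cont])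
      fix t assume t: "t \<in> {?a y..?a (Suc y)}"
      have "cmod (f (?a y) - f t) \<le> c * \<bar>?a y - t\<bar>"
        using t le sub[OF y] by (intro lip subsetD[OF sub[OF y]]) auto
      also have "\<dots> \<le> c * (1 / real n)"
        using t c len by (intro mult_left_mono) auto
      finally show "cmod (f (?a y) - f t) \<le> c / real n" by simp
    qed
    finally show ?thesis by (simp only: len)
  qed
  have "(\<Sum>y<n. f (?a y)) / of_nat n - (LINT x|unif01. f x)
      = (\<Sum>y<n. f (?a y) / of_nat n - integral {?a y..?a (Suc y)} f)"
    using split[of n] n by (simp add: integral_unif01_eq[OF cont] sum_subtractf sum_divide_distrib)
  also have "cmod \<dots> \<le> (\<Sum>y<n. c / real n * (1 / real n))"
    using each by (intro sum_norm_le) auto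
  also have "\<dots> = c / real n" using n by simp
  finally show ?thesis .
qed

lemma unif01_measurableI: "f \<in> borel_measurable borel \<Longrightarrow> f \<in> borel_measurable unif01"
  by (auto intro!: measurable_restrict_space1)

text \<open>
  If the points of a Poisson process on the unit interval have intensity \<open>l\<close>, then the sum of
  their distances to \<open>u\<close> has the characteristic function \<open>\<lambda>s. exp (l * dist_exponent s u)\<close>;
  \<open>theta_char\<close> is the case that belongs to the law of the toll term, in the scaling in which
  the limit variable for the parameter \<open>l\<close> is multiplied by \<open>l\<^sup>2\<close>.
\<close>

definition dist_exponent :: "real \<Rightarrow> real \<Rightarrow> complex" where
  "dist_exponent s u = (LINT x|unif01. iexp (s * \<bar>x - u\<bar>) - 1)"

definition theta_char :: "real \<Rightarrow> real \<Rightarrow> real \<Rightarrow> complex" where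
  "theta_char s l u = exp (l * dist_exponent (s * l) u)"

lemma integrable_unif01_iexp: "integrable unif01 (\<lambda>x. iexp (s * \<bar>x - u\<bar>))"
proof -
  have "integrable unif01 (\<lambda>x. exp (\<i> * complex_of_real (s * \<bar>x - u\<bar>)))"
    by (rule unif01.integrable_iexp) (auto intro!: measurable_restrict_space1)
  then show ?thesis .
qed

lemma dist_exponent_eq: "dist_exponent s u = (LINT x|unif01. iexp (s * \<bar>x - u\<bar>)) - 1"
  unfolding dist_exponent_def
  by (subst Bochner_Integration.integral_diff[OF integrable_unif01_iexp]) (simp_all add: space_restrict_space)

lemma Re_dist_exponent_le: "Re (dist_exponent s u) \<le> 0"
proof -
  have "cmod (LINT x|unif01. iexp (s * \<bar>x - u\<bar>)) \<le> 1"
    by (rule order.trans[OF integral_norm_bound]) simp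
  then show ?thesis
    using complex_Re_le_cmod[of "LINT x|unif01. iexp (s * \<bar>x - u\<bar>)"] by (simp add: dist_exponent_eq)
qed

lemma Re_mult_dist_exponent_le: "0 \<le> (l::real) \<Longrightarrow> Re (l * dist_exponent s u) \<le> 0"
  using Re_dist_exponent_le[of s u] by (simp add: mult_nonneg_nonpos)

lemma dist_exponent_diff_le:
  assumes d: "\<And>x. x \<in> {0..1} \<Longrightarrow> \<bar>s * \<bar>x - u\<bar> - r * \<bar>x - v\<bar>\<bar> \<le> d"
  shows "cmod (dist_exponent s u - dist_exponent r v) \<le> d"
proof -
  let ?D = "\<lambda>x. iexp (s * \<bar>x - u\<bar>) - iexp (r * \<bar>x - v\<bar>)"
  have int: "integrable unif01 ?D"
    by (intro Bochner_Integration.integrable_diff integrable_unif01_iexp)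
  have "dist_exponent s u - dist_exponent r v = (LINT x|unif01. ?D x)"
    unfolding dist_exponent_eq
    by (subst Bochner_Integration.integral_diff[OF integrable_unif01_iexp integrable_unif01_iexp]) simp
  then have "cmod (dist_exponent s u - dist_exponent r v) \<le> (LINT x|unif01. cmod (?D x))"
    by (simp only: integral_norm_bound)
  also have "\<dots> \<le> (LINT x|unif01. d)"
    using int by (intro integral_mono integrable_norm order.trans[OF cmod_iexp_diff_le d])
      (auto simp: space_restrict_space)
  finally show ?thesis by simp
qed

lemma cmod_theta_char_le: "0 \<le> (l::real) \<Longrightarrow> cmod (theta_char s l u) \<le> 1"
  using Re_mult_dist_exponent_le[of l "s * l" u] by (simp add: theta_char_def)

lemma theta_char_lipschitz:
  fixes s l u v :: real
  assumes "0 \<le> l"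
  shows "cmod (theta_char s l u - theta_char s l v) \<le> \<bar>s\<bar> * l\<^sup>2 * \<bar>u - v\<bar>"
proof -
  have "cmod (theta_char s l u - theta_char s l v)
      \<le> cmod (l * dist_exponent (s * l) u - l * dist_exponent (s * l) v)"
    unfolding theta_char_def using assms by (intro cmod_exp_diff_le Re_mult_dist_exponent_le)
  also have "\<dots> = l * cmod (dist_exponent (s * l) u - dist_exponent (s * l) v)"
    using assms by (simp flip: right_diff_distrib add: norm_mult)
  also have "\<dots> \<le> l * (\<bar>s\<bar> * l * \<bar>u - v\<bar>)"
  proof (intro mult_left_mono dist_exponent_diff_le assms)
    fix x
    have "\<bar>s * l * \<bar>x - u\<bar> - s * l * \<bar>x - v\<bar>\<bar> = \<bar>s\<bar> * l * \<bar>\<bar>x - u\<bar> - \<bar>x - v\<bar>\<bar>"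
      using assms by (simp flip: right_diff_distrib add: abs_mult)
    also have "\<dots> \<le> \<bar>s\<bar> * l * \<bar>u - v\<bar>" using assms by (intro mult_left_mono) auto
    finally show "\<bar>s * l * \<bar>x - u\<bar> - s * l * \<bar>x - v\<bar>\<bar> \<le> \<bar>s\<bar> * l * \<bar>u - v\<bar>" .
  qed
  finally show ?thesis by (simp add: power2_eq_square mult_ac)
qed

text \<open>
  The constant is \<open>exp 1 * 2\<^sup>2\<close> rounded up: \<open>iexp t - 1\<close> has modulus at most 2.
\<close>

lemma cmod_one_plus_minus_exp_le:
  fixes p t :: real
  assumes p: "0 \<le> p" "p \<le> 1 / 24"
  shows "cmod (1 + of_real p * (iexp t - 1) - exp (of_real p * (iexp t - 1))) \<le> 12 * p\<^sup>2"
proof -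
  let ?z = "of_real p * (iexp t - 1)"
  have z: "cmod ?z \<le> 2 * p"
    using mult_left_mono[OF norm_triangle_ineq4[of "iexp t" 1] p(1)] p by (simp add: norm_mult)
  have "cmod (exp ?z - (\<Sum>k\<le>1. ?z ^ k / fact k)) \<le> exp \<bar>Re ?z\<bar> * (cmod ?z ^ Suc 1) / fact 1"
    by (rule Taylor_exp)
  also have "\<dots> \<le> exp 1 * (2 * p)\<^sup>2 / 1"
  proof -
    have "\<bar>Re ?z\<bar> \<le> 1" using z p abs_Re_le_cmod[of ?z] by linarith
    moreover have "cmod ?z ^ Suc 1 \<le> (2 * p)\<^sup>2"
      using z unfolding Suc_1 by (intro power_mono) auto
    ultimately show ?thesis by (simp del: power_Suc) (intro mult_mono; simp)
  qed
  also have "\<dots> \<le> 3 * (2 * p)\<^sup>2 / 1" using exp_le by (intro divide_right_mono mult_right_mono) auto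
  finally show ?thesis by (simp add: norm_minus_commute algebra_simps)
qed

lemma cmod_mixture_iexp_le:
  fixes p t :: real
  assumes p: "0 \<le> p" "p \<le> 1"
  shows "cmod (1 + of_real p * (iexp t - 1)) \<le> 1"
proof -
  have "1 + of_real p * (iexp t - 1) = of_real (1 - p) + of_real p * iexp t" by (simp add: algebra_simps)
  also have "cmod \<dots> \<le> cmod (of_real (1 - p)) + cmod (of_real p * iexp t)" by (rule norm_triangle_ineq)
  also have "\<dots> = 1" using p by (simp only: norm_mult norm_of_real) simp
  finally show ?thesis .
qed

text \<open>
  The failures being independent, the characteristic function is a product over the elements of
  the list. Its factors \<open>1 + p z\<close> are close to \<open>exp (p z)\<close>, and the sum in the resulting exponent is a
  Riemann sum of the integral in \<open>dist_exponent\<close>.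
\<close>

lemma errors_char_approx:
  fixes n :: nat and s p :: real
  assumes n: "0 < n" and p: "0 \<le> p" "p \<le> 1 / 24" and x: "x < n"
  shows "cmod (measure_pmf.expectation (Pi_pmf ({..<n} - {x}) False (\<lambda>_. bernoulli_pmf p))
            (\<lambda>e. iexp (s * p * err_dist n (x, e))) - theta_char s (n * p) (x / n))
       \<le> 12 * n * p\<^sup>2 + \<bar>s\<bar> * n * p\<^sup>2"
proof -
  let ?z = "\<lambda>y. iexp (s * p * \<bar>real y - real x\<bar>) - 1"
  let ?B = "{..<n} - {x}"
  have "measure_pmf.expectation (Pi_pmf ?B False (\<lambda>_. bernoulli_pmf p)) (\<lambda>e. iexp (s * p * err_dist n (x, e)))
     = measure_pmf.expectation (Pi_pmf ?B False (\<lambda>_. bernoulli_pmf p))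
        (\<lambda>e. \<Prod>y\<in>?B. if e y then iexp (s * p * \<bar>real y - real x\<bar>) else 1)"
  proof (intro Bochner_Integration.integral_cong refl)
    fix e :: "nat \<Rightarrow> bool"
    have "(\<Prod>y\<in>?B. if e y then iexp (s * p * \<bar>real y - real x\<bar>) else 1)
        = (\<Prod>y\<in>err_set n (x, e). iexp (s * p * \<bar>real y - real x\<bar>))"
      by (simp add: prod.inter_filter[symmetric] err_set_def)
    also have "\<dots> = iexp (s * p * err_dist n (x, e))"
      by (simp add: err_dist_def sum_distrib_left exp_sum)
    finally show "iexp (s * p * err_dist n (x, e))
        = (\<Prod>y\<in>?B. if e y then iexp (s * p * \<bar>real y - real x\<bar>) else 1)" by simp
  qed
  also have "\<dots> = (\<Prod>y\<in>?B. measure_pmf.expectation (bernoulli_pmf p)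
      (\<lambda>b. if b then iexp (s * p * \<bar>real y - real x\<bar>) else 1))"
    by (rule expectation_prod_Pi_pmf_field) auto
  also have "\<dots> = (\<Prod>y\<in>?B. 1 + of_real p * ?z y)"
  proof (intro prod.cong refl)
    fix y
    show "measure_pmf.expectation (bernoulli_pmf p) (\<lambda>b. if b then iexp (s * p * \<bar>real y - real x\<bar>) else 1)
      = 1 + of_real p * ?z y"
      using p by (subst integral_measure_pmf[where A = UNIV])
        (auto simp: UNIV_bool scaleR_conv_of_real algebra_simps)
  qed
  also have "\<dots> = (\<Prod>y<n. 1 + of_real p * ?z y)"
    using x by (intro prod.mono_neutral_left) auto
  finally have E: "measure_pmf.expectation (Pi_pmf ?B False (\<lambda>_. bernoulli_pmf p))
    (\<lambda>e. iexp (s * p * err_dist n (x, e))) = (\<Prod>y<n. 1 + of_real p * ?z y)" .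
  have Rez: "Re (?z y) \<le> 0" for y by (simp add: Re_exp)
  have "cmod ((\<Prod>y<n. 1 + of_real p * ?z y) - (\<Prod>y<n. exp (of_real p * ?z y)))
      \<le> (\<Sum>y<n. cmod (1 + of_real p * ?z y - exp (of_real p * ?z y)))"
    using p Rez by (intro norm_prod_diff cmod_mixture_iexp_le) (auto simp: mult_nonneg_nonpos simp del: Re_exp)
  also have "\<dots> \<le> (\<Sum>y<n. 12 * p\<^sup>2)"
    using p by (intro sum_mono cmod_one_plus_minus_exp_le)
  finally have 1: "cmod ((\<Prod>y<n. 1 + of_real p * ?z y) - (\<Prod>y<n. exp (of_real p * ?z y))) \<le> 12 * n * p\<^sup>2"
    by simp
  let ?f = "\<lambda>v. iexp (s * (n * p) * \<bar>v - x / n\<bar>) - 1"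
  have zf: "?z y = ?f (y / n)" for y
  proof -
    have "real n * \<bar>real y / real n - real x / real n\<bar> = \<bar>real y - real x\<bar>"
      using n by (simp flip: diff_divide_distrib)
    then show ?thesis by (simp add: mult.assoc mult.left_commute[of "real n"])
  qed
  have "cmod ((\<Sum>y<n. ?f (y / n)) / of_nat n - (LINT v|unif01. ?f v)) \<le> \<bar>s\<bar> * (n * p) / n"
  proof (rule riemann_sum_error[OF n])
    fix u v :: real
    have "cmod (?f u - ?f v) \<le> \<bar>s * (n * p) * \<bar>u - x / n\<bar> - s * (n * p) * \<bar>v - x / n\<bar>\<bar>"
      using cmod_iexp_diff_le[of "s * (n * p) * \<bar>u - x / n\<bar>" "s * (n * p) * \<bar>v - x / n\<bar>"] by simp
    also have "\<dots> = \<bar>s\<bar> * (n * p) * \<bar>\<bar>u - x / n\<bar> - \<bar>v - x / n\<bar>\<bar>"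
      using p by (simp flip: right_diff_distrib add: abs_mult)
    also have "\<dots> \<le> \<bar>s\<bar> * (n * p) * \<bar>u - v\<bar>" using p by (intro mult_left_mono) auto
    finally show "cmod (?f u - ?f v) \<le> \<bar>s\<bar> * (n * p) * \<bar>u - v\<bar>" .
  qed (use p in auto)
  then have R: "cmod ((\<Sum>y<n. ?z y) / of_nat n - dist_exponent (s * (n * p)) (x / n)) \<le> \<bar>s\<bar> * p"
    unfolding zf dist_exponent_def using n by simp
  have "cmod ((\<Prod>y<n. exp (of_real p * ?z y)) - theta_char s (n * p) (x / n))
      = cmod (exp (\<Sum>y<n. of_real p * ?z y) - exp (of_real (n * p) * dist_exponent (s * (n * p)) (x / n)))"
    by (simp add: theta_char_def exp_sum)
  also have "\<dots> \<le> cmod ((\<Sum>y<n. of_real p * ?z y) - of_real (n * p) * dist_exponent (s * (n * p)) (x / n))"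
  proof (rule cmod_exp_diff_le)
    show "Re (\<Sum>y<n. of_real p * ?z y) \<le> 0"
      using Rez p by (auto intro!: sum_nonpos mult_nonneg_nonpos simp del: Re_exp)
    show "Re (of_real (n * p) * dist_exponent (s * (n * p)) (x / n)) \<le> 0"
      using p by (intro Re_mult_dist_exponent_le) auto
  qed
  also have "(\<Sum>y<n. of_real p * ?z y) - of_real (n * p) * dist_exponent (s * (n * p)) (x / n)
     = of_real (n * p) * ((\<Sum>y<n. ?z y) / of_nat n - dist_exponent (s * (n * p)) (x / n))"
    unfolding sum_distrib_left[symmetric] using n by (subst right_diff_distrib[of "of_real (n * p)"]) simp
  also have "cmod \<dots> \<le> n * p * (\<bar>s\<bar> * p)"
    unfolding norm_mult[of "of_real (n * p)"] using R p by (intro mult_mono) (auto simp: norm_mult)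
  finally have 2: "cmod ((\<Prod>y<n. exp (of_real p * ?z y)) - theta_char s (n * p) (x / n)) \<le> \<bar>s\<bar> * n * p\<^sup>2"
    by (simp add: power2_eq_square mult_ac)
  show ?thesis unfolding E using norm_triangle_le[OF add_mono[OF 1 2]] by simp
qed

lemma norm_expectation_diff_le:
  fixes f g :: "_ \<Rightarrow> complex"
  assumes "finite (set_pmf D)" "\<And>w. w \<in> set_pmf D \<Longrightarrow> cmod (f w - g w) \<le> h w"
  shows "cmod (measure_pmf.expectation D f - measure_pmf.expectation D g) \<le> measure_pmf.expectation D h"
proof -
  note [simp] = integrable_measure_pmf_finite[OF assms(1)]
  have "measure_pmf.expectation D f - measure_pmf.expectation D g = measure_pmf.expectation D (\<lambda>w. f w - g w)"
    by simp
  also have "cmod \<dots> \<le> measure_pmf.expectation D (\<lambda>w. cmod (f w - g w))"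
    by (rule integral_norm_bound)
  also have "\<dots> \<le> measure_pmf.expectation D h"
    using assms by (intro integral_mono_AE AE_pmfI) auto
  finally show ?thesis .
qed

text \<open>
  The bound is of second order in \<open>n p\<close>, as required by the contraction. For \<open>p \<le> 1/24\<close> the factor in
  \<open>expectation_sizes_squared\<close> is at most \<open>5/6\<close>, the new inversions contribute \<open>2 (n p)\<^sup>2\<close> times the
  modulus of \<open>s\<close>, and \<open>12\<close> solves \<open>c = 2 + 5/6 * c\<close>.
\<close>

lemma inv_char_near_one:
  fixes n :: nat and s p :: real
  assumes p: "0 \<le> p" "p \<le> 1 / 24"
  shows "cmod (inv_char s p n - 1) \<le> 12 * \<bar>s\<bar> * (n * p)\<^sup>2"
proof (induction n rule: less_induct)
  case (less n)
  show ?case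
  proof (cases "n = 0")
    case False
    then have n: "0 < n" by simp
    have p1: "p \<le> 1" using p by simp
    note [simp] = integrable_first_step[OF n p(1) p1]
    let ?D = "first_step n p"
    let ?k = "\<lambda>w. real (card (err_set n w))"
    have "cmod (inv_char s p n - measure_pmf.expectation ?D (\<lambda>w. 1))
      \<le> measure_pmf.expectation ?D (\<lambda>w. 2 * \<bar>s\<bar> * p * n * ?k w + 12 * \<bar>s\<bar> * p\<^sup>2 *
          ((real (left_size n w))\<^sup>2 + (real (right_size n w))\<^sup>2))"
      unfolding inv_char_rec[OF n, of s p]
    proof (rule norm_expectation_diff_le[OF finite_set_first_step[OF n]])
      fix w assume w: "w \<in> set_pmf ?D"
      obtain x e where [simp]: "w = (x, e)" by (cases w)
      have x: "x < n" using w set_first_step[OF n] by auto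
      have "declared_set b x {..<n} e \<subseteq> {..<n} - {x}" for b by (auto simp: declared_set_def)
      then have "card (declared_set b x {..<n} e) < n" for b
        using card_mono[of "{..<n} - {x}" "declared_set b x {..<n} e"] x by (auto simp: le_less_trans)
      then have lt: "left_size n w < n" "right_size n w < n" by (auto simp: left_size_def right_size_def)
      have "cmod (iexp (s * p * real (new_inversions n w)) - iexp 0) \<le> \<bar>s\<bar> * p * real (new_inversions n w)"
        using cmod_iexp_diff_le[of "s * p * real (new_inversions n w)" 0] p by (simp add: abs_mult)
      also have "\<dots> \<le> \<bar>s\<bar> * p * (2 * real n * ?k w)"
        using new_inversions_le[OF x, of e] p by (intro mult_left_mono) auto
      finally have a: "cmod (iexp (s * p * real (new_inversions n w)) - 1) \<le> \<bar>s\<bar> * p * (2 * real n * ?k w)"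
        by simp
      have "cmod (iexp (s * p * real (new_inversions n w)) * inv_char s p (left_size n w) * inv_char s p (right_size n w) - 1 * 1 * 1)
        \<le> cmod (iexp (s * p * real (new_inversions n w)) - 1) + cmod (inv_char s p (left_size n w) - 1)
          + cmod (inv_char s p (right_size n w) - 1)"
        by (intro cmod_mult3_diff_le cmod_inv_char_le) auto
      also have "\<dots> \<le> \<bar>s\<bar> * p * (2 * real n * ?k w) + 12 * \<bar>s\<bar> * (left_size n w * p)\<^sup>2 + 12 * \<bar>s\<bar> * (right_size n w * p)\<^sup>2"
        using a less.IH[OF lt(1)] less.IH[OF lt(2)] by linarith
      finally show "cmod (iexp (s * p * real (new_inversions n w)) * inv_char s p (left_size n w) * inv_char s p (right_size n w) - 1)
         \<le> 2 * \<bar>s\<bar> * p * n * ?k w + 12 * \<bar>s\<bar> * p\<^sup>2 * ((real (left_size n w))\<^sup>2 + (real (right_size n w))\<^sup>2)"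
        by (simp add: algebra_simps power_mult_distrib)
    qed
    also have "\<dots> = 2 * \<bar>s\<bar> * p * n * measure_pmf.expectation ?D ?k + 12 * \<bar>s\<bar> * p\<^sup>2 *
        measure_pmf.expectation ?D (\<lambda>w. (real (left_size n w))\<^sup>2 + (real (right_size n w))\<^sup>2)"
      by (subst Bochner_Integration.integral_add) auto
    also have "\<dots> \<le> 2 * \<bar>s\<bar> * p * n * (real n * p) + 12 * \<bar>s\<bar> * p\<^sup>2 * ((2 / 3 + 4 * p) * (real n)\<^sup>2)"
      using expectation_errs[OF n p(1) p1] expectation_sizes_squared[OF n p(1) p1] p
      by (intro add_mono mult_left_mono) auto
    also have "\<dots> \<le> 2 * \<bar>s\<bar> * p * n * (real n * p) + 12 * \<bar>s\<bar> * p\<^sup>2 * (5 / 6 * (real n)\<^sup>2)"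
      using p by (intro add_left_mono mult_left_mono mult_right_mono) auto
    also have "\<dots> = 12 * \<bar>s\<bar> * (n * p)\<^sup>2" by (simp add: power2_eq_square algebra_simps)
    finally show ?thesis by simp
  qed simp
qed


text \<open>
  The constant in the error of one step of the recursion, see \<open>first_step_Psi\<close>. Its four summands
  come from, in this order: the error of \<open>err_dist\<close>, the replacement of the lengths of the sublists
  by \<open>x\<close> and \<open>n - x\<close> for a pivot of rank \<open>x\<close>, the Poisson approximation, and the replacement of the mean
  over all pivots by an integral.
\<close>

definition step_const :: "real \<Rightarrow> real \<Rightarrow> real \<Rightarrow> real" where
  "step_const s Lam Lip = \<bar>s\<bar> * (Lam + Lam\<^sup>2) + Lip * (2 * Lam + 1) + (12 + \<bar>s\<bar>) * Lam + (\<bar>s\<bar> * Lam + 2 * Lip)"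

text \<open>
  \<open>Psi l\<close> stands for the value at \<open>s\<close> of the characteristic function of \<open>l\<^sup>2 X(l)\<close>. Only its recursion
  and its regularity matter for the comparison with the algorithm.
\<close>

context
  fixes s Lam Lip c1 :: real and Psi :: "real \<Rightarrow> complex"
  assumes Lam: "0 \<le> Lam" and Lip: "0 \<le> Lip" and c1: "0 \<le> c1"
    and Psi_le: "\<And>l. 0 \<le> l \<Longrightarrow> l \<le> Lam \<Longrightarrow> cmod (Psi l) \<le> 1"
    and Psi_lip: "\<And>l l'. 0 \<le> l \<Longrightarrow> l \<le> Lam \<Longrightarrow> 0 \<le> l' \<Longrightarrow> l' \<le> Lam
        \<Longrightarrow> cmod (Psi l - Psi l') \<le> Lip * \<bar>l - l'\<bar>"
    and Psi_near_one: "\<And>l. 0 \<le> l \<Longrightarrow> l \<le> Lam \<Longrightarrow> cmod (Psi l - 1) \<le> c1 * l\<^sup>2"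
    and Psi_rec: "\<And>l. 0 < l \<Longrightarrow> l \<le> Lam
        \<Longrightarrow> Psi l = (LINT u|unif01. theta_char s l u * Psi (l * u) * Psi (l * (1 - u)))"
begin

lemma step_const_nonneg: "0 \<le> step_const s Lam Lip"
  using Lam Lip by (simp add: step_const_def)

text \<open>
  One round of the algorithm, followed by the limit variables in place of the two recursive calls,
  is close to the limit variable, because the latter satisfies the limiting recursion.
\<close>

lemma first_step_Psi:
  fixes n :: nat and p :: real
  assumes n: "0 < n" and p: "0 < p" "p \<le> 1 / 24" and np: "n * p \<le> Lam"
  shows "cmod (measure_pmf.expectation (first_step n p) (\<lambda>w. iexp (s * p * real (new_inversions n w))
            * Psi (left_size n w * p) * Psi (right_size n w * p)) - Psi (n * p)) \<le> step_const s Lam Lip * p"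
proof -
  let ?D = "first_step n p"
  let ?k = "\<lambda>w. real (card (err_set n w))"
  let ?X = "\<lambda>w. iexp (s * p * real (new_inversions n w)) * Psi (left_size n w * p) * Psi (right_size n w * p)"
  let ?Y = "\<lambda>w. iexp (s * p * err_dist n w) * Psi (real (fst w) * p) * Psi ((real n - real (fst w)) * p)"
  let ?g = "\<lambda>x. Psi (real x * p) * Psi ((real n - real x) * p)"
  have p': "0 \<le> p" "p \<le> 1" using p by auto
  note [simp] = integrable_first_step[OF n p']
  have range: "0 \<le> a * p" "a * p \<le> Lam" if "0 \<le> a" "a \<le> real n" for a
    using that p np order.trans[OF mult_right_mono[of a "real n" p] np] by auto
  \<comment> \<open>In \<open>?Y\<close> the failures influence the new inversions alone. The second argument, without the pivot,
    would be \<open>n - 1 - x\<close>; with \<open>n - x\<close> the two add up to the parameter \<open>n p\<close>, as in the limit.\<close>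
  have A1: "cmod (measure_pmf.expectation ?D ?X
        - measure_pmf.expectation ?D ?Y)
      \<le> measure_pmf.expectation ?D (\<lambda>w. \<bar>s\<bar> * p * (?k w)\<^sup>2 + 2 * Lip * p * ?k w + Lip * p)"
  proof (rule norm_expectation_diff_le[OF finite_set_first_step[OF n]])
    fix w assume w: "w \<in> set_pmf ?D"
    obtain x e where [simp]: "w = (x, e)" by (cases w)
    have x: "x < n" using w set_first_step[OF n] by auto
    have "cmod (?X w
        - iexp (s * p * err_dist n w) * Psi (x * p) * Psi ((real n - x) * p))
      \<le> cmod (iexp (s * p * real (new_inversions n w)) - iexp (s * p * err_dist n w))
        + cmod (Psi (left_size n w * p) - Psi (x * p)) + cmod (Psi (right_size n w * p) - Psi ((real n - x) * p))"
      using x size_le[of n w] range by (intro cmod_mult3_diff_le Psi_le) auto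
    also have "cmod (iexp (s * p * real (new_inversions n w)) - iexp (s * p * err_dist n w))
        \<le> \<bar>s\<bar> * p * (?k w)\<^sup>2"
    proof -
      have "\<bar>s * p * real (new_inversions n w) - s * p * err_dist n w\<bar>
          = \<bar>s\<bar> * p * \<bar>real (new_inversions n w) - err_dist n w\<bar>"
        using p by (simp flip: right_diff_distrib add: abs_mult)
      also have "\<dots> \<le> \<bar>s\<bar> * p * (?k w)\<^sup>2"
        using new_inversions_approx[OF x, of e] p by (intro mult_left_mono) auto
      finally show ?thesis by (rule order.trans[OF cmod_iexp_diff_le])
    qed
    also have "cmod (Psi (left_size n w * p) - Psi (x * p)) \<le> Lip * (p * ?k w)"
    proof -
      have "\<bar>left_size n w * p - x * p\<bar> = p * \<bar>real (left_size n w) - x\<bar>"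
        using p by (simp flip: left_diff_distrib add: abs_mult)
      also have "\<dots> \<le> p * ?k w"
        using left_size_approx[OF x, of e] p by (intro mult_left_mono) auto
      finally show ?thesis using x size_le[of n w] range Lip
        by (intro order.trans[OF Psi_lip] mult_left_mono) auto
    qed
    also have "cmod (Psi (right_size n w * p) - Psi ((real n - x) * p)) \<le> Lip * (p * (?k w + 1))"
    proof -
      have "\<bar>right_size n w * p - (real n - x) * p\<bar> = p * \<bar>real (right_size n w) - (real n - x)\<bar>"
        using p by (simp flip: left_diff_distrib add: abs_mult)
      also have "\<dots> \<le> p * (?k w + 1)"
        using right_size_approx[OF x, of e] p by (intro mult_left_mono) (auto simp: abs_le_iff)
      finally show ?thesis using x size_le[of n w] range Lip
        by (intro order.trans[OF Psi_lip] mult_left_mono) auto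
    qed
    finally show "cmod (?X w
        - ?Y w)
      \<le> \<bar>s\<bar> * p * (?k w)\<^sup>2 + 2 * Lip * p * ?k w + Lip * p"
      by (simp add: algebra_simps)
  qed
  also have "\<dots> = \<bar>s\<bar> * p * measure_pmf.expectation ?D (\<lambda>w. (?k w)\<^sup>2)
       + 2 * Lip * p * measure_pmf.expectation ?D ?k + Lip * p"
    by simp
  also have "\<dots> \<le> \<bar>s\<bar> * p * (Lam + Lam\<^sup>2) + 2 * Lip * p * Lam + Lip * p"
  proof (intro add_mono mult_left_mono order.refl)
    show "measure_pmf.expectation ?D ?k \<le> Lam" using expectation_errs[OF n p'] np by linarith
    have "(n * p)\<^sup>2 \<le> Lam\<^sup>2" using np p by (intro power_mono) auto
    then show "measure_pmf.expectation ?D (\<lambda>w. (?k w)\<^sup>2) \<le> Lam + Lam\<^sup>2"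
      using expectation_errs_squared[OF n p'] np by linarith
  qed (use p Lip in auto)
  finally have A: "cmod (measure_pmf.expectation ?D ?X
        - measure_pmf.expectation ?D ?Y)
      \<le> (\<bar>s\<bar> * (Lam + Lam\<^sup>2) + Lip * (2 * Lam + 1)) * p" by (simp add: algebra_simps)

  \<comment> \<open>Integrate out the failures for a fixed pivot.\<close>
  let ?E = "\<lambda>x. measure_pmf.expectation (Pi_pmf ({..<n} - {x}) False (\<lambda>_. bernoulli_pmf p))
            (\<lambda>e. iexp (s * p * err_dist n (x, e)))"
  let ?H = "\<lambda>u. theta_char s (n * p) u * Psi (n * p * u) * Psi (n * p * (1 - u))"
  have H: "?H (real x / real n) = theta_char s (n * p) (x / n) * ?g x" for x
  proof -
    have "n * p * (real x / real n) = x * p" "n * p * (1 - real x / real n) = (real n - real x) * p"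
      using n by (auto simp: field_simps)
    then show ?thesis by (simp only: mult.assoc)
  qed
  have "measure_pmf.expectation ?D ?Y
      = (\<Sum>x<n. ?E x * ?g x) / of_nat n"
    using n by (simp add: expectation_first_step scaleR_conv_of_real mult.assoc field_simps)
  then have "cmod (measure_pmf.expectation ?D ?Y
      - (\<Sum>x<n. ?H (real x / real n)) / of_nat n) = cmod (\<Sum>x<n. (?E x - theta_char s (n * p) (x / n)) * ?g x) / n"
    unfolding H by (simp only: diff_divide_distrib[symmetric] sum_subtractf[symmetric] norm_divide left_diff_distrib) simp
  also have "\<dots> \<le> (\<Sum>x<n. (12 + \<bar>s\<bar>) * Lam * p) / n"
  proof (intro divide_right_mono sum_norm_le)
    fix x assume "x \<in> {..<n}"
    then have x: "x < n" by simp
    have "cmod (?g x) \<le> 1"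
      unfolding norm_mult using x range by (intro mult_le_one Psi_le) auto
    then have "cmod ((?E x - theta_char s (n * p) (x / n)) * ?g x) \<le> (12 * n * p\<^sup>2 + \<bar>s\<bar> * n * p\<^sup>2) * 1"
      unfolding norm_mult[of "_ - _"] using errors_char_approx[OF n p'(1) p(2) x, of s]
      by (intro mult_mono) auto
    also have "\<dots> = (12 + \<bar>s\<bar>) * (n * p) * p" by (simp add: algebra_simps power2_eq_square)
    also have "\<dots> \<le> (12 + \<bar>s\<bar>) * Lam * p" using np p by (intro mult_right_mono mult_left_mono) auto
    finally show "cmod ((?E x - theta_char s (n * p) (x / n)) * ?g x) \<le> (12 + \<bar>s\<bar>) * Lam * p" .
  qed simp
  also have "\<dots> = (12 + \<bar>s\<bar>) * Lam * p" using n by simp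
  finally have B: "cmod (measure_pmf.expectation ?D ?Y
      - (\<Sum>x<n. ?H (real x / real n)) / of_nat n) \<le> (12 + \<bar>s\<bar>) * Lam * p" .

  \<comment> \<open>The Lipschitz constant of \<open>?H\<close> is of order \<open>n p\<close>, so dividing it by \<open>n\<close> leaves an error of order \<open>p\<close>.\<close>
  have "cmod ((\<Sum>x<n. ?H (real x / real n)) / of_nat n - (LINT u|unif01. ?H u))
     \<le> (\<bar>s\<bar> * (n * p)\<^sup>2 + 2 * Lip * (n * p)) / n"
  proof (rule riemann_sum_error[OF n])
    fix u v :: real assume uv: "u \<in> {0..1}" "v \<in> {0..1}"
    have r: "0 \<le> n * p * a" "n * p * a \<le> Lam" if "0 \<le> a" "a \<le> 1" for a
      using that p np order.trans[OF mult_left_mono[of a 1 "n * p"]] by auto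
    have d: "cmod (Psi (n * p * a) - Psi (n * p * b)) \<le> Lip * (n * p) * \<bar>a - b\<bar>"
      if "0 \<le> a" "a \<le> 1" "0 \<le> b" "b \<le> 1" for a b
      using Psi_lip[OF r[OF that(1,2)] r[OF that(3,4)]] p
      by (simp flip: right_diff_distrib add: abs_mult mult.assoc)
    have "cmod (?H u - ?H v) \<le> cmod (theta_char s (n * p) u - theta_char s (n * p) v)
      + cmod (Psi (n * p * u) - Psi (n * p * v)) + cmod (Psi (n * p * (1 - u)) - Psi (n * p * (1 - v)))"
      using uv p by (intro cmod_mult3_diff_le Psi_le r cmod_theta_char_le) auto
    also have "\<dots> \<le> \<bar>s\<bar> * (n * p)\<^sup>2 * \<bar>u - v\<bar> + Lip * (n * p) * \<bar>u - v\<bar> + Lip * (n * p) * \<bar>u - v\<bar>"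
      using uv p d[of u v] d[of "1 - u" "1 - v"] theta_char_lipschitz[of "n * p" s u v]
      by (intro add_mono) (auto simp: abs_minus_commute)
    finally show "cmod (?H u - ?H v) \<le> (\<bar>s\<bar> * (n * p)\<^sup>2 + 2 * Lip * (n * p)) * \<bar>u - v\<bar>"
      by (simp add: algebra_simps)
  qed (use p Lip in auto)
  also have "(\<bar>s\<bar> * (n * p)\<^sup>2 + 2 * Lip * (n * p)) / n = (\<bar>s\<bar> * (n * p) + 2 * Lip) * p"
    using n by (simp add: field_simps power2_eq_square)
  also have "\<dots> \<le> (\<bar>s\<bar> * Lam + 2 * Lip) * p"
    using p np by (intro mult_right_mono add_mono mult_left_mono) auto
  also have "(LINT u|unif01. ?H u) = Psi (n * p)"
    using n p np by (intro Psi_rec[symmetric]) auto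
  finally have C: "cmod ((\<Sum>x<n. ?H (real x / real n)) / of_nat n - Psi (n * p)) \<le> (\<bar>s\<bar> * Lam + 2 * Lip) * p" .
  have tri: "cmod (a - d) \<le> cmod (a - b) + cmod (b - c) + cmod (c - d)" for a b c d :: complex
    using norm_triangle_ineq[of "a - b" "b - c"] norm_triangle_ineq[of "a - c" "c - d"] by simp
  show ?thesis
    by (rule order.trans[OF tri order.trans[OF add_mono[OF add_mono[OF A B] C]]])
       (simp add: step_const_def algebra_simps)
qed

text \<open>
  Each application of the recursion contracts the quadratic part of the bound by \<open>5/6\<close>, while the
  constant part is doubled, as there are two recursive calls, and increased by the error of one
  round.
\<close>

lemma inv_char_approx:
  fixes n :: nat and p :: real
  assumes p: "0 < p" "p \<le> 1 / 24"
  shows "n * p \<le> Lam \<Longrightarrow> cmod (inv_char s p n - Psi (n * p))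
     \<le> (5 / 6) ^ K * (12 * \<bar>s\<bar> + c1) * (n * p)\<^sup>2 + (2 ^ K - 1) * step_const s Lam Lip * p"
proof (induction K arbitrary: n)
  case 0
  have "cmod (inv_char s p n - Psi (n * p)) \<le> cmod (inv_char s p n - 1) + cmod (Psi (n * p) - 1)"
    using norm_triangle_ineq4[of "inv_char s p n - 1" "Psi (n * p) - 1"] by simp
  also have "\<dots> \<le> 12 * \<bar>s\<bar> * (n * p)\<^sup>2 + c1 * (n * p)\<^sup>2"
    using p 0 by (intro add_mono inv_char_near_one Psi_near_one) auto
  finally show ?case by (simp add: algebra_simps)
next
  case (Suc K)
  show ?case
  proof (cases "n = 0")
    case True
    have "Psi 0 = 1" using Psi_near_one[of 0] Lam by simp
    moreover have "(1::real) \<le> 2 ^ Suc K" by (rule one_le_power) simp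
    ultimately show ?thesis using True step_const_nonneg p by simp
  next
    case False
    then have n: "0 < n" by simp
    have p': "0 \<le> p" "p \<le> 1" using p by auto
    note [simp] = integrable_first_step[OF n p']
    let ?D = "first_step n p"
    let ?a = "(5 / 6) ^ K * (12 * \<bar>s\<bar> + c1)" and ?b = "(2 ^ K - 1) * step_const s Lam Lip * p"
    have a: "0 \<le> ?a" using c1 by simp
    let ?F = "\<lambda>w. iexp (s * p * real (new_inversions n w)) * Psi (left_size n w * p) * Psi (right_size n w * p)"
    have "cmod (inv_char s p n - measure_pmf.expectation ?D ?F) \<le> measure_pmf.expectation ?D
        (\<lambda>w. ?a * p\<^sup>2 * ((real (left_size n w))\<^sup>2 + (real (right_size n w))\<^sup>2) + 2 * ?b)"
      unfolding inv_char_rec[OF n, of s p]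
    proof (rule norm_expectation_diff_le[OF finite_set_first_step[OF n]])
      fix w
      have r: "m * p \<le> Lam" if "m \<le> n" for m
        using that p order.trans[OF mult_right_mono Suc.prems, of "real m"] by simp
      have "cmod (iexp (s * p * real (new_inversions n w)) * inv_char s p (left_size n w) * inv_char s p (right_size n w) - ?F w)
         \<le> cmod (iexp (s * p * real (new_inversions n w)) - iexp (s * p * real (new_inversions n w)))
          + cmod (inv_char s p (left_size n w) - Psi (left_size n w * p))
          + cmod (inv_char s p (right_size n w) - Psi (right_size n w * p))"
        using p by (intro cmod_mult3_diff_le cmod_inv_char_le Psi_le r size_le) auto
      also have "\<dots> \<le> 0 + (?a * (left_size n w * p)\<^sup>2 + ?b) + (?a * (right_size n w * p)\<^sup>2 + ?b)"
        by (intro add_mono Suc.IH r size_le) auto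
      also have "\<dots> = ?a * p\<^sup>2 * ((real (left_size n w))\<^sup>2 + (real (right_size n w))\<^sup>2) + 2 * ?b"
        by (simp add: algebra_simps power_mult_distrib)
      finally show "cmod (iexp (s * p * real (new_inversions n w)) * inv_char s p (left_size n w) * inv_char s p (right_size n w) - ?F w)
         \<le> ?a * p\<^sup>2 * ((real (left_size n w))\<^sup>2 + (real (right_size n w))\<^sup>2) + 2 * ?b" .
    qed
    also have "\<dots> = ?a * p\<^sup>2 * measure_pmf.expectation ?D (\<lambda>w. (real (left_size n w))\<^sup>2 + (real (right_size n w))\<^sup>2) + 2 * ?b"
      by (subst Bochner_Integration.integral_add) auto
    also have "\<dots> \<le> ?a * p\<^sup>2 * ((2 / 3 + 4 * p) * (real n)\<^sup>2) + 2 * ?b"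
      using expectation_sizes_squared[OF n p'] a by (intro add_right_mono mult_left_mono) auto
    also have "\<dots> \<le> ?a * p\<^sup>2 * (5 / 6 * (real n)\<^sup>2) + 2 * ?b"
      using p a by (intro add_right_mono mult_left_mono mult_right_mono) auto
    finally have 1: "cmod (inv_char s p n - measure_pmf.expectation ?D ?F) \<le> ?a * p\<^sup>2 * (5 / 6 * (real n)\<^sup>2) + 2 * ?b" .
    have "cmod (inv_char s p n - Psi (n * p)) \<le> cmod (inv_char s p n - measure_pmf.expectation ?D ?F)
       + cmod (measure_pmf.expectation ?D ?F - Psi (n * p))"
      using norm_triangle_ineq[of "inv_char s p n - measure_pmf.expectation ?D ?F"
         "measure_pmf.expectation ?D ?F - Psi (n * p)"] by simp
    also have "\<dots> \<le> (5 / 6) ^ Suc K * (12 * \<bar>s\<bar> + c1) * (n * p)\<^sup>2 + (2 * ?b + step_const s Lam Lip * p)"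
    proof -
      have "?a * p\<^sup>2 * (5 / 6 * (real n)\<^sup>2) = (5 / 6) ^ Suc K * (12 * \<bar>s\<bar> + c1) * (n * p)\<^sup>2"
        by (simp add: power_mult_distrib algebra_simps)
      with add_mono[OF 1 first_step_Psi[OF n p Suc.prems]] show ?thesis by linarith
    qed
    finally show ?thesis by (simp add: algebra_simps)
  qed
qed

end

section \<open>Division points of the limit variable as a binary tree\<close>

definition tree_idx :: "(nat \<times> nat) set" where
  "tree_idx = {(k, j). 1 \<le> j \<and> j \<le> 2 ^ k}"

abbreviation trees :: "(nat \<times> nat \<Rightarrow> real) measure" where
  "trees \<equiv> PiM tree_idx (\<lambda>_. unif01)"

definition left_tree :: "(nat \<times> nat \<Rightarrow> real) \<Rightarrow> nat \<times> nat \<Rightarrow> real" where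
  "left_tree u = (\<lambda>(k, j)\<in>tree_idx. u (Suc k, j))"

definition right_tree :: "(nat \<times> nat \<Rightarrow> real) \<Rightarrow> nat \<times> nat \<Rightarrow> real" where
  "right_tree u = (\<lambda>(k, j)\<in>tree_idx. u (Suc k, 2 ^ k + j))"

text \<open>
  \<open>gap k u x\<close> is the distance from \<open>x\<close> to the point that divides, in round \<open>k + 1\<close>, the interval of
  level \<open>k\<close> containing \<open>x\<close> (see \<open>Jidx_gap\<close>). The recursion follows the path from the root: the
  first division point \<open>u (0, 1)\<close> cuts the unit interval into two, each of which is, up to scaling,
  divided according to one of the two subtrees.
\<close>

fun gap :: "nat \<Rightarrow> (nat \<times> nat \<Rightarrow> real) \<Rightarrow> real \<Rightarrow> real" where
  "gap 0 u x = \<bar>x - u (0, 1)\<bar>"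
| "gap (Suc k) u x =
     (if x < u (0, 1) then u (0, 1) * gap k (left_tree u) (x / u (0, 1))
      else (1 - u (0, 1)) * gap k (right_tree u) ((x - u (0, 1)) / (1 - u (0, 1))))"

text \<open>
  The points on both sides of the first division point are scaled copies of those of the subtrees.
\<close>

lemma Ypt_left:
  "m \<le> 2 ^ k \<Longrightarrow> Ypt u (Suc k) m = u (0, 1) * Ypt (left_tree u) k m"
proof (induction k arbitrary: m)
  case 0
  then consider "m = 0" | "m = 1" by fastforce
  then show ?case by cases auto
next
  case (Suc k)
  have "m div 2 \<le> 2 ^ k" using Suc.prems by auto
  note IH = Suc.IH[OF this]
  show ?case
  proof (cases "even m")
    case True
    then show ?thesis using IH by simp
  next
    case False
    with Suc.prems have m: "Suc (m div 2) \<le> 2 ^ k" by (auto elim!: oddE)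
    then have "left_tree u (k, Suc (m div 2)) = u (Suc k, Suc (m div 2))"
      by (simp add: left_tree_def tree_idx_def)
    then show ?thesis using False IH Suc.IH[OF m]
      by (simp del: Ypt.simps(2) add: Ypt.simps(2)[of u "Suc k"] Ypt.simps(2)[of "left_tree u" k] algebra_simps)
  qed
qed

lemma Ypt_right:
  "m \<le> 2 ^ k \<Longrightarrow> Ypt u (Suc k) (2 ^ k + m) = u (0, 1) + (1 - u (0, 1)) * Ypt (right_tree u) k m"
proof (induction k arbitrary: m)
  case 0
  then consider "m = 0" | "m = 1" by fastforce
  then show ?case by cases auto
next
  case (Suc k)
  have "m div 2 \<le> 2 ^ k" using Suc.prems by auto
  note IH = Suc.IH[OF this]
  have d: "(2 ^ Suc k + m) div 2 = 2 ^ k + m div 2" by simp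
  show ?case
  proof (cases "even m")
    case True
    then have "even (2 ^ Suc k + m)" by simp
    with True show ?thesis using IH d by (simp only: Ypt.simps(2)[of u "Suc k"] Ypt.simps(2)[of "right_tree u" k] if_True)
  next
    case False
    with Suc.prems have m: "Suc (m div 2) \<le> 2 ^ k" by (auto elim!: oddE)
    then have *: "right_tree u (k, Suc (m div 2)) = u (Suc k, Suc (2 ^ k + m div 2))"
      by (simp add: right_tree_def tree_idx_def)
    have "\<not> even (2 ^ Suc k + m)" using False by simp
    then show ?thesis using False IH Suc.IH[OF m]
      by (simp only: Ypt.simps(2)[of u "Suc k"] Ypt.simps(2)[of "right_tree u" k] if_False d * add_Suc_right)
         (simp add: algebra_simps)
  qed
qed

lemma Ypt_step_le:
  assumes "\<forall>i\<in>tree_idx. 0 \<le> u i \<and> u i \<le> 1"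
  shows "m < 2 ^ k \<Longrightarrow> Ypt u k m \<le> Ypt u k (Suc m)"
proof (induction k arbitrary: m)
  case (Suc k)
  have m: "m div 2 < 2 ^ k" using Suc.prems by auto
  let ?U = "u (k, Suc (m div 2))"
  have U: "0 \<le> ?U" "?U \<le> 1" using assms m by (auto simp: tree_idx_def)
  have le: "Ypt u k (m div 2) \<le> Ypt u k (Suc (m div 2))" using Suc.IH[OF m] .
  have a: "(1 - ?U) * Ypt u k (m div 2) + ?U * Ypt u k (Suc (m div 2)) - Ypt u k (m div 2)
      = ?U * (Ypt u k (Suc (m div 2)) - Ypt u k (m div 2))" by (simp add: algebra_simps)
  have b: "Ypt u k (Suc (m div 2)) - ((1 - ?U) * Ypt u k (m div 2) + ?U * Ypt u k (Suc (m div 2)))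
      = (1 - ?U) * (Ypt u k (Suc (m div 2)) - Ypt u k (m div 2))" by (simp add: algebra_simps)
  have "0 \<le> ?U * (Ypt u k (Suc (m div 2)) - Ypt u k (m div 2))"
     "0 \<le> (1 - ?U) * (Ypt u k (Suc (m div 2)) - Ypt u k (m div 2))"
    using U le by auto
  then have mid: "Ypt u k (m div 2) \<le> (1 - ?U) * Ypt u k (m div 2) + ?U * Ypt u k (Suc (m div 2))"
    "(1 - ?U) * Ypt u k (m div 2) + ?U * Ypt u k (Suc (m div 2)) \<le> Ypt u k (Suc (m div 2))"
    unfolding a[symmetric] b[symmetric] by (simp_all only: diff_ge_0_iff_ge)
  show ?case
  proof (cases "even m")
    case True
    then have "Suc m div 2 = m div 2" by simp
    then show ?thesis using True mid(1) by (simp only: Ypt.simps even_Suc if_True if_False not_True_eq_False)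
  next
    case False
    then have "Suc m div 2 = Suc (m div 2)" by (auto elim: oddE)
    then show ?thesis using False mid(2) by (simp only: Ypt.simps even_Suc if_True if_False not_False_eq_True)
  qed
qed simp

lemma Ypt_mono:
  assumes "\<forall>i\<in>tree_idx. 0 \<le> u i \<and> u i \<le> 1" "m \<le> m'" "m' \<le> 2 ^ k"
  shows "Ypt u k m \<le> Ypt u k m'"
  using assms(2,3)
proof (induction m' rule: dec_induct)
  case (step i)
  then show ?case using Ypt_step_le[OF assms(1), of i k] by simp
qed simp

lemma left_tree_in: "\<forall>i\<in>tree_idx. P (u i) \<Longrightarrow> \<forall>i\<in>tree_idx. P (left_tree u i)"
  by (auto simp: left_tree_def tree_idx_def)

lemma right_tree_in: "\<forall>i\<in>tree_idx. P (u i) \<Longrightarrow> \<forall>i\<in>tree_idx. P (right_tree u i)"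
  by (auto simp: right_tree_def tree_idx_def)

definition in_cell :: "(nat \<times> nat \<Rightarrow> real) \<Rightarrow> nat \<Rightarrow> real \<Rightarrow> nat \<Rightarrow> bool" where
  "in_cell u k x j \<longleftrightarrow> 1 \<le> j \<and> j \<le> 2 ^ k \<and> Ypt u k (j - 1) \<le> x \<and> x < Ypt u k j"

lemma in_cell_unique:
  assumes u: "\<forall>i\<in>tree_idx. 0 \<le> u i \<and> u i \<le> 1" and "in_cell u k x i" "in_cell u k x j"
  shows "i = j"
proof -
  have "\<not> i < j" if "in_cell u k x i" "in_cell u k x j" for i j
  proof
    assume "i < j"
    then have "Ypt u k i \<le> Ypt u k (j - 1)" using that by (intro Ypt_mono[OF u]) (auto simp: in_cell_def)
    then show False using that by (auto simp: in_cell_def)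
  qed
  from this[OF assms(2,3)] this[OF assms(3,2)] show ?thesis by simp
qed

text \<open>
  The cell containing \<open>x\<close> is found in the subtree on whose side of the root \<open>x\<close> lies.
\<close>

lemma in_cell_gap:
  assumes "\<forall>i\<in>tree_idx. 0 < u i \<and> u i < 1" "0 \<le> x" "x < 1"
  shows "\<exists>j. in_cell u k x j \<and> \<bar>x - Ypt u (Suc k) (2 * j - 1)\<bar> = gap k u x"
  using assms
proof (induction k arbitrary: u x)
  case 0
  then show ?case by (intro exI[of _ 1]) (simp add: in_cell_def)
next
  case (Suc k)
  let ?a = "u (0, 1)"
  have a: "0 < ?a" "?a < 1" using Suc.prems(1) by (auto simp: tree_idx_def)
  show ?case
  proof (cases "x < ?a")
    case True
    have "0 \<le> x / ?a" "x / ?a < 1" using True a Suc.prems by auto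
    from Suc.IH[OF left_tree_in[OF Suc.prems(1)] this] obtain j where
      j: "in_cell (left_tree u) k (x / ?a) j"
      and g: "\<bar>x / ?a - Ypt (left_tree u) (Suc k) (2 * j - 1)\<bar> = gap k (left_tree u) (x / ?a)" by auto
    have "in_cell u (Suc k) x j"
      using j a by (auto simp: in_cell_def Ypt_left field_simps simp del: Ypt.simps)
    moreover have "\<bar>x - Ypt u (Suc (Suc k)) (2 * j - 1)\<bar> = gap (Suc k) u x"
    proof -
      have "Ypt u (Suc (Suc k)) (2 * j - 1) = ?a * Ypt (left_tree u) (Suc k) (2 * j - 1)"
        using j by (intro Ypt_left) (auto simp: in_cell_def)
      then have "x - Ypt u (Suc (Suc k)) (2 * j - 1) = ?a * (x / ?a - Ypt (left_tree u) (Suc k) (2 * j - 1))"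
        using a by (simp add: right_diff_distrib)
      then show ?thesis using True a g by (simp del: Ypt.simps add: abs_mult)
    qed
    ultimately show ?thesis by blast
  next
    case False
    have "0 \<le> (x - ?a) / (1 - ?a)" "(x - ?a) / (1 - ?a) < 1" using False a Suc.prems by auto
    from Suc.IH[OF right_tree_in[OF Suc.prems(1)] this] obtain j where
      j: "in_cell (right_tree u) k ((x - ?a) / (1 - ?a)) j"
      and g: "\<bar>(x - ?a) / (1 - ?a) - Ypt (right_tree u) (Suc k) (2 * j - 1)\<bar>
        = gap k (right_tree u) ((x - ?a) / (1 - ?a))" by auto
    have "in_cell u (Suc k) x (2 ^ k + j)"
    proof -
      have e: "2 ^ k + j - 1 = 2 ^ k + (j - 1)" using j by (auto simp: in_cell_def)
      have "j - 1 \<le> 2 ^ k" "j \<le> 2 ^ k" using j by (auto simp: in_cell_def)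
      from this[THEN Ypt_right, of u] show ?thesis
        using j a unfolding in_cell_def e by (auto simp: field_simps simp del: Ypt.simps)
    qed
    moreover have "\<bar>x - Ypt u (Suc (Suc k)) (2 * (2 ^ k + j) - 1)\<bar> = gap (Suc k) u x"
    proof -
      have "2 * (2 ^ k + j) - 1 = 2 ^ Suc k + (2 * j - 1)" using j by (auto simp: in_cell_def)
      moreover have "2 * j - 1 \<le> 2 ^ Suc k" using j by (auto simp: in_cell_def)
      ultimately have eq: "Ypt u (Suc (Suc k)) (2 * (2 ^ k + j) - 1)
          = ?a + (1 - ?a) * Ypt (right_tree u) (Suc k) (2 * j - 1)"
        by (simp only: Ypt_right)
      then have "x - Ypt u (Suc (Suc k)) (2 * (2 ^ k + j) - 1)
          = (1 - ?a) * ((x - ?a) / (1 - ?a) - Ypt (right_tree u) (Suc k) (2 * j - 1))"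
      proof -
        have "(1 - ?a) * ((x - ?a) / (1 - ?a)) = x - ?a"
          using a by (subst times_divide_eq_right) (rule nonzero_mult_div_cancel_left, simp)
        then show ?thesis
          by (simp only: right_diff_distrib[of "1 - ?a" "(x - ?a) / (1 - ?a)"] eq diff_diff_eq)
      qed
      then show ?thesis using False a g by (simp del: Ypt.simps add: abs_mult)
    qed
    ultimately show ?thesis by blast
  qed
qed

lemma Jidx_gap:
  assumes u: "\<forall>i\<in>tree_idx. 0 < u i \<and> u i < 1" and x: "0 \<le> x" "x < 1"
  shows "\<bar>x - Ypt u (Suc k) (Jidx u (Suc k) x)\<bar> = gap k u x"
proof -
  obtain j where j: "in_cell u k x j" "\<bar>x - Ypt u (Suc k) (2 * j - 1)\<bar> = gap k u x"
    using in_cell_gap[OF assms] by blast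
  have "(THE j. in_cell u k x j) = j"
  proof (rule the_equality)
    show "in_cell u k x j" by (rule j(1))
  next
    have u': "\<forall>i\<in>tree_idx. 0 \<le> u i \<and> u i \<le> 1" using u by (auto simp: less_imp_le)
    fix i assume "in_cell u k x i"
    from in_cell_unique[OF u' this j(1)] show "i = j" .
  qed
  then have "Jidx u (Suc k) x = 2 * j - 1"
    by (simp add: Jidx_def in_cell_def)
  with j show ?thesis by simp
qed

lemma gap_nonneg: "\<forall>i\<in>tree_idx. 0 \<le> u i \<and> u i \<le> 1 \<Longrightarrow> 0 \<le> gap k u x"
proof (induction k arbitrary: u x)
  case (Suc k)
  have "0 \<le> u (0, 1)" "u (0, 1) \<le> 1" using Suc.prems by (auto simp: tree_idx_def)
  then show ?case using Suc.IH[OF left_tree_in[OF Suc.prems]] Suc.IH[OF right_tree_in[OF Suc.prems]]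
    by auto
qed simp

lemma root_in_tree_idx [simp]: "(0, Suc 0) \<in> tree_idx"
  by (simp add: tree_idx_def)

lemma measurable_tree_component: "(\<lambda>u. u i) \<in> borel_measurable trees"
proof (cases "i \<in> tree_idx")
  case True
  have "(\<lambda>u. u i) \<in> measurable trees unif01" using True by (rule measurable_component_singleton)
  then show ?thesis by (rule measurable_compose) (auto intro!: measurable_restrict_space1)
next
  case False
  have "(\<lambda>u. u i) \<in> borel_measurable trees \<longleftrightarrow> (\<lambda>_. undefined :: real) \<in> borel_measurable trees"
  proof (rule measurable_cong)
    fix u assume "u \<in> space trees"
    then have "u \<in> PiE tree_idx (\<lambda>_. space unif01)" by (simp only: space_PiM)
    then show "u i = undefined" using False by (rule PiE_arb)
  qed
  then show ?thesis by simp
qed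

lemma measurable_tree_component' [measurable (raw)]:
  "f \<in> M \<rightarrow>\<^sub>M trees \<Longrightarrow> (\<lambda>x. f x i) \<in> borel_measurable M"
  by (rule measurable_compose[OF _ measurable_tree_component])

lemma measurable_left_tree [measurable]: "left_tree \<in> trees \<rightarrow>\<^sub>M trees"
  unfolding left_tree_def case_prod_beta
  by (intro measurable_restrict measurable_component_singleton) (auto simp: tree_idx_def)

lemma measurable_right_tree [measurable]: "right_tree \<in> trees \<rightarrow>\<^sub>M trees"
  unfolding right_tree_def case_prod_beta
  by (intro measurable_restrict measurable_component_singleton) (auto simp: tree_idx_def)

lemma measurable_gap [measurable (raw)]:
  "f \<in> M \<rightarrow>\<^sub>M trees \<Longrightarrow> g \<in> borel_measurable M \<Longrightarrow> (\<lambda>w. gap k (f w) (g w)) \<in> borel_measurable M"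
proof (induction k arbitrary: f g)
  case (Suc k)
  note [measurable] = Suc
  show ?case by simp
qed simp

lemma measurable_Ypt [measurable (raw)]:
  "f \<in> M \<rightarrow>\<^sub>M trees \<Longrightarrow> (\<lambda>w. Ypt (f w) k m) \<in> borel_measurable M"
proof (induction k arbitrary: m)
  case (Suc k)
  note [measurable] = Suc
  show ?case by simp
qed simp

lemma space_trees: "u \<in> space trees \<Longrightarrow> \<forall>i\<in>tree_idx. 0 \<le> u i \<and> u i \<le> 1"
  by (auto simp: space_PiM space_restrict_space)

text \<open>
  On the whole space the division points are weakly increasing, so that \<open>x\<close> lies in at most one cell
  and the definite description in \<open>Jidx\<close> is a measurable choice, even where no cell contains \<open>x\<close>.
\<close>

lemma measurable_cell_distance [measurable (raw)]:
  assumes [measurable]: "f \<in> M \<rightarrow>\<^sub>M trees" "g \<in> borel_measurable M"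
  shows "(\<lambda>w. \<bar>g w - Ypt (f w) (Suc k) (Jidx (f w) (Suc k) (g w))\<bar>) \<in> borel_measurable M"
proof -
  have T: "(\<lambda>w. THE j. 1 \<le> j \<and> j \<le> 2 ^ k \<and> Ypt (f w) k (j - 1) \<le> g w \<and> g w < Ypt (f w) k j)
      \<in> measurable M (count_space UNIV)"
  proof (rule measurable_THE[where I = UNIV])
    fix w i j assume "w \<in> space M"
    then have "\<forall>i\<in>tree_idx. 0 \<le> f w i \<and> f w i \<le> 1"
      using measurable_space[OF assms(1)] by (intro space_trees)
    from in_cell_unique[OF this, of k "g w" i j]
    show "1 \<le> i \<and> i \<le> 2 ^ k \<and> Ypt (f w) k (i - 1) \<le> g w \<and> g w < Ypt (f w) k i \<Longrightarrow>
       1 \<le> j \<and> j \<le> 2 ^ k \<and> Ypt (f w) k (j - 1) \<le> g w \<and> g w < Ypt (f w) k j \<Longrightarrow> i = j"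
      by (simp add: in_cell_def)
  qed auto
  have J: "(\<lambda>w. Jidx (f w) (Suc k) (g w)) \<in> measurable M (count_space UNIV)"
    unfolding Jidx_def diff_Suc_1 by (rule measurable_compose[OF T, where g = "\<lambda>j. 2 * j - 1"]) simp
  have "(\<lambda>w. Ypt (f w) (Suc k) (Jidx (f w) (Suc k) (g w))) \<in> borel_measurable M"
    by (rule measurable_compose_countable[where f = "\<lambda>j w. Ypt (f w) (Suc k) j", OF measurable_Ypt[OF assms(1)] J])
  from borel_measurable_diff[OF assms(2) this] show ?thesis
    by (rule borel_measurable_abs)
qed

abbreviation marks :: "(nat \<times> nat \<Rightarrow> real) measure" where
  "marks \<equiv> PiM ({1..} \<times> UNIV) (\<lambda>_. unif01)"

abbreviation counts :: "real \<Rightarrow> (nat \<Rightarrow> nat) measure" where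
  "counts lam \<equiv> PiM {1..} (\<lambda>_. measure_pmf (poisson_pmf lam))"

lemma X_space_eq: "X_space lam = counts lam \<Otimes>\<^sub>M (marks \<Otimes>\<^sub>M trees)"
  by (simp add: X_space_def tree_idx_def)

lemma sets_counts: "sets (counts lam) = sets (counts lam')"
  by (intro sets_PiM_cong) auto

text \<open>
  On the summands, \<open>gap\<close> agrees almost surely with the distances in \<open>X_var\<close>, and it is \<open>gap\<close> that
  satisfies a recursion.
\<close>

definition X_part :: "nat \<Rightarrow> real \<Rightarrow> (nat \<Rightarrow> nat) \<times> (nat \<times> nat \<Rightarrow> real) \<times> (nat \<times> nat \<Rightarrow> real) \<Rightarrow> real" where
  "X_part K lam = (\<lambda>(N, V, u). (1 / lam) * (\<Sum>k<K. \<Sum>i<N (Suc k). gap k u (V (Suc k, i))))"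

lemma measurable_count_component [measurable (raw)]:
  assumes "f \<in> M \<rightarrow>\<^sub>M counts lam" 
  shows "(\<lambda>x. f x (Suc k)) \<in> M \<rightarrow>\<^sub>M count_space UNIV"
proof -
  have "(\<lambda>N. N (Suc k)) \<in> counts lam \<rightarrow>\<^sub>M measure_pmf (poisson_pmf lam)"
    by (rule measurable_component_singleton) simp
  from measurable_compose[OF assms this] show ?thesis by simp
qed

lemma measurable_mark_component [measurable (raw)]:
  assumes "f \<in> M \<rightarrow>\<^sub>M marks" 
  shows "(\<lambda>x. f x (Suc k, i)) \<in> borel_measurable M"
proof -
  have "(\<lambda>V. V (Suc k, i)) \<in> marks \<rightarrow>\<^sub>M unif01"
    by (rule measurable_component_singleton) simp
  then have "(\<lambda>V. V (Suc k, i)) \<in> borel_measurable marks"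
    by (rule measurable_compose) (auto intro!: measurable_restrict_space1)
  from measurable_compose[OF assms this] show ?thesis by simp
qed

lemma measurable_random_sum [measurable (raw)]:
  fixes f :: "nat \<Rightarrow> 'a \<Rightarrow> real"
  assumes [measurable]: "g \<in> M \<rightarrow>\<^sub>M count_space UNIV" "\<And>i. f i \<in> borel_measurable M"
  shows "(\<lambda>w. \<Sum>i<g w. f i w) \<in> borel_measurable M"
  by (rule measurable_compose_countable[of "\<lambda>n w. \<Sum>i<n. f i w"]) auto

text \<open>
  The parameter is included in the argument: this is what measurability of the family of laws needs.
\<close>

lemma measurable_X_var [measurable]:
  "(\<lambda>(lam, w). X_var lam w) \<in> borel \<Otimes>\<^sub>M (counts lam' \<Otimes>\<^sub>M (marks \<Otimes>\<^sub>M trees)) \<rightarrow>\<^sub>M borel"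
  unfolding X_var_def case_prod_beta by measurable

lemma measurable_X_part [measurable]:
  "(\<lambda>(lam, w). X_part K lam w) \<in> borel \<Otimes>\<^sub>M (counts lam' \<Otimes>\<^sub>M (marks \<Otimes>\<^sub>M trees)) \<rightarrow>\<^sub>M borel"
  unfolding X_part_def case_prod_beta by measurable

declare measurable_tree_component' [measurable del]
declare measurable_mark_component [measurable del]
declare measurable_count_component [measurable del]

section \<open>Characteristic functions of the partial sums\<close>

lemma integrable_bounded_complex:
  fixes f :: "'a \<Rightarrow> complex"
  assumes "prob_space M" "f \<in> borel_measurable M" "\<And>x. cmod (f x) \<le> B"
  shows "integrable M f"
proof -
  interpret prob_space M by fact
  show ?thesis by (rule integrable_const_bound[where B = B]) (use assms in auto)
qed

lemma PiM_integral_prod: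
  fixes f :: "'i \<Rightarrow> 'a \<Rightarrow> 'b::{real_normed_field, banach, second_countable_topology}"
  assumes Q: "prob_space Q" and J: "finite J" "J \<subseteq> I" and f: "\<And>i. i \<in> J \<Longrightarrow> integrable Q (f i)"
  shows "(LINT w|PiM I (\<lambda>_. Q). (\<Prod>i\<in>J. f i (w i))) = (\<Prod>i\<in>J. LINT x|Q. f i x)"
proof -
  interpret Q: prob_space Q by fact
  interpret product_prob_space "\<lambda>_. Q" I by unfold_locales
  have [measurable]: "\<And>i. i \<in> J \<Longrightarrow> f i \<in> borel_measurable Q" using f by auto
  have "(LINT w|PiM I (\<lambda>_. Q). (\<Prod>i\<in>J. f i (w i))) = (LINT w|PiM I (\<lambda>_. Q). (\<Prod>i\<in>J. f i (restrict w J i)))"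
    by (intro Bochner_Integration.integral_cong prod.cong) auto
  also have "\<dots> = (LINT w|distr (PiM I (\<lambda>_. Q)) (PiM J (\<lambda>_. Q)) (\<lambda>x. restrict x J). (\<Prod>i\<in>J. f i (w i)))"
    using J(2) by (subst integral_distr) (auto intro!: measurable_restrict_subset)
  also have "\<dots> = (\<Prod>i\<in>J. LINT x|Q. f i x)"
    unfolding distr_PiM_restrict_finite[OF J] using J f by (intro product_integral_prod) auto
  finally show ?thesis .
qed

lemma poisson_pgf:
  fixes c :: complex
  assumes "0 < lam" "cmod c \<le> 1"
  shows "(LINT n|measure_pmf (poisson_pmf lam). c ^ n) = exp (lam * (c - 1))"
proof -
  have e: "pmf (poisson_pmf lam) n *\<^sub>R c ^ n = ((lam * c) ^ n /\<^sub>R fact n) * exp (- lam)" for n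
    using assms by (simp add: scaleR_conv_of_real exp_of_real power_mult_distrib field_simps)
  have sums: "(\<lambda>n. pmf (poisson_pmf lam) n *\<^sub>R c ^ n) sums (exp (lam * c) * exp (- lam))"
    unfolding e using sums_mult2[OF exp_converges] .
  have int: "integrable (measure_pmf (poisson_pmf lam)) (\<lambda>n. c ^ n)"
    using assms by (intro integrable_bounded_complex[where B = 1] measure_pmf.prob_space_axioms)
       (auto simp: norm_power power_le_one)
  then have "integrable (count_space UNIV) (\<lambda>n. pmf (poisson_pmf lam) n *\<^sub>R c ^ n)"
    by (simp add: measure_pmf_eq_density integrable_density)
  then have "(LINT n|measure_pmf (poisson_pmf lam). c ^ n) = (\<Sum>n. pmf (poisson_pmf lam) n *\<^sub>R c ^ n)"
    by (simp add: measure_pmf_eq_density integral_density integral_count_space_nat)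
  also have "\<dots> = exp (lam * c) * exp (- lam)" using sums by (rule sums_unique[symmetric])
  also have "\<dots> = exp (lam * (c - 1))" by (simp add: exp_add[symmetric] right_diff_distrib exp_of_real flip: exp_of_real)
  finally show ?thesis .
qed

interpretation trees: prob_space trees
  by (intro prob_space_PiM prob_space_unif01)

interpretation marks: prob_space marks
  by (intro prob_space_PiM prob_space_unif01)

lemma prob_space_counts: "prob_space (counts lam)"
  by (intro prob_space_PiM measure_pmf.prob_space_axioms)

lemma prob_space_X_space: "prob_space (X_space lam)"
  unfolding X_space_eq
  by (intro prob_space_pair prob_space_counts marks.prob_space_axioms trees.prob_space_axioms)

lemma measurable_ident_unif01: "(\<lambda>x. x) \<in> borel_measurable unif01"
  by (intro unif01_measurableI) auto

text \<open>
  The characteristic function of the contribution of one point of level \<open>k + 1\<close>, given the tree.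
\<close>

definition gap_char :: "real \<Rightarrow> nat \<Rightarrow> (nat \<times> nat \<Rightarrow> real) \<Rightarrow> complex" where
  "gap_char s k u = (LINT x|unif01. iexp (s * gap k u x))"

lemma measurable_gap_char [measurable]: "gap_char s k \<in> borel_measurable trees"
proof -
  have "(\<lambda>(u, x). iexp (s * gap k u x)) \<in> borel_measurable (trees \<Otimes>\<^sub>M unif01)"
  proof -
    have [measurable]: "snd \<in> borel_measurable (trees \<Otimes>\<^sub>M unif01)"
      by (rule measurable_compose[OF measurable_snd measurable_ident_unif01])
    show ?thesis unfolding case_prod_beta by measurable
  qed
  then show ?thesis unfolding gap_char_def[abs_def] by (rule unif01.borel_measurable_lebesgue_integral)
qed

lemma cmod_gap_char_le: "cmod (gap_char s k u) \<le> 1"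
  unfolding gap_char_def
  by (rule order.trans[OF integral_norm_bound]) simp

lemma Re_gap_char_le: "Re (gap_char s k u) \<le> 1"
  using abs_Re_le_cmod[of "gap_char s k u"] cmod_gap_char_le[of s k u] by linarith

lemma measurable_X_part_single [measurable]: "X_part K lam \<in> borel_measurable (X_space lam')"
proof -
  have "(\<lambda>w. (\<lambda>(l, w). X_part K l w) (lam, w)) \<in> borel_measurable (counts lam' \<Otimes>\<^sub>M (marks \<Otimes>\<^sub>M trees))"
    by (rule measurable_compose[OF measurable_Pair1' measurable_X_part]) simp
  then show ?thesis by (simp add: X_space_eq)
qed

lemma measurable_X_var_single [measurable]: "X_var lam \<in> borel_measurable (X_space lam')"
proof -
  have "(\<lambda>w. (\<lambda>(l, w). X_var l w) (lam, w)) \<in> borel_measurable (counts lam' \<Otimes>\<^sub>M (marks \<Otimes>\<^sub>M trees))"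
    by (rule measurable_compose[OF measurable_Pair1' measurable_X_var]) simp
  then show ?thesis by (simp add: X_space_eq)
qed

definition X_part_law :: "nat \<Rightarrow> real \<Rightarrow> real measure" where
  "X_part_law K lam = distr (X_space lam) borel (X_part K lam)"

text \<open>
  Given the tree, the sum over each level is a compound Poisson variable, and the levels are
  independent: integrating out the marks gives powers of \<open>gap_char\<close>, and integrating out the numbers
  of points gives their generating functions.
\<close>

lemma char_X_part_law:
  assumes lam: "0 < lam"
  shows "char (X_part_law K lam) t
     = (LINT u|trees. exp (lam * (\<Sum>k<K. gap_char (t / lam) k u - 1)))"
proof -
  interpret C: prob_space "counts lam" by (rule prob_space_counts)
  interpret VT: pair_prob_space marks trees ..
  interpret CVT: pair_prob_space "counts lam" "marks \<Otimes>\<^sub>M trees" ..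
  interpret CT: pair_prob_space "counts lam" trees ..
  let ?s = "t / lam"
  define F where "F = (\<lambda>w. iexp (t * X_part K lam w))"
  have mF: "F \<in> borel_measurable (X_space lam)"
    unfolding F_def by simp
  have bF: "cmod (F w) \<le> 1" for w by (simp add: F_def case_prod_beta)
  have iF: "integrable (counts lam \<Otimes>\<^sub>M (marks \<Otimes>\<^sub>M trees)) F"
    using mF bF by (intro integrable_bounded_complex[where B = 1] CVT.prob_space_axioms) (simp add: X_space_eq)
  \<comment> \<open>Integrate the three components of the outcome in the order marks, numbers of points, tree.\<close>
  have V: "(LINT V|marks. F (N, V, u)) = (\<Prod>k<K. gap_char ?s k u ^ N (Suc k))" if u: "u \<in> space trees" for N u
  proof -
    let ?J = "(\<lambda>(k, i). (Suc k, i)) ` (SIGMA k:{..<K}. {..<N (Suc k)})"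
    have inj: "inj_on (\<lambda>(k, i). (Suc k, i)) A" for A :: "(nat \<times> nat) set" by (auto simp: inj_on_def)
    have "F (N, V, u) = (\<Prod>j\<in>?J. iexp (?s * gap (fst j - 1) u (V j)))" for V
    proof -
      have "t * X_part K lam (N, V, u) = (\<Sum>k<K. \<Sum>i<N (Suc k). ?s * gap k u (V (Suc k, i)))"
        by (simp add: X_part_def sum_distrib_left)
      also have "\<dots> = (\<Sum>(k, i)\<in>(SIGMA k:{..<K}. {..<N (Suc k)}). ?s * gap k u (V (Suc k, i)))"
        by (subst sum.Sigma) auto
      also have "\<dots> = (\<Sum>j\<in>?J. ?s * gap (fst j - 1) u (V j))"
        by (subst sum.reindex[OF inj]) (simp add: case_prod_beta)
      finally have e: "t * X_part K lam (N, V, u) = (\<Sum>j\<in>?J. ?s * gap (fst j - 1) u (V j))" .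
      have "F (N, V, u) = iexp (\<Sum>j\<in>?J. ?s * gap (fst j - 1) u (V j))" unfolding F_def e ..
      also have "\<dots> = (\<Prod>j\<in>?J. iexp (?s * gap (fst j - 1) u (V j)))"
        unfolding of_real_sum sum_distrib_left by (rule exp_sum) auto
      finally show ?thesis .
    qed
    then have "(LINT V|marks. F (N, V, u)) = (LINT V|marks. (\<Prod>j\<in>?J. iexp (?s * gap (fst j - 1) u (V j))))" by simp
    also have "\<dots> = (\<Prod>j\<in>?J. LINT x|unif01. iexp (?s * gap (fst j - 1) u x))"
    proof (rule PiM_integral_prod[OF prob_space_unif01])
      have "(\<lambda>x. gap k u x) \<in> borel_measurable unif01" for k
        using u by (intro measurable_gap measurable_ident_unif01) auto
      then show "integrable unif01 (\<lambda>x. iexp (?s * gap (fst j - 1) u x))" for j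
        by (intro integrable_bounded_complex[where B = 1] prob_space_unif01) auto
    qed auto
    also have "\<dots> = (\<Prod>(k, i)\<in>(SIGMA k:{..<K}. {..<N (Suc k)}). gap_char ?s k u)"
      by (subst prod.reindex[OF inj]) (simp add: case_prod_beta gap_char_def)
    also have "\<dots> = (\<Prod>k<K. gap_char ?s k u ^ N (Suc k))"
      by (subst prod.Sigma[symmetric]) auto
    finally show ?thesis .
  qed
  have N: "(LINT N|counts lam. (\<Prod>k<K. gap_char ?s k u ^ N (Suc k))) = exp (lam * (\<Sum>k<K. gap_char ?s k u - 1))" for u
  proof -
    have "(LINT N|counts lam. (\<Prod>k<K. gap_char ?s k u ^ N (Suc k)))
        = (LINT N|counts lam. (\<Prod>j\<in>Suc ` {..<K}. gap_char ?s (j - 1) u ^ N j))"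
      by (subst prod.reindex) auto
    also have "\<dots> = (\<Prod>j\<in>Suc ` {..<K}. LINT n|measure_pmf (poisson_pmf lam). gap_char ?s (j - 1) u ^ n)"
      using cmod_gap_char_le[of ?s _ u]
      by (intro PiM_integral_prod measure_pmf.prob_space_axioms integrable_bounded_complex[where B = 1])
         (auto simp: norm_power power_le_one)
    also have "\<dots> = (\<Prod>k<K. exp (lam * (gap_char ?s k u - 1)))"
      using lam cmod_gap_char_le by (subst prod.reindex) (auto simp: poisson_pgf)
    finally show ?thesis by (simp add: exp_sum sum_distrib_left)
  qed
  have mN: "(\<lambda>N. N (Suc k)) \<in> counts lam \<rightarrow>\<^sub>M count_space UNIV" for k
  proof -
    have "(\<lambda>N. N (Suc k)) \<in> counts lam \<rightarrow>\<^sub>M measure_pmf (poisson_pmf lam)"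
      by (rule measurable_component_singleton) simp
    then show ?thesis by simp
  qed
  have m2: "(\<lambda>(N, u). \<Prod>k<K. gap_char ?s k u ^ N (Suc k)) \<in> borel_measurable (counts lam \<Otimes>\<^sub>M trees)"
    unfolding case_prod_beta
  proof (intro borel_measurable_prod)
    fix k
    show "(\<lambda>x. gap_char ?s k (snd x) ^ fst x (Suc k)) \<in> borel_measurable (counts lam \<Otimes>\<^sub>M trees)"
      by (rule measurable_compose_countable[where f = "\<lambda>n x. gap_char ?s k (snd x) ^ n",
            OF _ measurable_compose[OF measurable_fst mN]]) measurable
  qed
  have i2: "integrable (counts lam \<Otimes>\<^sub>M trees) (\<lambda>(N, u). \<Prod>k<K. gap_char ?s k u ^ N (Suc k))"
    using m2 by (rule integrable_bounded_complex[where B = 1, OF CT.prob_space_axioms])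
       (auto simp: prod_norm[symmetric] norm_power power_le_one cmod_gap_char_le intro!: prod_le_1)
  have "char (X_part_law K lam) t = (LINT w|X_space lam. F w)"
    unfolding char_def X_part_law_def by (subst integral_distr) (auto simp: F_def case_prod_beta)
  also have "\<dots> = (LINT N|counts lam. LINT w|(marks \<Otimes>\<^sub>M trees). F (N, w))"
    unfolding X_space_eq by (rule CVT.integral_fst'[OF iF, symmetric])
  also have "\<dots> = (LINT N|counts lam. LINT u|trees. LINT V|marks. F (N, V, u))"
  proof (intro Bochner_Integration.integral_cong refl)
    fix N assume N: "N \<in> space (counts lam)"
    have "integrable (marks \<Otimes>\<^sub>M trees) (\<lambda>w. F (N, w))"
      using mF bF measurable_compose[OF measurable_Pair1'[OF N], of F "marks \<Otimes>\<^sub>M trees" borel]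
      by (intro integrable_bounded_complex[where B = 1] VT.prob_space_axioms) (simp_all add: X_space_eq)
    then show "(LINT w|(marks \<Otimes>\<^sub>M trees). F (N, w)) = (LINT u|trees. LINT V|marks. F (N, V, u))"
      using VT.integral_snd[of "\<lambda>V u. F (N, V, u)"] by (simp add: case_prod_beta')
  qed
  also have "\<dots> = (LINT N|counts lam. LINT u|trees. (\<Prod>k<K. gap_char ?s k u ^ N (Suc k)))"
    by (intro Bochner_Integration.integral_cong refl V)
  also have "\<dots> = (LINT u|trees. LINT N|counts lam. (\<Prod>k<K. gap_char ?s k u ^ N (Suc k)))"
    by (rule CT.Fubini_integral[OF i2, symmetric])
  finally show ?thesis unfolding N .
qed


text \<open>
  The two pieces are mapped onto the unit interval by affine substitutions. The degenerate cases
  \<open>a = 0\<close> and \<open>a = 1\<close> hold as well, since division by zero affects at most one point.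
\<close>

lemma integral_unif01_split:
  fixes f g :: "real \<Rightarrow> complex" and a :: real
  assumes a: "0 \<le> a" "a \<le> 1"
    and f [measurable]: "f \<in> borel_measurable borel" and g [measurable]: "g \<in> borel_measurable borel"
    and bound: "\<And>x. cmod (f x) \<le> 1" "\<And>x. cmod (g x) \<le> 1"
  shows "(LINT x|unif01. (if x < a then f (x / a) else g ((x - a) / (1 - a))))
       = a * (LINT x|unif01. f x) + (1 - a) * (LINT x|unif01. g x)"
proof -
  consider "a = 0" | "a = 1" | "0 < a" "a < 1" using a by linarith
  then show ?thesis
  proof cases
    case 1
    have "(LINT x|unif01. (if x < a then f (x / a) else g ((x - a) / (1 - a)))) = (LINT x|unif01. g x)"
      using 1 by (intro Bochner_Integration.integral_cong) (auto simp: space_restrict_space)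
    then show ?thesis using 1 by simp
  next
    case 2
    have "AE x in lborel. x \<noteq> (1::real)" by (rule AE_lborel_singleton)
    then have "AE x in unif01. (if x < a then f (x / a) else g ((x - a) / (1 - a))) = f x"
      using 2 by (subst AE_restrict_space_iff) auto
    then have "(LINT x|unif01. (if x < a then f (x / a) else g ((x - a) / (1 - a)))) = (LINT x|unif01. f x)"
      by (intro integral_cong_AE unif01_measurableI) measurable
    then show ?thesis using 2 by simp
  next
    case 3
    have I: "(LINT x|unif01. h x) = (LINT x|lborel. indicator {0..1} x *\<^sub>R h x)" for h :: "real \<Rightarrow> complex"
      by (subst integral_restrict_space) auto
    have "(LINT x|unif01. (if x < a then f (x / a) else g ((x - a) / (1 - a))))
        = (LINT x|unif01. indicator {..<a} x *\<^sub>R f (x / a) + indicator {a..} x *\<^sub>R g ((x - a) / (1 - a)))"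
      by (intro Bochner_Integration.integral_cong) (auto simp: indicator_def)
    also have "\<dots> = (LINT x|unif01. indicator {..<a} x *\<^sub>R f (x / a))
        + (LINT x|unif01. indicator {a..} x *\<^sub>R g ((x - a) / (1 - a)))"
      by (intro Bochner_Integration.integral_add integrable_bounded_complex[where B = 1]
            prob_space_unif01 unif01_measurableI)
         (auto simp: indicator_def bound)
    also have "(LINT x|unif01. indicator {..<a} x *\<^sub>R f (x / a)) = a * (LINT x|unif01. f x)"
    proof -
      have "(LINT x|unif01. indicator {..<a} x *\<^sub>R f (x / a))
          = (LINT x|lborel. indicator {0..<a} x *\<^sub>R f (x / a))"
        unfolding I using 3 by (intro Bochner_Integration.integral_cong) (auto simp: indicator_def)
      also have "\<dots> = \<bar>a\<bar> *\<^sub>R (LINT x|lborel. indicator {0..<a} (0 + a * x) *\<^sub>R f ((0 + a * x) / a))"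
        using 3 by (intro lborel_integral_real_affine) auto
      also have "(LINT x|lborel. indicator {0..<a} (0 + a * x) *\<^sub>R f ((0 + a * x) / a))
          = (LINT x|lborel. indicator {0..1} x *\<^sub>R f x)"
      proof (rule integral_cong_AE)
        have "AE x in lborel. x \<noteq> (1::real)" by (rule AE_lborel_singleton)
        then show "AE x in lborel. indicator {0..<a} (0 + a * x) *\<^sub>R f ((0 + a * x) / a) = indicator {0..1} x *\<^sub>R f x"
          by eventually_elim (use 3 in \<open>auto simp: indicator_def zero_le_mult_iff\<close>)
      qed (auto intro!: borel_measurable_scaleR measurable_compose[OF _ f])
      finally show ?thesis using 3 by (simp add: I scaleR_conv_of_real)
    qed
    also have "(LINT x|unif01. indicator {a..} x *\<^sub>R g ((x - a) / (1 - a))) = (1 - a) * (LINT x|unif01. g x)"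
    proof -
      have "(LINT x|unif01. indicator {a..} x *\<^sub>R g ((x - a) / (1 - a)))
          = (LINT x|lborel. indicator {a..1} x *\<^sub>R g ((x - a) / (1 - a)))"
        unfolding I using 3 by (intro Bochner_Integration.integral_cong) (auto simp: indicator_def)
      also have "\<dots> = \<bar>1 - a\<bar> *\<^sub>R (LINT x|lborel. indicator {a..1} (a + (1 - a) * x) *\<^sub>R g (((a + (1 - a) * x) - a) / (1 - a)))"
        using 3 by (intro lborel_integral_real_affine) auto
      also have "(LINT x|lborel. indicator {a..1} (a + (1 - a) * x) *\<^sub>R g (((a + (1 - a) * x) - a) / (1 - a)))
          = (LINT x|lborel. indicator {0..1} x *\<^sub>R g x)"
      proof (intro Bochner_Integration.integral_cong refl)
        fix x :: real
        have "a + (1 - a) * x \<le> 1 \<longleftrightarrow> (1 - a) * x \<le> (1 - a) * 1" by (simp add: algebra_simps)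
        also have "\<dots> \<longleftrightarrow> x \<le> 1" using 3 by (subst mult_le_cancel_left_pos) auto
        finally show "indicator {a..1} (a + (1 - a) * x) *\<^sub>R g (((a + (1 - a) * x) - a) / (1 - a)) = indicator {0..1} x *\<^sub>R g x"
          using 3 by (auto simp: indicator_def zero_le_mult_iff)
      qed
      finally show ?thesis using 3 by (simp add: I scaleR_conv_of_real)
    qed
    finally show ?thesis .
  qed
qed

lemma measurable_gap_snd: "u \<in> space trees \<Longrightarrow> gap k u \<in> borel_measurable borel"
  by (rule measurable_gap[of "\<lambda>_. u" borel "\<lambda>x. x"]) auto

lemma left_tree_space: "left_tree u \<in> space trees" if "u \<in> space trees"
  using measurable_space[OF measurable_left_tree that] .

lemma right_tree_space: "right_tree u \<in> space trees" if "u \<in> space trees"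
  using measurable_space[OF measurable_right_tree that] .

text \<open>
  A uniform point falls to the left of the root \<open>a\<close> with probability \<open>a\<close> and is then uniform on the
  left interval, where distances are those of the left subtree scaled by \<open>a\<close>; similarly on the right.
\<close>

lemma gap_char_Suc:
  assumes u: "u \<in> space trees"
  shows "gap_char s (Suc k) u = u (0, 1) * gap_char (s * u (0, 1)) k (left_tree u)
           + (1 - u (0, 1)) * gap_char (s * (1 - u (0, 1))) k (right_tree u)"
proof -
  let ?a = "u (0, 1)"
  note [measurable] = measurable_gap_snd[OF left_tree_space[OF u]] measurable_gap_snd[OF right_tree_space[OF u]]
  have a: "0 \<le> ?a" "?a \<le> 1" using space_trees[OF u] by (auto simp: tree_idx_def)
  have "gap_char s (Suc k) u = (LINT x|unif01. (if x < ?a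
      then iexp (s * ?a * gap k (left_tree u) (x / ?a))
      else iexp (s * (1 - ?a) * gap k (right_tree u) ((x - ?a) / (1 - ?a)))))"
    unfolding gap_char_def by (intro Bochner_Integration.integral_cong) (auto simp: mult_ac)
  also have "\<dots> = ?a * (LINT x|unif01. iexp (s * ?a * gap k (left_tree u) x))
      + (1 - ?a) * (LINT x|unif01. iexp (s * (1 - ?a) * gap k (right_tree u) x))"
    using a by (intro integral_unif01_split) auto
  finally show ?thesis by (simp add: gap_char_def)
qed

text \<open>
  The inverse of the map that takes a tree to its root and its two subtrees.
\<close>

definition join_trees ::
    "real \<Rightarrow> (nat \<times> nat \<Rightarrow> real) \<Rightarrow> (nat \<times> nat \<Rightarrow> real) \<Rightarrow> nat \<times> nat \<Rightarrow> real" where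
  "join_trees a l r = (\<lambda>(k, j)\<in>tree_idx.
     if k = 0 then a else if j \<le> 2 ^ (k - 1) then l (k - 1, j) else r (k - 1, j - 2 ^ (k - 1)))"

definition left_idx :: "nat \<times> nat \<Rightarrow> nat \<times> nat" where
  "left_idx = (\<lambda>(k, j). (Suc k, j))"

definition right_idx :: "nat \<times> nat \<Rightarrow> nat \<times> nat" where
  "right_idx = (\<lambda>(k, j). (Suc k, 2 ^ k + j))"

lemma tree_idx_eq: "tree_idx = insert (0, 1) (left_idx ` tree_idx \<union> right_idx ` tree_idx)"
proof (intro equalityI subsetI)
  fix i assume "i \<in> tree_idx"
  then obtain k j where i: "i = (k, j)" "1 \<le> j" "j \<le> 2 ^ k" by (auto simp: tree_idx_def)
  show "i \<in> insert (0, 1) (left_idx ` tree_idx \<union> right_idx ` tree_idx)"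
  proof (cases k)
    case 0
    then show ?thesis using i by simp
  next
    case (Suc k')
    show ?thesis
    proof (cases "j \<le> 2 ^ k'")
      case True
      then have "i = left_idx (k', j)" "(k', j) \<in> tree_idx" using i Suc by (auto simp: left_idx_def tree_idx_def)
      then show ?thesis by blast
    next
      case False
      then have "i = right_idx (k', j - 2 ^ k')" "(k', j - 2 ^ k') \<in> tree_idx"
        using i Suc by (auto simp: right_idx_def tree_idx_def)
      then show ?thesis by blast
    qed
  qed
qed (auto simp: tree_idx_def left_idx_def right_idx_def)

lemma join_trees_simps:
  "join_trees a l r (0, 1) = a"
  "i \<in> tree_idx \<Longrightarrow> join_trees a l r (left_idx i) = l i"
  "i \<in> tree_idx \<Longrightarrow> join_trees a l r (right_idx i) = r i"
  by (auto simp: join_trees_def tree_idx_def left_idx_def right_idx_def)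

lemma left_tree_join: "l \<in> space trees \<Longrightarrow> left_tree (join_trees a l r) = l"
proof (rule ext)
  fix i assume "l \<in> space trees"
  then have "i \<notin> tree_idx \<Longrightarrow> l i = undefined"
    unfolding space_PiM by (rule PiE_arb)
  then show "left_tree (join_trees a l r) i = l i"
    by (cases "i \<in> tree_idx") (auto simp: left_tree_def join_trees_def tree_idx_def)
qed

lemma right_tree_join: "r \<in> space trees \<Longrightarrow> right_tree (join_trees a l r) = r"
proof (rule ext)
  fix i assume "r \<in> space trees"
  then have "i \<notin> tree_idx \<Longrightarrow> r i = undefined"
    unfolding space_PiM by (rule PiE_arb)
  then show "right_tree (join_trees a l r) i = r i"
    by (cases "i \<in> tree_idx") (auto simp: right_tree_def join_trees_def tree_idx_def)
qed

lemma measurable_join_trees: "(\<lambda>(a, l, r). join_trees a l r) \<in> unif01 \<Otimes>\<^sub>M (trees \<Otimes>\<^sub>M trees) \<rightarrow>\<^sub>M trees"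
proof -
  have "(\<lambda>x. case i of (k, j) \<Rightarrow> if k = 0 then fst x else if j \<le> 2 ^ (k - 1) then fst (snd x) (k - 1, j)
          else snd (snd x) (k - 1, j - 2 ^ (k - 1))) \<in> unif01 \<Otimes>\<^sub>M (trees \<Otimes>\<^sub>M trees) \<rightarrow>\<^sub>M unif01"
    if i: "i \<in> tree_idx" for i
  proof -
    have c: "(\<lambda>u. u q) \<in> trees \<rightarrow>\<^sub>M unif01" if "q \<in> tree_idx" for q
      using that by (rule measurable_component_singleton)
    obtain k j where kj: "i = (k, j)" by (cases i)
    consider "k = 0" | "k \<noteq> 0" "j \<le> 2 ^ (k - 1)" | "k \<noteq> 0" "\<not> j \<le> 2 ^ (k - 1)" by blast
    then show ?thesis
    proof cases
      case 1
      then show ?thesis by (simp add: kj)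
    next
      case 2
      then have q: "(k - 1, j) \<in> tree_idx" using i kj by (auto simp: tree_idx_def)
      have "(\<lambda>x. fst (snd x) (k - 1, j)) \<in> unif01 \<Otimes>\<^sub>M (trees \<Otimes>\<^sub>M trees) \<rightarrow>\<^sub>M unif01"
        by (rule measurable_compose[OF measurable_compose[OF measurable_snd measurable_fst] c[OF q]])
      with 2 show ?thesis by (simp add: kj)
    next
      case 3
      then have q: "(k - 1, j - 2 ^ (k - 1)) \<in> tree_idx" using i kj by (cases k) (auto simp: tree_idx_def)
      have "(\<lambda>x. snd (snd x) (k - 1, j - 2 ^ (k - 1))) \<in> unif01 \<Otimes>\<^sub>M (trees \<Otimes>\<^sub>M trees) \<rightarrow>\<^sub>M unif01"
        by (rule measurable_compose[OF measurable_compose[OF measurable_snd measurable_snd] c[OF q]])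
      with 3 show ?thesis by (simp add: kj)
    qed
  qed
  then show ?thesis unfolding join_trees_def case_prod_beta by (intro measurable_restrict) (simp add: case_prod_beta)
qed

text \<open>
  The coordinates of the tree other than the root are split by \<open>left_idx\<close> and \<open>right_idx\<close> into two
  families, both indexed by \<open>tree_idx\<close>; so a box has the same measure on both sides.
\<close>

lemma distr_join_trees:
  "distr (unif01 \<Otimes>\<^sub>M (trees \<Otimes>\<^sub>M trees)) trees (\<lambda>(a, l, r). join_trees a l r) = trees"
proof -
  interpret P: product_prob_space "\<lambda>_. unif01" tree_idx by unfold_locales
  interpret TT: pair_prob_space trees trees ..
  show ?thesis
  proof (rule P.PiM_eq)
    fix J and F :: "nat \<times> nat \<Rightarrow> real set"
    assume J: "finite J" "J \<subseteq> tree_idx" and F: "\<And>j. j \<in> J \<Longrightarrow> F j \<in> sets unif01"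
    define L where "L = {i \<in> tree_idx. left_idx i \<in> J}"
    define R where "R = {i \<in> tree_idx. right_idx i \<in> J}"
    \<comment> \<open>The box need not restrict the root.\<close>
    define A where "A = (if (0, 1) \<in> J then F (0, 1) else space unif01)"
    have inj: "inj_on left_idx S" "inj_on right_idx S" for S
      by (auto simp: inj_on_def left_idx_def right_idx_def)
    have "left_idx ` L \<subseteq> J" "right_idx ` R \<subseteq> J" by (auto simp: L_def R_def)
    then have LR: "finite L" "finite R"
      using J inj by (meson finite_imageD finite_subset)+
    have Jeq: "J = (J \<inter> {(0, 1)}) \<union> (left_idx ` L \<union> right_idx ` R)"
    proof (intro equalityI subsetI)
      fix j assume j: "j \<in> J"
      then have "j \<in> insert (0, 1) (left_idx ` tree_idx \<union> right_idx ` tree_idx)"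
        using J(2) tree_idx_eq by blast
      then show "j \<in> (J \<inter> {(0, 1)}) \<union> (left_idx ` L \<union> right_idx ` R)"
        using j by (auto simp: L_def R_def)
    qed (auto simp: L_def R_def)
    let ?EL = "prod_emb tree_idx (\<lambda>_. unif01) L (\<Pi>\<^sub>E i\<in>L. F (left_idx i))"
    let ?ER = "prod_emb tree_idx (\<lambda>_. unif01) R (\<Pi>\<^sub>E i\<in>R. F (right_idx i))"
    have sL: "?EL \<in> sets trees" and sR: "?ER \<in> sets trees"
      using LR F by (auto intro!: sets_PiM_I simp: L_def R_def)
    have sA: "A \<in> sets unif01" using F[of "(0, 1)"] sets.top[of unif01] by (simp only: A_def split: if_split) blast
    have pre: "(\<lambda>(a, l, r). join_trees a l r) -` prod_emb tree_idx (\<lambda>_. unif01) J (Pi\<^sub>E J F)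
        \<inter> space (unif01 \<Otimes>\<^sub>M (trees \<Otimes>\<^sub>M trees)) = A \<times> (?EL \<times> ?ER)"
    proof (intro set_eqI, clarify)
      fix a l r
      show "(a, l, r) \<in> (\<lambda>(a, l, r). join_trees a l r) -` prod_emb tree_idx (\<lambda>_. unif01) J (Pi\<^sub>E J F)
        \<inter> space (unif01 \<Otimes>\<^sub>M (trees \<Otimes>\<^sub>M trees)) \<longleftrightarrow> (a, l, r) \<in> A \<times> (?EL \<times> ?ER)"
      proof (cases "a \<in> space unif01 \<and> l \<in> space trees \<and> r \<in> space trees")
        case True
        have "join_trees a l r \<in> space trees"
          using measurable_space[OF measurable_join_trees, of "(a, l, r)"] True by (auto simp: space_pair_measure)
        then have "join_trees a l r \<in> prod_emb tree_idx (\<lambda>_. unif01) J (Pi\<^sub>E J F) \<longleftrightarrow> (\<forall>j\<in>J. join_trees a l r j \<in> F j)"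
          by (auto simp: prod_emb_def space_PiM PiE_iff)
        also have "\<dots> \<longleftrightarrow> a \<in> A \<and> (\<forall>i\<in>L. l i \<in> F (left_idx i)) \<and> (\<forall>i\<in>R. r i \<in> F (right_idx i))"
        proof -
          have "(\<forall>j\<in>J. join_trees a l r j \<in> F j)
              \<longleftrightarrow> (\<forall>j\<in>(J \<inter> {(0, 1)}) \<union> (left_idx ` L \<union> right_idx ` R). join_trees a l r j \<in> F j)"
            by (rule arg_cong[OF Jeq, where f = "\<lambda>J. \<forall>j\<in>J. join_trees a l r j \<in> F j"])
          also have "\<dots> \<longleftrightarrow> ((0, 1) \<in> J \<longrightarrow> join_trees a l r (0, 1) \<in> F (0, 1))
              \<and> (\<forall>i\<in>L. join_trees a l r (left_idx i) \<in> F (left_idx i))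
              \<and> (\<forall>i\<in>R. join_trees a l r (right_idx i) \<in> F (right_idx i))" by blast
          also have "\<dots> \<longleftrightarrow> a \<in> A \<and> (\<forall>i\<in>L. l i \<in> F (left_idx i)) \<and> (\<forall>i\<in>R. r i \<in> F (right_idx i))"
            using True unfolding join_trees_simps by (simp add: A_def L_def R_def join_trees_simps)
          finally show ?thesis .
        qed
        also have "(\<forall>i\<in>L. l i \<in> F (left_idx i)) \<longleftrightarrow> l \<in> ?EL"
          using True by (auto simp: prod_emb_def space_PiM PiE_iff)
        also have "(\<forall>i\<in>R. r i \<in> F (right_idx i)) \<longleftrightarrow> r \<in> ?ER"
          using True by (auto simp: prod_emb_def space_PiM PiE_iff)
        finally show ?thesis using True by (simp add: space_pair_measure)
      next
        case False
        then show ?thesis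
          using sets.sets_into_space[OF sA] sets.sets_into_space[OF sL] sets.sets_into_space[OF sR]
          unfolding space_pair_measure by blast
      qed
    qed
    have "emeasure (distr (unif01 \<Otimes>\<^sub>M (trees \<Otimes>\<^sub>M trees)) trees (\<lambda>(a, l, r). join_trees a l r))
        (prod_emb tree_idx (\<lambda>_. unif01) J (Pi\<^sub>E J F)) = emeasure (unif01 \<Otimes>\<^sub>M (trees \<Otimes>\<^sub>M trees)) (A \<times> (?EL \<times> ?ER))"
      using J F by (subst emeasure_distr) (auto simp: pre measurable_join_trees intro!: sets_PiM_I)
    also have "\<dots> = emeasure unif01 A * (emeasure trees ?EL * emeasure trees ?ER)"
      using sA sL sR by (simp add: TT.emeasure_pair_measure_Times trees.emeasure_pair_measure_Times)
    also have "emeasure trees ?EL = (\<Prod>i\<in>L. emeasure unif01 (F (left_idx i)))"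
      using LR F by (intro emeasure_PiM_emb prob_space_unif01) (auto simp: L_def)
    also have "emeasure trees ?ER = (\<Prod>i\<in>R. emeasure unif01 (F (right_idx i)))"
      using LR F by (intro emeasure_PiM_emb prob_space_unif01) (auto simp: R_def)
    also have "(\<Prod>i\<in>L. emeasure unif01 (F (left_idx i))) = (\<Prod>j\<in>left_idx ` L. emeasure unif01 (F j))"
      by (subst prod.reindex[OF inj(1)]) simp
    also have "(\<Prod>i\<in>R. emeasure unif01 (F (right_idx i))) = (\<Prod>j\<in>right_idx ` R. emeasure unif01 (F j))"
      by (subst prod.reindex[OF inj(2)]) simp
    also have "(\<Prod>j\<in>left_idx ` L. emeasure unif01 (F j)) * (\<Prod>j\<in>right_idx ` R. emeasure unif01 (F j))
        = (\<Prod>j\<in>left_idx ` L \<union> right_idx ` R. emeasure unif01 (F j))"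
      using LR by (intro prod.union_disjoint[symmetric])
        (auto simp: L_def R_def left_idx_def right_idx_def tree_idx_def)
    also have "emeasure unif01 A = (\<Prod>j\<in>J \<inter> {(0, 1)}. emeasure unif01 (F j))"
      using unif01.emeasure_space_1 by (auto simp: A_def simp del: One_nat_def)
    also have "(\<Prod>j\<in>J \<inter> {(0, 1)}. emeasure unif01 (F j)) * (\<Prod>j\<in>left_idx ` L \<union> right_idx ` R. emeasure unif01 (F j))
        = (\<Prod>j\<in>(J \<inter> {(0, 1)}) \<union> (left_idx ` L \<union> right_idx ` R). emeasure unif01 (F j))"
      using LR by (intro prod.union_disjoint[symmetric]) (auto simp: left_idx_def right_idx_def)
    finally show "emeasure (distr (unif01 \<Otimes>\<^sub>M (trees \<Otimes>\<^sub>M trees)) trees (\<lambda>(a, l, r). join_trees a l r))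
        (prod_emb tree_idx (\<lambda>_. unif01) J (Pi\<^sub>E J F)) = (\<Prod>j\<in>J. emeasure unif01 (F j))"
      using Jeq by simp
  qed simp
qed

lemma integral_trees_split:
  fixes F :: "(nat \<times> nat \<Rightarrow> real) \<Rightarrow> complex"
  assumes F: "F \<in> borel_measurable trees" and bound: "\<And>u. cmod (F u) \<le> 1"
  shows "(LINT u|trees. F u) = (LINT a|unif01. LINT l|trees. LINT r|trees. F (join_trees a l r))"
proof -
  interpret TT: pair_prob_space trees trees ..
  interpret UTT: pair_prob_space unif01 "trees \<Otimes>\<^sub>M trees" ..
  let ?G = "\<lambda>(a, l, r). F (join_trees a l r)"
  have mG: "?G \<in> borel_measurable (unif01 \<Otimes>\<^sub>M (trees \<Otimes>\<^sub>M trees))"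
    using measurable_compose[OF measurable_join_trees F] by (simp add: case_prod_beta)
  have "(LINT u|trees. F u) = (LINT w|(unif01 \<Otimes>\<^sub>M (trees \<Otimes>\<^sub>M trees)). ?G w)"
    by (subst distr_join_trees[symmetric], subst integral_distr[OF measurable_join_trees F])
       (auto intro!: Bochner_Integration.integral_cong)
  also have "\<dots> = (LINT a|unif01. LINT w|(trees \<Otimes>\<^sub>M trees). ?G (a, w))"
    using mG by (intro UTT.integral_fst'[symmetric] integrable_bounded_complex[where B = 1] UTT.prob_space_axioms)
       (auto simp: bound)
  also have "\<dots> = (LINT a|unif01. LINT l|trees. LINT r|trees. F (join_trees a l r))"
  proof (intro Bochner_Integration.integral_cong refl)
    fix a assume a: "a \<in> space unif01"
    have "integrable (trees \<Otimes>\<^sub>M trees) (\<lambda>w. ?G (a, w))"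
      using measurable_compose[OF measurable_Pair1'[OF a] mG]
      by (intro integrable_bounded_complex[where B = 1] TT.prob_space_axioms) (auto simp: bound)
    from TT.integral_fst'[OF this]
    show "(LINT w|(trees \<Otimes>\<^sub>M trees). ?G (a, w)) = (LINT l|trees. LINT r|trees. F (join_trees a l r))"
      by simp
  qed
  finally show ?thesis .
qed

text \<open>
  By \<open>char_X_part_law\<close> this is the value at \<open>s\<close> of the characteristic function of \<open>lam * X_part K lam\<close>.
  Unlike that of \<open>X_part K lam\<close>, it makes sense for \<open>lam = 0\<close>, where it is 1.
\<close>

definition Phi :: "nat \<Rightarrow> real \<Rightarrow> real \<Rightarrow> complex" where
  "Phi K lam s = (LINT u|trees. exp (lam * (\<Sum>k<K. gap_char s k u - 1)))"

lemma Phi_0 [simp]: "Phi 0 lam s = 1"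
  by (simp add: Phi_def trees.prob_space)

lemma cmod_exp_gap_sum_le: "0 \<le> lam \<Longrightarrow> cmod (exp (complex_of_real lam * (\<Sum>k<K. gap_char s k u - 1))) \<le> 1"
  using Re_gap_char_le by (auto intro!: mult_nonneg_nonpos sum_nonpos)

lemma cmod_Phi_le: "0 \<le> lam \<Longrightarrow> cmod (Phi K lam s) \<le> 1"
  unfolding Phi_def
  by (rule order.trans[OF integral_norm_bound trees.integral_le_const])
     (auto intro!: cmod_exp_gap_sum_le integrable_norm integrable_bounded_complex[where B = 1] trees.prob_space_axioms
       simp del: norm_exp_eq_Re)

text \<open>
  In the exponent, level 1 belongs to the root and the other levels split by \<open>gap_char_Suc\<close>; the
  factors \<open>a\<close> and \<open>1 - a\<close> there turn the intensity \<open>lam\<close> into \<open>lam * a\<close> and \<open>lam * (1 - a)\<close>. The expectation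
  then factorizes, since root and subtrees are independent.
\<close>

lemma Phi_Suc:
  assumes lam: "0 \<le> lam"
  shows "Phi (Suc K) lam s = (LINT a|unif01. exp (lam * dist_exponent s a)
     * Phi K (lam * a) (s * a) * Phi K (lam * (1 - a)) (s * (1 - a)))"
proof -
  let ?F = "\<lambda>K lam s u. exp (complex_of_real lam * (\<Sum>k<K. gap_char s k u - 1))"
  have "Phi (Suc K) lam s = (LINT a|unif01. LINT l|trees. LINT r|trees. ?F (Suc K) lam s (join_trees a l r))"
    unfolding Phi_def using lam by (intro integral_trees_split cmod_exp_gap_sum_le) auto
  also have "\<dots> = (LINT a|unif01. LINT l|trees. LINT r|trees.
      exp (lam * dist_exponent s a) * ?F K (lam * a) (s * a) l * ?F K (lam * (1 - a)) (s * (1 - a)) r)"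
  proof (intro Bochner_Integration.integral_cong refl)
    fix a l r assume alr: "a \<in> space unif01" "l \<in> space trees" "r \<in> space trees"
    let ?u = "join_trees a l r"
    have u: "?u \<in> space trees"
      using measurable_space[OF measurable_join_trees, of "(a, l, r)"] alr by (auto simp: space_pair_measure)
    have u0: "?u (0, 1) = a" by (rule join_trees_simps)
    have g0: "gap_char s 0 ?u - 1 = dist_exponent s a"
      using u0 by (simp add: gap_char_def dist_exponent_eq)
    have gS: "gap_char s (Suc k) ?u - 1 = a * (gap_char (s * a) k l - 1) + (1 - a) * (gap_char (s * (1 - a)) k r - 1)" for k
      unfolding gap_char_Suc[OF u] u0 left_tree_join[OF alr(2)] right_tree_join[OF alr(3)]
      by (simp add: algebra_simps)
    have "lam * (\<Sum>k<Suc K. gap_char s k ?u - 1) = lam * dist_exponent s a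
      + of_real (lam * a) * (\<Sum>k<K. gap_char (s * a) k l - 1) + of_real (lam * (1 - a)) * (\<Sum>k<K. gap_char (s * (1 - a)) k r - 1)"
      unfolding sum.lessThan_Suc_shift g0 gS sum.distrib sum_distrib_left[symmetric]
      by (simp only: of_real_mult distrib_left mult.assoc add.assoc of_real_diff of_real_1)
    then show "?F (Suc K) lam s ?u = exp (lam * dist_exponent s a) * ?F K (lam * a) (s * a) l * ?F K (lam * (1 - a)) (s * (1 - a)) r"
      by (simp only: exp_add)
  qed
  also have "\<dots> = (LINT a|unif01. exp (lam * dist_exponent s a)
     * Phi K (lam * a) (s * a) * Phi K (lam * (1 - a)) (s * (1 - a)))"
    by (simp only: Phi_def integral_mult_right_zero integral_mult_left_zero)
  finally show ?thesis .
qed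

section \<open>Measurable families of laws and the splitting operation\<close>

lemma measurable_emeasure_poisson [measurable]:
  "(\<lambda>lam. emeasure (measure_pmf (poisson_pmf lam)) E) \<in> borel_measurable (restrict_space borel {0<..})"
proof -
  have "emeasure (measure_pmf (poisson_pmf lam)) E
      = (\<Sum>k. ennreal (lam ^ k / fact k * exp (- lam)) * indicator E k)" if "lam \<in> space (restrict_space borel {0<..})" for lam
  proof -
    have "emeasure (measure_pmf (poisson_pmf lam)) E = (\<integral>\<^sup>+k. indicator E k \<partial>measure_pmf (poisson_pmf lam))"
      by simp
    also have "\<dots> = (\<integral>\<^sup>+k. ennreal (pmf (poisson_pmf lam) k) * indicator E k \<partial>count_space UNIV)"
      by (rule nn_integral_measure_pmf)
    finally show ?thesis using that by (simp add: nn_integral_count_space_nat space_restrict_space)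
  qed
  then have "?thesis \<longleftrightarrow> (\<lambda>lam. \<Sum>k. ennreal (lam ^ k / fact k * exp (- lam)) * indicator E k)
      \<in> borel_measurable (restrict_space borel {0<..})"
    by (rule measurable_cong)
  moreover have "(\<lambda>lam::real. \<Sum>k. ennreal (lam ^ k / fact k * exp (- lam)) * indicator E k) \<in> borel_measurable borel"
    by measurable
  ultimately show ?thesis by (simp add: measurable_restrict_space1)
qed

text \<open>
  The measure of a box is a finite product of Poisson probabilities, each a power series in \<open>lam\<close>
  times an exponential.
\<close>

lemma counts_kernel: "counts \<in> restrict_space borel {0<..} \<rightarrow>\<^sub>M prob_algebra (counts 1)"
proof (rule measurable_prob_algebra_generated[OF sets_PiM Int_stable_prod_algebra prod_algebra_sets_into_space])
  fix A assume "A \<in> prod_algebra {1::nat..} (\<lambda>_. measure_pmf (poisson_pmf 1))"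
  then obtain J E where A: "A = prod_emb {1..} (\<lambda>_. measure_pmf (poisson_pmf 1)) J (\<Pi>\<^sub>E j\<in>J. E j)"
    and J: "finite J" "J \<subseteq> {1..}"
    by (rule prod_algebraE)
  have "emeasure (counts lam) A = (\<Prod>j\<in>J. emeasure (measure_pmf (poisson_pmf lam)) (E j))" for lam
  proof -
    have "A = prod_emb {1..} (\<lambda>_. measure_pmf (poisson_pmf lam)) J (\<Pi>\<^sub>E j\<in>J. E j)"
      by (simp add: A prod_emb_def)
    then show ?thesis using J by (simp add: emeasure_PiM_emb measure_pmf.prob_space_axioms)
  qed
  then show "(\<lambda>lam. emeasure (counts lam) A) \<in> borel_measurable (restrict_space borel {0<..})" by simp
qed (rule prob_space_counts, rule sets_counts)

lemma X_space_kernel: "X_space \<in> restrict_space borel {0<..} \<rightarrow>\<^sub>M prob_algebra (X_space 1)"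
proof -
  have "marks \<Otimes>\<^sub>M trees \<in> space (prob_algebra (marks \<Otimes>\<^sub>M trees))"
    unfolding space_prob_algebra
    by (intro CollectI conjI refl prob_space_pair marks.prob_space_axioms trees.prob_space_axioms)
  then have "(\<lambda>lam. counts lam \<Otimes>\<^sub>M (marks \<Otimes>\<^sub>M trees)) \<in> restrict_space borel {0<..} \<rightarrow>\<^sub>M prob_algebra (X_space 1)"
    unfolding X_space_eq by (intro measurable_pair_prob counts_kernel measurable_const)
  then show ?thesis by (simp add: X_space_eq[abs_def])
qed

lemma distr_X_space_kernel:
  assumes "(\<lambda>(lam, w). f lam w) \<in> borel \<Otimes>\<^sub>M (counts 1 \<Otimes>\<^sub>M (marks \<Otimes>\<^sub>M trees)) \<rightarrow>\<^sub>M borel"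
  shows "(\<lambda>lam. distr (X_space lam) borel (f lam)) \<in> restrict_space borel {0<..} \<rightarrow>\<^sub>M prob_algebra borel"
proof (rule measurable_distr_prob_space2[OF X_space_kernel])
  have id: "(\<lambda>x. x) \<in> restrict_space borel {0<..} \<rightarrow>\<^sub>M (borel :: real measure)"
    by (rule measurable_restrict_space1) simp
  have "(\<lambda>w. (fst w, snd w)) \<in> restrict_space (borel :: real measure) {0<..} \<Otimes>\<^sub>M X_space 1 \<rightarrow>\<^sub>M borel \<Otimes>\<^sub>M (counts 1 \<Otimes>\<^sub>M (marks \<Otimes>\<^sub>M trees))"
    unfolding X_space_eq by (intro measurable_Pair measurable_snd measurable_compose[OF measurable_fst id])
  from measurable_compose[OF this assms]
  show "(\<lambda>(lam, w). f lam w) \<in> restrict_space borel {0<..} \<Otimes>\<^sub>M X_space 1 \<rightarrow>\<^sub>M borel"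
    by (simp add: case_prod_beta)
qed

lemma X_law_kernel: "X_law \<in> restrict_space borel {0<..} \<rightarrow>\<^sub>M prob_algebra borel"
  using distr_X_space_kernel[OF measurable_X_var] by (simp add: X_law_def[abs_def])

lemma X_part_law_kernel: "X_part_law K \<in> restrict_space borel {0<..} \<rightarrow>\<^sub>M prob_algebra borel"
  using distr_X_space_kernel[OF measurable_X_part] by (simp add: X_part_law_def[abs_def])

lemma real_distribution_prob_algebra: "M \<in> space (prob_algebra borel) \<Longrightarrow> real_distribution M"
  by (auto simp: space_prob_algebra real_distribution_def real_distribution_axioms_def)

abbreviation unif_seq :: "(nat \<Rightarrow> real) measure" where
  "unif_seq \<equiv> \<Pi>\<^sub>M i\<in>(UNIV :: nat set). unif01"

abbreviation theta_space :: "real \<Rightarrow> (nat \<times> (nat \<Rightarrow> real)) measure" where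
  "theta_space lam \<equiv> measure_pmf (poisson_pmf lam) \<Otimes>\<^sub>M unif_seq"

lemma prob_space_unif_seq: "prob_space unif_seq"
  by (intro prob_space_PiM prob_space_unif01)

lemma prob_space_theta_space: "prob_space (theta_space lam)"
  by (intro prob_space_pair prob_space_unif_seq measure_pmf.prob_space_axioms)

lemma measurable_seq_component: "(\<lambda>V. V i) \<in> borel_measurable unif_seq"
proof -
  have "(\<lambda>V. V i) \<in> unif_seq \<rightarrow>\<^sub>M unif01"
    by (rule measurable_component_singleton) simp
  from measurable_compose[OF this measurable_ident_unif01] show ?thesis .
qed

lemma measurable_theta: "(\<lambda>(u, N, V). (1 / lam) * (\<Sum>i<N. \<bar>u - V i\<bar>)) \<in> borel_measurable (borel \<Otimes>\<^sub>M theta_space lam')"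
proof -
  have [measurable]: "(\<lambda>w. snd (snd w) i) \<in> borel_measurable (borel \<Otimes>\<^sub>M theta_space lam')" for i
    by (rule measurable_compose[OF measurable_compose[OF measurable_snd measurable_snd] measurable_seq_component])
  have [measurable]: "(\<lambda>w. fst (snd w)) \<in> borel \<Otimes>\<^sub>M theta_space lam' \<rightarrow>\<^sub>M count_space UNIV"
    using measurable_compose[OF measurable_snd measurable_fst, of borel "measure_pmf (poisson_pmf lam')" "unif_seq"]
    by simp
  show ?thesis unfolding case_prod_beta by measurable
qed

lemma measurable_theta': "(\<lambda>(N, V). (1 / lam) * (\<Sum>i<N. \<bar>u - V i\<bar>)) \<in> borel_measurable (theta_space lam')"
proof -
  have "(\<lambda>w. (\<lambda>(u, N, V). (1 / lam) * (\<Sum>i<N. \<bar>u - V i\<bar>)) (u, w)) \<in> borel_measurable (theta_space lam')"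
    by (rule measurable_compose[OF measurable_Pair1' measurable_theta]) simp
  then show ?thesis by simp
qed

lemma Theta_law_kernel: "Theta_law lam \<in> borel \<rightarrow>\<^sub>M prob_algebra borel"
  unfolding Theta_law_def[abs_def]
proof (rule measurable_distr_prob_space2)
  show "(\<lambda>_. theta_space lam) \<in> borel \<rightarrow>\<^sub>M prob_algebra (theta_space lam)"
    by (intro measurable_const) (auto simp: space_prob_algebra prob_space_theta_space)
  show "(\<lambda>(x, y). case y of (N, V) \<Rightarrow> 1 / lam * (\<Sum>i<N. \<bar>x - V i\<bar>)) \<in> borel \<Otimes>\<^sub>M theta_space lam \<rightarrow>\<^sub>M borel"
    using measurable_theta[of lam lam] unfolding case_prod_beta by this
qed

lemma char_Theta_law:
  assumes lam: "0 < lam"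
  shows "char (Theta_law lam u) t = exp (lam * dist_exponent (t / lam) u)"
proof -
  interpret S: prob_space "unif_seq" by (rule prob_space_unif_seq)
  interpret PS: pair_prob_space "measure_pmf (poisson_pmf lam)" "unif_seq" ..
  let ?c = "LINT x|unif01. iexp (t / lam * \<bar>x - u\<bar>)"
  let ?F = "\<lambda>w. iexp (t * (case w of (N, V) \<Rightarrow> (1 / lam) * (\<Sum>i<N. \<bar>u - V i\<bar>)))"
  have mF: "?F \<in> borel_measurable (theta_space lam)"
    using measurable_theta'[of lam u lam] by (rule measurable_compose) measurable
  have c: "cmod ?c \<le> 1"
    by (rule order.trans[OF integral_norm_bound]) simp
  have "char (Theta_law lam u) t = (LINT w|theta_space lam. ?F w)"
    unfolding char_def Theta_law_def by (subst integral_distr[OF measurable_theta']) auto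
  also have "\<dots> = (LINT N|measure_pmf (poisson_pmf lam). LINT V|unif_seq. ?F (N, V))"
    by (rule PS.integral_fst'[symmetric], rule integrable_bounded_complex[where B = 1, OF PS.prob_space_axioms mF]) auto
  also have "\<dots> = (LINT N|measure_pmf (poisson_pmf lam). ?c ^ N)"
  proof (intro Bochner_Integration.integral_cong refl)
    fix N :: nat
    have "?F (N, V) = (\<Prod>i\<in>{..<N}. iexp (t / lam * \<bar>V i - u\<bar>))" for V
    proof -
      have e: "t * (1 / lam * (\<Sum>i<N. \<bar>u - V i\<bar>)) = (\<Sum>i<N. t / lam * \<bar>V i - u\<bar>)"
        by (simp add: sum_distrib_left abs_minus_commute)
      have "?F (N, V) = iexp (\<Sum>i<N. t / lam * \<bar>V i - u\<bar>)" unfolding prod.case e ..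
      also have "\<dots> = (\<Prod>i\<in>{..<N}. iexp (t / lam * \<bar>V i - u\<bar>))"
        unfolding of_real_sum sum_distrib_left by (rule exp_sum) auto
      finally show ?thesis .
    qed
    then have "(LINT V|unif_seq. ?F (N, V))
        = (LINT V|unif_seq. (\<Prod>i\<in>{..<N}. iexp (t / lam * \<bar>V i - u\<bar>)))" by simp
    also have "\<dots> = (\<Prod>i\<in>{..<N}. ?c)"
      by (intro PiM_integral_prod prob_space_unif01 integrable_unif01_iexp) auto
    finally show "(LINT V|unif_seq. ?F (N, V)) = ?c ^ N" by simp
  qed
  also have "\<dots> = exp (lam * (?c - 1))" by (rule poisson_pgf[OF lam c])
  also have "?c - 1 = dist_exponent (t / lam) u"
    by (rule dist_exponent_eq[symmetric])
  finally show ?thesis .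
qed

text \<open>
  The right-hand side of the distributional identity for an arbitrary family of laws, so that it can
  be applied to the partial sums as well.
\<close>

definition split_of :: "(real \<Rightarrow> real measure) \<Rightarrow> real \<Rightarrow> real \<Rightarrow> real measure" where
  "split_of L lam u =
     distr (L (lam * u) \<Otimes>\<^sub>M (L (lam * (1 - u)) \<Otimes>\<^sub>M Theta_law lam u)) borel
       (\<lambda>(x, x', t). u\<^sup>2 * x + (1 - u)\<^sup>2 * x' + t)"

lemma split_law_eq: "split_law lam = split_of X_law lam"
  by (simp add: split_law_def split_of_def fun_eq_iff)

lemma split_of_kernel:
  assumes L: "L \<in> restrict_space borel {0<..} \<rightarrow>\<^sub>M prob_algebra borel" and lam: "0 < lam"
  shows "split_of L lam \<in> restrict_space borel {0<..<1} \<rightarrow>\<^sub>M prob_algebra borel"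
proof -
  have *: "(\<lambda>u. L (f u)) \<in> restrict_space borel {0<..<1} \<rightarrow>\<^sub>M prob_algebra borel"
    if "f \<in> borel_measurable borel" "\<And>u. 0 < u \<Longrightarrow> u < 1 \<Longrightarrow> 0 < f u" for f
  proof (rule measurable_compose[OF measurable_restrict_space2 L])
    show "f \<in> restrict_space borel {0<..<1} \<rightarrow>\<^sub>M borel"
      using that(1) by (rule measurable_restrict_space1)
  qed (use that(2) in \<open>auto simp: space_restrict_space\<close>)
  have T: "Theta_law lam \<in> restrict_space borel {0<..<1} \<rightarrow>\<^sub>M prob_algebra borel"
    using Theta_law_kernel by (rule measurable_restrict_space1)
  have id: "(\<lambda>u. u) \<in> restrict_space borel {0<..<1} \<rightarrow>\<^sub>M (borel :: real measure)"
    by (rule measurable_restrict_space1) simp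
  show ?thesis unfolding split_of_def[abs_def]
  proof (rule measurable_distr_prob_space2[where M = "borel \<Otimes>\<^sub>M (borel \<Otimes>\<^sub>M borel)"])
    show "(\<lambda>u. L (lam * u) \<Otimes>\<^sub>M (L (lam * (1 - u)) \<Otimes>\<^sub>M Theta_law lam u))
        \<in> restrict_space borel {0<..<1} \<rightarrow>\<^sub>M prob_algebra (borel \<Otimes>\<^sub>M (borel \<Otimes>\<^sub>M borel))"
      using lam by (intro measurable_pair_prob * T) auto
    have [measurable]: "fst \<in> borel_measurable
        (restrict_space (borel :: real measure) {0<..<1} \<Otimes>\<^sub>M
          ((borel :: real measure) \<Otimes>\<^sub>M ((borel :: real measure) \<Otimes>\<^sub>M (borel :: real measure))))"
      by (rule measurable_compose[OF measurable_fst id])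
    show "(\<lambda>(u :: real, y). case y of (x, x', t) \<Rightarrow> u\<^sup>2 * x + (1 - u)\<^sup>2 * x' + t)
        \<in> restrict_space borel {0<..<1} \<Otimes>\<^sub>M (borel \<Otimes>\<^sub>M (borel \<Otimes>\<^sub>M borel)) \<rightarrow>\<^sub>M borel"
      unfolding case_prod_beta by measurable
  qed
qed

lemma kernel_real_distribution:
  assumes "L \<in> restrict_space borel {0<..} \<rightarrow>\<^sub>M prob_algebra borel" "0 < (lam :: real)"
  shows "real_distribution (L lam)"
  using measurable_space[OF assms(1), of lam] assms(2)
  by (intro real_distribution_prob_algebra) (auto simp: space_restrict_space)

lemma real_distribution_Theta: "real_distribution (Theta_law lam u)"
  using measurable_space[OF Theta_law_kernel, of u] by (intro real_distribution_prob_algebra) auto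

lemma char_distr_sum3:
  assumes "real_distribution A" "real_distribution B" "real_distribution C"
  shows "char (distr (A \<Otimes>\<^sub>M (B \<Otimes>\<^sub>M C)) borel (\<lambda>(x, y, z). a * x + b * y + z)) t
       = char A (a * t) * char B (b * t) * char C t"
proof -
  interpret A: real_distribution A by fact
  interpret B: real_distribution B by fact
  interpret C: real_distribution C by fact
  interpret BC: pair_prob_space B C ..
  interpret ABC: pair_prob_space A "B \<Otimes>\<^sub>M C" ..
  let ?F = "\<lambda>(x, y, z). iexp (a * t * x) * (iexp (b * t * y) * iexp (t * z))"
  have F: "iexp (t * (case w of (x, y, z) \<Rightarrow> a * x + b * y + z)) = ?F w" for w
    by (cases w) (simp add: exp_add[symmetric] algebra_simps)
  have "char (distr (A \<Otimes>\<^sub>M (B \<Otimes>\<^sub>M C)) borel (\<lambda>(x, y, z). a * x + b * y + z)) t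
      = (LINT w|(A \<Otimes>\<^sub>M (B \<Otimes>\<^sub>M C)). ?F w)"
    unfolding char_def F[symmetric] by (subst integral_distr) (auto simp: case_prod_beta)
  also have "\<dots> = (LINT x|A. LINT w|(B \<Otimes>\<^sub>M C). ?F (x, w))"
    by (rule ABC.integral_fst'[symmetric], rule integrable_bounded_complex[where B = 1, OF ABC.prob_space_axioms])
       (auto simp: norm_mult)
  also have "\<dots> = (LINT x|A. LINT y|B. LINT z|C. ?F (x, y, z))"
  proof (intro Bochner_Integration.integral_cong refl)
    fix x
    have "integrable (B \<Otimes>\<^sub>M C) (\<lambda>w. ?F (x, w))"
      by (rule integrable_bounded_complex[where B = 1, OF BC.prob_space_axioms]) (auto simp: norm_mult)
    from BC.integral_fst'[OF this]
    show "(LINT w|(B \<Otimes>\<^sub>M C). ?F (x, w)) = (LINT y|B. LINT z|C. ?F (x, y, z))" by simp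
  qed
  also have "\<dots> = char A (a * t) * char B (b * t) * char C t"
    by (simp add: char_def mult.assoc del: of_real_mult)
  finally show ?thesis .
qed

lemma char_split_of:
  assumes L: "L \<in> restrict_space borel {0<..} \<rightarrow>\<^sub>M prob_algebra borel" and lam: "0 < lam" and u: "0 < u" "u < 1"
  shows "char (split_of L lam u) t = char (L (lam * u)) (u\<^sup>2 * t) * char (L (lam * (1 - u))) ((1 - u)\<^sup>2 * t)
     * exp (lam * dist_exponent (t / lam) u)"
  unfolding split_of_def char_Theta_law[OF lam, symmetric]
  using lam u by (intro char_distr_sum3 kernel_real_distribution[OF L] real_distribution_Theta) auto

lemma prob_space_unif_open: "prob_space unif_open"
  by (rule prob_spaceI) (simp add: emeasure_restrict_space space_restrict_space)

interpretation unif_open: prob_space unif_open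
  by (rule prob_space_unif_open)

lemma measurable_unif_open_iff: "measurable unif_open N = measurable (restrict_space borel {0<..<1}) N"
  by (intro measurable_cong_sets sets_restrict_space_cong) auto

text \<open>
  Real and imaginary parts are bounded, so each of them may be integrated successively.
\<close>

lemma char_bind:
  assumes K: "K \<in> restrict_space borel {0<..<1} \<rightarrow>\<^sub>M prob_algebra borel"
  shows "char (unif_open \<bind> K) t = (LINT u|unif_open. char (K u) t)"
proof -
  have K': "K \<in> unif_open \<rightarrow>\<^sub>M subprob_algebra borel"
    unfolding measurable_unif_open_iff by (rule measurable_prob_algebraD[OF K])
  have Kp: "prob_space (K u)" "sets (K u) = sets borel" if "u \<in> space unif_open" for u
    using measurable_space[OF K, of u] that by (auto simp: space_prob_algebra space_restrict_space)
  have Kborel: "f \<in> borel_measurable (K u)" if "u \<in> space unif_open" "f \<in> borel_measurable borel"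
    for u and f :: "real \<Rightarrow> real"
    using that(2) unfolding measurable_cong_sets[OF Kp(2)[OF that(1)] refl] .
  have bd: "AE u in unif_open. emeasure (K u) (space (K u)) \<le> ennreal 1"
    using Kp prob_space.emeasure_space_1 by (intro AE_I2) fastforce
  have I: "(LINT x|(unif_open \<bind> K). f x) = (LINT u|unif_open. LINT x|K u. f x)"
    "integrable (unif_open \<bind> K) f" "integrable unif_open (\<lambda>u. LINT x|K u. f x)"
    if f: "f \<in> borel_measurable borel" "\<And>x. \<bar>f x\<bar> \<le> 1" for f :: "real \<Rightarrow> real"
  proof -
    show "(LINT x|(unif_open \<bind> K). f x) = (LINT u|unif_open. LINT x|K u. f x)"
      by (rule integral_bind[OF f(1) f(2) K' _ bd]) unfold_locales
    show "integrable (unif_open \<bind> K) f"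
      by (rule integrable_bind[OF f(1) f(2) K' _ bd]) unfold_locales
    show "integrable unif_open (\<lambda>u. LINT x|K u. f x)"
    proof (rule unif_open.integrable_const_bound[where B = 1])
      show "(\<lambda>u. LINT x|K u. f x) \<in> borel_measurable unif_open"
        using measurable_compose[OF K' integral_measurable_subprob_algebra[OF f(1)]] .
      show "AE u in unif_open. norm (LINT x|K u. f x) \<le> 1"
      proof (rule AE_I2)
        fix u assume "u \<in> space unif_open"
        then interpret Ku: prob_space "K u" by (rule Kp)
        have "norm (LINT x|K u. f x) \<le> (LINT x|K u. norm (f x))" by (rule integral_norm_bound)
        also have "\<dots> \<le> 1"
        proof (rule Ku.integral_le_const)
          show "integrable (K u) (\<lambda>x. norm (f x))"
            using f(2) Kborel[OF \<open>u \<in> space unif_open\<close> f(1)]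
            by (intro Ku.integrable_const_bound[where B = 1]) simp_all
        qed (use f(2) in simp)
        finally show "norm (LINT x|K u. f x) \<le> 1" .
      qed
    qed
  qed
  let ?c = "\<lambda>x. cos (t * x)" and ?s = "\<lambda>x. sin (t * x)"
  have iexp: "iexp (t * x) = of_real (?c x) + \<i> * of_real (?s x)" for x
    by (simp add: complex_eq_iff Re_exp Im_exp)
  have split: "(LINT x|M. iexp (t * x)) = of_real (LINT x|M. ?c x) + \<i> * of_real (LINT x|M. ?s x)"
    if "integrable M ?c" "integrable M ?s" for M
    unfolding iexp using that by (subst Bochner_Integration.integral_add) auto
  have Kint: "integrable (K u) ?c" "integrable (K u) ?s" if "u \<in> space unif_open" for u
  proof -
    interpret Ku: prob_space "K u" by (rule Kp[OF that])
    show "integrable (K u) ?c" "integrable (K u) ?s"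
      by (intro Ku.integrable_const_bound[where B = 1] Kborel[OF that]; simp)+
  qed
  have "char (unif_open \<bind> K) t = of_real (LINT u|unif_open. LINT x|K u. ?c x) + \<i> * of_real (LINT u|unif_open. LINT x|K u. ?s x)"
    unfolding char_def by (subst split) (auto simp: I)
  also have "\<dots> = (LINT u|unif_open. of_real (LINT x|K u. ?c x) + \<i> * of_real (LINT x|K u. ?s x))"
    by (subst Bochner_Integration.integral_add)
       (simp_all add: integrable_of_real[OF I(3)] integrable_mult_right[OF integrable_of_real[OF I(3)]])
  also have "\<dots> = (LINT u|unif_open. char (K u) t)"
    unfolding char_def by (intro Bochner_Integration.integral_cong refl split[symmetric] Kint)
  finally show ?thesis .
qed

lemma real_distribution_bind:
  assumes K: "K \<in> restrict_space borel {0<..<1} \<rightarrow>\<^sub>M prob_algebra borel"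
  shows "real_distribution (unif_open \<bind> K)"
proof -
  have K1: "K \<in> unif_open \<rightarrow>\<^sub>M prob_algebra borel"
    unfolding measurable_unif_open_iff by (rule K)
  have K': "K \<in> unif_open \<rightarrow>\<^sub>M subprob_algebra borel"
    by (rule measurable_prob_algebraD[OF K1])
  have "prob_space (K u)" if "u \<in> space unif_open" for u
    using measurable_space[OF K1 that] by (simp add: space_prob_algebra)
  then have "prob_space (unif_open \<bind> K)"
    by (intro unif_open.prob_space_bind[OF _ K'] AE_I2)
  moreover have "sets (unif_open \<bind> K) = sets borel"
    by (rule sets_bind[OF sets_kernel[OF K'] unif_open.not_empty])
  ultimately show ?thesis by (intro real_distribution_prob_algebra) (simp add: space_prob_algebra)
qed

section \<open>Splitting of the partial sums\<close>

lemma char_X_part_Phi: "0 < lam \<Longrightarrow> char (X_part_law K lam) t = Phi K lam (t / lam)"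
  by (simp add: char_X_part_law Phi_def)

text \<open>
  The integrand is the characteristic function of \<open>split_of L lam u\<close>, the three summands being
  independent, and the characteristic function of the mixture is the integral over \<open>u\<close>.
\<close>

lemma splits_eqI:
  assumes L: "L \<in> restrict_space borel {0<..} \<rightarrow>\<^sub>M prob_algebra borel" and lam: "0 < lam"
    and mu: "real_distribution mu"
    and char: "\<And>t. char mu t = (LINT u|unif_open. char (L (lam * u)) (u\<^sup>2 * t) * char (L (lam * (1 - u))) ((1 - u)\<^sup>2 * t)
     * exp (lam * dist_exponent (t / lam) u))"
  shows "mu = unif_open \<bind> split_of L lam"
proof (rule Levy_uniqueness[OF mu real_distribution_bind[OF split_of_kernel[OF L lam]]], rule ext)
  fix t
  show "char mu t = char (unif_open \<bind> split_of L lam) t"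
    unfolding char char_bind[OF split_of_kernel[OF L lam]]
    by (intro Bochner_Integration.integral_cong refl char_split_of[OF L lam, symmetric])
       (auto simp: space_restrict_space)
qed

lemma integral_unif_open_eq:
  fixes f :: "real \<Rightarrow> complex"
  assumes [measurable]: "f \<in> borel_measurable borel"
  shows "(LINT u|unif_open. f u) = (LINT u|unif01. f u)"
proof -
  have "(LINT x|lborel. indicator {0<..<1} x *\<^sub>R f x) = (LINT x|lborel. indicator {0..1} x *\<^sub>R f x)"
  proof (rule integral_cong_AE)
    have "AE x in lborel. x \<noteq> (0::real)" "AE x in lborel. x \<noteq> (1::real)" by (rule AE_lborel_singleton)+
    then show "AE x in lborel. indicator {0<..<1} x *\<^sub>R f x = indicator {0..1} x *\<^sub>R f x"
      by eventually_elim (auto simp: indicator_def)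
  qed measurable
  then show ?thesis by (subst (1 2) integral_restrict_space) auto
qed

lemma measurable_gap_char2: "(\<lambda>(s, u). gap_char s k u) \<in> borel_measurable (borel \<Otimes>\<^sub>M trees)"
proof -
  have "(\<lambda>(w, x). iexp (fst w * gap k (snd w) x)) \<in> borel_measurable ((borel \<Otimes>\<^sub>M trees) \<Otimes>\<^sub>M unif01)"
  proof -
    have [measurable]: "snd \<in> borel_measurable ((borel \<Otimes>\<^sub>M trees) \<Otimes>\<^sub>M unif01)"
      by (rule measurable_compose[OF measurable_snd measurable_ident_unif01])
    show ?thesis unfolding case_prod_beta by measurable
  qed
  then have "(\<lambda>w. LINT x|unif01. iexp (fst w * gap k (snd w) x)) \<in> borel_measurable (borel \<Otimes>\<^sub>M trees)"
    by (rule unif01.borel_measurable_lebesgue_integral)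
  then show ?thesis by (simp add: gap_char_def case_prod_beta)
qed

lemma measurable_Phi2: "(\<lambda>(l, s). Phi K l s) \<in> borel_measurable (borel \<Otimes>\<^sub>M borel)"
proof -
  have "(\<lambda>(w, u). exp (complex_of_real (fst w) * (\<Sum>k<K. gap_char (snd w) k u - 1)))
      \<in> borel_measurable ((borel \<Otimes>\<^sub>M borel) \<Otimes>\<^sub>M trees)"
  proof -
    have [measurable]: "(\<lambda>w. gap_char (snd (fst w)) k (snd w)) \<in> borel_measurable (((borel :: real measure) \<Otimes>\<^sub>M borel) \<Otimes>\<^sub>M trees)" for k
    proof -
      have "(\<lambda>w. (snd (fst w), snd w)) \<in> ((borel :: real measure) \<Otimes>\<^sub>M borel) \<Otimes>\<^sub>M trees \<rightarrow>\<^sub>M borel \<Otimes>\<^sub>M trees" by measurable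
      from measurable_compose[OF this measurable_gap_char2[of k]] show ?thesis by simp
    qed
    show ?thesis unfolding case_prod_beta by measurable
  qed
  then have "(\<lambda>w. LINT u|trees. exp (complex_of_real (fst w) * (\<Sum>k<K. gap_char (snd w) k u - 1))) \<in> borel_measurable (borel \<Otimes>\<^sub>M borel)"
    by (rule trees.borel_measurable_lebesgue_integral)
  then show ?thesis by (simp add: Phi_def case_prod_beta)
qed

lemma measurable_Phi [measurable (raw)]:
  assumes "f \<in> borel_measurable M" "g \<in> borel_measurable M"
  shows "(\<lambda>x. Phi K (f x) (g x)) \<in> borel_measurable M"
  using measurable_compose[OF measurable_Pair[OF assms] measurable_Phi2] by simp

lemma measurable_dist_exponent: "dist_exponent s \<in> borel_measurable borel"
  unfolding dist_exponent_def[abs_def]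
proof (rule unif01.borel_measurable_lebesgue_integral)
  have [measurable]: "snd \<in> borel_measurable ((borel :: real measure) \<Otimes>\<^sub>M unif01)"
    by (rule measurable_compose[OF measurable_snd measurable_ident_unif01])
  show "(\<lambda>(a, x). iexp (s * \<bar>x - a\<bar>) - 1) \<in> borel_measurable (borel \<Otimes>\<^sub>M unif01)"
    unfolding case_prod_beta by measurable
qed

text \<open>
  The integrand in \<open>Phi_Suc\<close>, for an arbitrary function in place of \<open>Phi K\<close>; below it is also needed for
  the limit of these functions.
\<close>

definition step_integrand :: "(real \<Rightarrow> real \<Rightarrow> complex) \<Rightarrow> real \<Rightarrow> real \<Rightarrow> real \<Rightarrow> complex" where
  "step_integrand P lam s a = exp (lam * dist_exponent s a)
     * P (lam * a) (s * a) * P (lam * (1 - a)) (s * (1 - a))"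

lemma measurable_step_integrand: "step_integrand (Phi K) lam s \<in> borel_measurable borel"
proof -
  note [measurable] = measurable_dist_exponent
  show ?thesis unfolding step_integrand_def[abs_def] by measurable
qed

lemma Phi_Suc': "0 \<le> lam \<Longrightarrow> Phi (Suc K) lam s = (LINT a|unif01. step_integrand (Phi K) lam s a)"
  unfolding step_integrand_def by (rule Phi_Suc)

text \<open>
  This is \<open>Phi_Suc\<close> after rescaling: the factor \<open>v\<^sup>2\<close> in front of the variable with parameter \<open>lam * v\<close>
  accounts for the factors \<open>v\<close> by which both the intensity and the distances are multiplied.
\<close>

lemma X_part_law_Suc:
  assumes lam: "0 < lam"
  shows "X_part_law (Suc K) lam = unif_open \<bind> split_of (X_part_law K) lam"
proof (rule splits_eqI[OF X_part_law_kernel lam kernel_real_distribution[OF X_part_law_kernel lam]])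
  fix t
  have "char (X_part_law (Suc K) lam) t = (LINT u|unif_open. step_integrand (Phi K) lam (t / lam) u)"
    using lam by (simp add: char_X_part_Phi Phi_Suc' integral_unif_open_eq[OF measurable_step_integrand])
  also have "\<dots> = (LINT u|unif_open. char (X_part_law K (lam * u)) (u\<^sup>2 * t) * char (X_part_law K (lam * (1 - u))) ((1 - u)\<^sup>2 * t)
     * exp (lam * dist_exponent (t / lam) u))"
  proof (intro Bochner_Integration.integral_cong refl)
    fix u assume "u \<in> space unif_open"
    then have u: "0 < u" "u < 1" by (auto simp: space_restrict_space)
    have e: "v\<^sup>2 * t / (lam * v) = t / lam * v" if "0 < v" for v
      using that lam by (simp add: power2_eq_square)
    have c: "char (X_part_law K (lam * v)) (v\<^sup>2 * t) = Phi K (lam * v) (t / lam * v)" if "0 < v" for v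
      using that lam char_X_part_Phi[of "lam * v" K "v\<^sup>2 * t"] by (simp only: e mult_pos_pos)
    have v: "0 < 1 - u" using u by simp
    show "step_integrand (Phi K) lam (t / lam) u = char (X_part_law K (lam * u)) (u\<^sup>2 * t) * char (X_part_law K (lam * (1 - u))) ((1 - u)\<^sup>2 * t)
     * exp (lam * dist_exponent (t / lam) u)"
      unfolding c[OF u(1)] c[OF v] step_integrand_def by (simp only: mult_ac)
  qed
  finally show "char (X_part_law (Suc K) lam) t = \<dots>" .
qed

section \<open>Moments of the partial sums\<close>

lemma nn_integral_unif_open:
  assumes "\<And>x. 0 < x \<Longrightarrow> x < 1 \<Longrightarrow> 0 \<le> f x" "(f has_integral I) {0..1}"
  shows "(\<integral>\<^sup>+u. ennreal (f u) \<partial>unif_open) = ennreal I"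
proof -
  have "(f has_integral I) {0<..<1}" using assms(2) by (simp add: has_integral_Icc_iff_Ioo)
  then have "(\<integral>\<^sup>+u. ennreal (f u) * indicator {0<..<1} u \<partial>lborel) = ennreal I"
    using assms(1) by (intro nn_integral_has_integral_lebesgue') auto
  then show ?thesis by (subst nn_integral_restrict_space) auto
qed

text \<open>
  Nonnegative variables allow all computations to be done with the nonnegative integral, where no
  integrability has to be checked.
\<close>

definition has_moments :: "real measure \<Rightarrow> real \<Rightarrow> real \<Rightarrow> bool" where
  "has_moments M m1 m2 \<longleftrightarrow> real_distribution M \<and> (AE x in M. 0 \<le> x) \<and> 0 \<le> m1 \<and> 0 \<le> m2 \<and>
     (\<integral>\<^sup>+x. ennreal x \<partial>M) = ennreal m1 \<and> (\<integral>\<^sup>+x. ennreal (x\<^sup>2) \<partial>M) = ennreal m2"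

lemma has_moments_quadratic:
  assumes M: "has_moments M m1 m2" and c: "0 \<le> c0" "0 \<le> c1" "0 \<le> c2"
  shows "(\<integral>\<^sup>+x. ennreal (c0 + c1 * x + c2 * x\<^sup>2) \<partial>M) = ennreal (c0 + c1 * m1 + c2 * m2)"
proof -
  interpret real_distribution M using M by (simp add: has_moments_def)
  have m: "0 \<le> m1" "0 \<le> m2" using M by (auto simp: has_moments_def)
  have "(\<integral>\<^sup>+x. ennreal (c0 + c1 * x + c2 * x\<^sup>2) \<partial>M) = (\<integral>\<^sup>+x. ennreal c0 + ennreal c1 * ennreal x + ennreal c2 * ennreal (x\<^sup>2) \<partial>M)"
  proof (rule nn_integral_cong_AE)
    have "AE x in M. 0 \<le> x" using M by (simp add: has_moments_def)
    then show "AE x in M. ennreal (c0 + c1 * x + c2 * x\<^sup>2) = ennreal c0 + ennreal c1 * ennreal x + ennreal c2 * ennreal (x\<^sup>2)"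
      by eventually_elim (use c in \<open>simp add: ennreal_plus ennreal_mult\<close>)
  qed
  also have "\<dots> = ennreal c0 + ennreal c1 * (\<integral>\<^sup>+x. ennreal x \<partial>M) + ennreal c2 * (\<integral>\<^sup>+x. ennreal (x\<^sup>2) \<partial>M)"
    using emeasure_space_1 by (subst nn_integral_add nn_integral_cmult; simp)+
  also have "\<dots> = ennreal (c0 + c1 * m1 + c2 * m2)"
    using M c m by (simp add: has_moments_def ennreal_plus ennreal_mult)
  finally show ?thesis .
qed

text \<open>
  The variables are integrated out one after the other; at each stage the integrand is a quadratic
  polynomial with nonnegative coefficients.
\<close>

lemma moments_sum3:
  assumes A: "has_moments A a1 a2" and B: "has_moments B b1 b2" and C: "has_moments C c1 c2"
    and ab: "0 \<le> a" "0 \<le> b"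
  defines "D \<equiv> distr (A \<Otimes>\<^sub>M (B \<Otimes>\<^sub>M C)) borel (\<lambda>(x, y, z). a * x + b * y + z)"
  shows "(\<integral>\<^sup>+x. ennreal x \<partial>D) = ennreal (a * a1 + b * b1 + c1)"
    and "(\<integral>\<^sup>+x. ennreal (x\<^sup>2) \<partial>D)
       = ennreal (a\<^sup>2 * a2 + b\<^sup>2 * b2 + c2 + 2 * a * b * a1 * b1 + 2 * (a * a1 + b * b1) * c1)"
proof -
  interpret A: real_distribution A using A by (simp add: has_moments_def)
  interpret B: real_distribution B using B by (simp add: has_moments_def)
  interpret C: real_distribution C using C by (simp add: has_moments_def)
  interpret BC: pair_prob_space B C ..
  have pos: "AE x in A. 0 \<le> x" "AE x in B. 0 \<le> x" "0 \<le> a1" "0 \<le> b1" "0 \<le> c1" "0 \<le> a2" "0 \<le> b2" "0 \<le> c2"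
    using A B C by (auto simp: has_moments_def)
  have iter: "(\<integral>\<^sup>+x. ennreal (f x) \<partial>D) = (\<integral>\<^sup>+x. \<integral>\<^sup>+y. \<integral>\<^sup>+z. ennreal (f (a * x + b * y + z)) \<partial>C \<partial>B \<partial>A)"
    if [measurable]: "f \<in> borel_measurable borel" for f :: "real \<Rightarrow> real"
  proof -
    let ?g = "\<lambda>w. ennreal (f (a * fst w + b * fst (snd w) + snd (snd w)))"
    have "(\<integral>\<^sup>+x. ennreal (f x) \<partial>D) = (\<integral>\<^sup>+w. ?g w \<partial>(A \<Otimes>\<^sub>M (B \<Otimes>\<^sub>M C)))"
      unfolding D_def by (subst nn_integral_distr) (auto simp: case_prod_beta)
    also have "\<dots> = (\<integral>\<^sup>+x. \<integral>\<^sup>+w. ?g (x, w) \<partial>(B \<Otimes>\<^sub>M C) \<partial>A)"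
      by (rule BC.nn_integral_fst[symmetric]) measurable
    also have "\<dots> = (\<integral>\<^sup>+x. \<integral>\<^sup>+y. \<integral>\<^sup>+z. ?g (x, y, z) \<partial>C \<partial>B \<partial>A)"
    proof (rule nn_integral_cong)
      fix x
      have "(\<integral>\<^sup>+y. \<integral>\<^sup>+z. (\<lambda>w. ?g (x, w)) (y, z) \<partial>C \<partial>B) = (\<integral>\<^sup>+w. ?g (x, w) \<partial>(B \<Otimes>\<^sub>M C))"
        by (rule C.nn_integral_fst) simp
      then show "(\<integral>\<^sup>+w. ?g (x, w) \<partial>(B \<Otimes>\<^sub>M C)) = (\<integral>\<^sup>+y. \<integral>\<^sup>+z. ?g (x, y, z) \<partial>C \<partial>B)"
        by simp
    qed
    finally show ?thesis by simp
  qed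
  have inner: "(\<integral>\<^sup>+x. \<integral>\<^sup>+y. \<integral>\<^sup>+z. ennreal (ff x y z) \<partial>C \<partial>B \<partial>A) = (\<integral>\<^sup>+x. ennreal (hh x) \<partial>A)"
    if 1: "\<And>x y. 0 \<le> x \<Longrightarrow> 0 \<le> y \<Longrightarrow> (\<integral>\<^sup>+z. ennreal (ff x y z) \<partial>C) = ennreal (gg x y)"
      and 2: "\<And>x. 0 \<le> x \<Longrightarrow> (\<integral>\<^sup>+y. ennreal (gg x y) \<partial>B) = ennreal (hh x)" for ff gg hh
  proof (rule nn_integral_cong_AE)
    show "AE x in A. (\<integral>\<^sup>+y. \<integral>\<^sup>+z. ennreal (ff x y z) \<partial>C \<partial>B) = ennreal (hh x)"
      using pos(1)
    proof eventually_elim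
      fix x :: real assume x: "0 \<le> x"
      have "(\<integral>\<^sup>+y. \<integral>\<^sup>+z. ennreal (ff x y z) \<partial>C \<partial>B) = (\<integral>\<^sup>+y. ennreal (gg x y) \<partial>B)"
        by (rule nn_integral_cong_AE) (use pos(2) in eventually_elim, use 1[OF x] in auto)
      then show "(\<integral>\<^sup>+y. \<integral>\<^sup>+z. ennreal (ff x y z) \<partial>C \<partial>B) = ennreal (hh x)" using 2[OF x] by simp
    qed
  qed
  show "(\<integral>\<^sup>+x. ennreal x \<partial>D) = ennreal (a * a1 + b * b1 + c1)"
  proof -
    have "(\<integral>\<^sup>+x. ennreal x \<partial>D) = (\<integral>\<^sup>+x. ennreal ((b * b1 + c1) + a * x) \<partial>A)"
      unfolding iter[OF measurable_ident, unfolded id_def]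
    proof (rule inner[of _ "\<lambda>x y. a * x + c1 + b * y"])
      fix x y :: real assume "0 \<le> x" "0 \<le> y"
      then show "(\<integral>\<^sup>+z. ennreal (a * x + b * y + z) \<partial>C) = ennreal (a * x + c1 + b * y)"
        using has_moments_quadratic[OF C, of "a * x + b * y" 1 0] ab by (simp add: algebra_simps)
    next
      fix x :: real assume "0 \<le> x"
      then show "(\<integral>\<^sup>+y. ennreal (a * x + c1 + b * y) \<partial>B) = ennreal ((b * b1 + c1) + a * x)"
        using has_moments_quadratic[OF B, of "a * x + c1" b 0] ab pos by (simp add: algebra_simps)
    qed
    also have "\<dots> = ennreal (a * a1 + b * b1 + c1)"
      using has_moments_quadratic[OF A, of "b * b1 + c1" a 0] ab pos by (simp add: algebra_simps)
    finally show ?thesis .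
  qed
  show "(\<integral>\<^sup>+x. ennreal (x\<^sup>2) \<partial>D)
       = ennreal (a\<^sup>2 * a2 + b\<^sup>2 * b2 + c2 + 2 * a * b * a1 * b1 + 2 * (a * a1 + b * b1) * c1)"
  proof -
    have "(\<integral>\<^sup>+x. ennreal (x\<^sup>2) \<partial>D)
       = (\<integral>\<^sup>+x. ennreal ((b\<^sup>2 * b2 + c2 + 2 * b * b1 * c1) + (2 * a * b * b1 + 2 * a * c1) * x + a\<^sup>2 * x\<^sup>2) \<partial>A)"
      unfolding iter[OF borel_measurable_power[OF measurable_ident], unfolded id_def]
    proof (rule inner[of _ "\<lambda>x y. ((a * x)\<^sup>2 + 2 * a * x * c1 + c2) + (2 * a * x * b + 2 * b * c1) * y + b\<^sup>2 * y\<^sup>2"])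
      fix x y :: real assume xy: "0 \<le> x" "0 \<le> y"
      have "(\<integral>\<^sup>+z. ennreal ((a * x + b * y + z)\<^sup>2) \<partial>C)
          = (\<integral>\<^sup>+z. ennreal ((a * x + b * y)\<^sup>2 + 2 * (a * x + b * y) * z + 1 * z\<^sup>2) \<partial>C)"
        by (intro nn_integral_cong arg_cong[where f = ennreal]) (simp add: power2_sum)
      also have "\<dots> = ennreal ((a * x + b * y)\<^sup>2 + 2 * (a * x + b * y) * c1 + 1 * c2)"
        using ab xy by (intro has_moments_quadratic[OF C]) auto
      finally show "(\<integral>\<^sup>+z. ennreal ((a * x + b * y + z)\<^sup>2) \<partial>C)
          = ennreal (((a * x)\<^sup>2 + 2 * a * x * c1 + c2) + (2 * a * x * b + 2 * b * c1) * y + b\<^sup>2 * y\<^sup>2)"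
        by (simp add: power2_sum power_mult_distrib algebra_simps)
    next
      fix x :: real assume x: "0 \<le> x"
      have "(\<integral>\<^sup>+y. ennreal (((a * x)\<^sup>2 + 2 * a * x * c1 + c2) + (2 * a * x * b + 2 * b * c1) * y + b\<^sup>2 * y\<^sup>2) \<partial>B)
          = ennreal (((a * x)\<^sup>2 + 2 * a * x * c1 + c2) + (2 * a * x * b + 2 * b * c1) * b1 + b\<^sup>2 * b2)"
        using ab x pos by (intro has_moments_quadratic[OF B]) auto
      then show "(\<integral>\<^sup>+y. ennreal (((a * x)\<^sup>2 + 2 * a * x * c1 + c2) + (2 * a * x * b + 2 * b * c1) * y + b\<^sup>2 * y\<^sup>2) \<partial>B)
          = ennreal ((b\<^sup>2 * b2 + c2 + 2 * b * b1 * c1) + (2 * a * b * b1 + 2 * a * c1) * x + a\<^sup>2 * x\<^sup>2)"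
        by (simp add: power_mult_distrib algebra_simps)
    qed
    also have "\<dots> = ennreal ((b\<^sup>2 * b2 + c2 + 2 * b * b1 * c1) + (2 * a * b * b1 + 2 * a * c1) * a1 + a\<^sup>2 * a2)"
      using ab pos by (intro has_moments_quadratic[OF A]) auto
    finally show ?thesis by (simp add: algebra_simps)
  qed
qed

text \<open>
  The weights satisfy \<open>(n + 1) w (n + 1) = lam * w n\<close>, so multiplying by \<open>n\<close> amounts to a shift of the
  exponential series.
\<close>

lemma poisson_factorial_moments:
  assumes lam: "0 < lam" and that: "0 \<le> c" "0 \<le> d"
  shows "(\<integral>\<^sup>+n. ennreal (c * real n + d * (real n * (real n - 1))) \<partial>measure_pmf (poisson_pmf lam)) = ennreal (c * lam + d * lam\<^sup>2)"
proof -
  let ?w = "\<lambda>n. lam ^ n / fact n"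
  have s0: "?w sums exp lam" using exp_converges[of lam] by (simp add: divide_inverse mult.commute)
  have "(\<lambda>n. real (Suc n) * ?w (Suc n)) sums (lam * exp lam)"
  proof -
    have "real (Suc n) * ?w (Suc n) = lam * ?w n" for n
      by (simp add: fact_Suc[where 'a = real] del: of_nat_Suc)
    then show ?thesis using sums_mult[OF s0, of lam] by (simp only:)
  qed
  then have s1: "(\<lambda>n. real n * ?w n) sums (lam * exp lam)" by (subst (asm) sums_Suc_iff) simp
  have "(\<lambda>n. real (Suc n) * (real (Suc n) - 1) * ?w (Suc n)) sums (lam * (lam * exp lam))"
  proof -
    have "real (Suc n) * (real (Suc n) - 1) * ?w (Suc n) = lam * (real n * ?w n)" for n
    proof -
      have "real (Suc n) - 1 = real n" by simp
      then show ?thesis by (simp only:) (simp add: fact_Suc[where 'a = real] mult.commute del: of_nat_Suc)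
    qed
    then show ?thesis using sums_mult[OF s1, of lam] by (simp only:)
  qed
  then have s2: "(\<lambda>n. real n * (real n - 1) * ?w n) sums (lam * (lam * exp lam))" by (subst (asm) sums_Suc_iff) simp
  have "(\<lambda>n. (c * (real n * ?w n) + d * (real n * (real n - 1) * ?w n)) * exp (- lam))
      sums ((c * (lam * exp lam) + d * (lam * (lam * exp lam))) * exp (- lam))"
    by (intro sums_mult2 sums_add sums_mult s1 s2)
  moreover have "(c * (lam * exp lam) + d * (lam * (lam * exp lam))) * exp (- lam) = c * lam + d * lam\<^sup>2"
  proof -
    have "exp lam * exp (- lam) = 1" by (simp add: exp_minus)
    then show ?thesis by (simp add: algebra_simps power2_eq_square)
  qed
  ultimately have sums: "(\<lambda>n. pmf (poisson_pmf lam) n * (c * real n + d * (real n * (real n - 1)))) sums (c * lam + d * lam\<^sup>2)"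
    using lam by (simp add: algebra_simps)
  have nn: "0 \<le> c * real n + d * (real n * (real n - 1))" for n
    using that by (cases n) auto
  have "(\<integral>\<^sup>+n. ennreal (c * real n + d * (real n * (real n - 1))) \<partial>measure_pmf (poisson_pmf lam))
      = (\<Sum>n. ennreal (pmf (poisson_pmf lam) n * (c * real n + d * (real n * (real n - 1)))))"
    by (simp add: nn_integral_measure_pmf nn_integral_count_space_nat ennreal_mult'[symmetric] nn)
  also have "\<dots> = ennreal (c * lam + d * lam\<^sup>2)"
    by (rule suminf_ennreal_eq[OF _ sums]) (intro mult_nonneg_nonneg nn pmf_nonneg)
  finally show ?thesis .
qed

lemma has_integral_of_derivative:
  fixes F f :: "real \<Rightarrow> real"
  assumes "a \<le> b" "\<And>x. a \<le> x \<Longrightarrow> x \<le> b \<Longrightarrow> (F has_real_derivative f x) (at x)"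
  shows "(f has_integral (F b - F a)) {a..b}"
  using assms by (intro fundamental_theorem_of_calculus)
    (auto simp: has_real_derivative_iff_has_vector_derivative[symmetric] intro: has_field_derivative_at_within)

lemma integral_abs_dist:
  assumes u: "0 \<le> u" "u \<le> 1"
  shows "(LINT x|unif01. \<bar>u - x\<bar>) = (u\<^sup>2 + (1 - u)\<^sup>2) / 2"
proof -
  have "((\<lambda>x. u - x) has_integral ((u * u - u\<^sup>2 / 2) - (u * 0 - 0\<^sup>2 / 2))) {0..u}"
    using u by (intro has_integral_of_derivative) (auto intro!: derivative_eq_intros)
  then have 1: "((\<lambda>x. \<bar>u - x\<bar>) has_integral ((u * u - u\<^sup>2 / 2) - (u * 0 - 0\<^sup>2 / 2))) {0..u}"
    by (rule has_integral_eq[rotated]) auto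
  have "((\<lambda>x. x - u) has_integral ((1\<^sup>2 / 2 - u * 1) - (u\<^sup>2 / 2 - u * u))) {u..1}"
    using u by (intro has_integral_of_derivative) (auto intro!: derivative_eq_intros)
  then have 2: "((\<lambda>x. \<bar>u - x\<bar>) has_integral ((1\<^sup>2 / 2 - u * 1) - (u\<^sup>2 / 2 - u * u))) {u..1}"
    by (rule has_integral_eq[rotated]) auto
  have "((\<lambda>x. \<bar>u - x\<bar>) has_integral ((u\<^sup>2 + (1 - u)\<^sup>2) / 2)) {0..1}"
    using has_integral_combine[OF u 1 2] by (simp add: power2_eq_square field_simps)
  from integral_unique[OF this] show ?thesis
    by (subst integral_unif01_eq) (auto intro!: continuous_intros)
qed

lemma integral_square_dist:
  "(LINT x|unif01. \<bar>u - x\<bar>\<^sup>2) = (u ^ 3 + (1 - u) ^ 3) / 3"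
proof -
  have "((\<lambda>x. \<bar>u - x\<bar>\<^sup>2) has_integral (- ((u - 1) ^ 3 / 3) - - ((u - 0) ^ 3 / 3))) {0..1}"
    by (intro has_integral_of_derivative) (auto intro!: derivative_eq_intros simp: power2_eq_square)
  also have "- ((u - 1) ^ 3 / 3) - - ((u - 0) ^ 3 / 3) = (u ^ 3 + (1 - u) ^ 3) / 3"
    by (simp add: power3_eq_cube field_simps)
  finally have "((\<lambda>x. \<bar>u - x\<bar>\<^sup>2) has_integral (u ^ 3 + (1 - u) ^ 3) / 3) {0..1}" .
  from integral_unique[OF this] show ?thesis
    by (subst integral_unif01_eq) (auto intro!: continuous_intros)
qed

text \<open>
  In the square of the sum, the \<open>n\<close> diagonal terms have the second moment of a single distance as their
  mean, and the \<open>n (n - 1)\<close> others have the square of the first moment, by independence.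
\<close>

lemma Theta_path_moments:
  fixes u :: real and n :: nat
  assumes u: "0 \<le> u" "u \<le> 1"
  defines "S \<equiv> unif_seq"
  shows "(\<integral>\<^sup>+V. ennreal ((\<Sum>i<n. \<bar>u - V i\<bar>)) \<partial>S) = ennreal (real n * ((u\<^sup>2 + (1 - u)\<^sup>2) / 2))"
    and "(\<integral>\<^sup>+V. ennreal ((\<Sum>i<n. \<bar>u - V i\<bar>)\<^sup>2) \<partial>S)
       = ennreal (real n * ((u ^ 3 + (1 - u) ^ 3) / 3) + real n * (real n - 1) * ((u\<^sup>2 + (1 - u)\<^sup>2) / 2)\<^sup>2)"
proof -
  interpret S: prob_space S unfolding S_def by (rule prob_space_unif_seq)
  let ?g = "(u\<^sup>2 + (1 - u)\<^sup>2) / 2" and ?h = "(u ^ 3 + (1 - u) ^ 3) / 3"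
  have [measurable]: "(\<lambda>V. V i) \<in> borel_measurable S" for i
    unfolding S_def by (rule measurable_seq_component)
  have range: "0 \<le> V i \<and> V i \<le> 1" if "V \<in> space S" for V i
    using that by (auto simp: S_def space_PiM PiE_iff space_restrict_space)
  have le: "\<bar>u - V i\<bar> \<le> 1" if "V \<in> space S" for V i
    using range[OF that, of i] u by auto
  have int1: "integrable unif01 (\<lambda>x. \<bar>u - x\<bar> ^ k)" for k
  proof (rule unif01.integrable_const_bound[where B = 1])
    show "AE x in unif01. norm (\<bar>u - x\<bar> ^ k) \<le> 1"
    proof (rule AE_I2)
      fix x assume "x \<in> space unif01"
      then have "\<bar>u - x\<bar> \<le> 1" using u by (auto simp: space_restrict_space)
      then have "\<bar>u - x\<bar> ^ k \<le> 1" by (intro power_le_one) auto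
      then show "norm (\<bar>u - x\<bar> ^ k) \<le> 1" by (simp only: real_norm_def abs_of_nonneg zero_le_power abs_ge_zero)
    qed
  qed (intro unif01_measurableI, measurable)
  have I1: "integrable S (\<lambda>V. \<bar>u - V i\<bar>)" for i
    using le by (intro S.integrable_const_bound[where B = 1] AE_I2) auto
  have I2: "integrable S (\<lambda>V. \<bar>u - V i\<bar> * \<bar>u - V j\<bar>)" for i j
    using le by (intro S.integrable_const_bound[where B = 1] AE_I2) (auto simp: abs_mult mult_le_one)
  have E1: "(LINT V|S. \<bar>u - V i\<bar>) = ?g" for i
  proof -
    have "(LINT V|S. (\<Prod>j\<in>{i}. \<bar>u - V j\<bar>)) = (\<Prod>j\<in>{i}. LINT x|unif01. \<bar>u - x\<bar>)"
      unfolding S_def using int1[of 1] by (intro PiM_integral_prod prob_space_unif01) auto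
    then show ?thesis using integral_abs_dist[OF u] by simp
  qed
  have E2: "(LINT V|S. \<bar>u - V i\<bar> * \<bar>u - V j\<bar>) = (if i = j then ?h else ?g\<^sup>2)" for i j
  proof (cases "i = j")
    case True
    have "(LINT V|S. (\<Prod>j\<in>{i}. \<bar>u - V j\<bar>\<^sup>2)) = (\<Prod>j\<in>{i}. LINT x|unif01. \<bar>u - x\<bar>\<^sup>2)"
      unfolding S_def using int1[of 2] by (intro PiM_integral_prod prob_space_unif01) auto
    then show ?thesis using True integral_square_dist[of u] by (simp add: power2_eq_square[symmetric])
  next
    case False
    have "(LINT V|S. (\<Prod>k\<in>{i, j}. \<bar>u - V k\<bar>)) = (\<Prod>k\<in>{i, j}. LINT x|unif01. \<bar>u - x\<bar>)"
      unfolding S_def using int1[of 1] by (intro PiM_integral_prod prob_space_unif01) auto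
    then show ?thesis using False integral_abs_dist[OF u] by (simp add: power2_eq_square)
  qed
  show "(\<integral>\<^sup>+V. ennreal ((\<Sum>i<n. \<bar>u - V i\<bar>)) \<partial>S) = ennreal (real n * ?g)"
  proof -
    have "(\<integral>\<^sup>+V. ennreal ((\<Sum>i<n. \<bar>u - V i\<bar>)) \<partial>S) = ennreal (LINT V|S. (\<Sum>i<n. \<bar>u - V i\<bar>))"
      by (rule nn_integral_eq_integral) (auto intro!: Bochner_Integration.integrable_sum I1 sum_nonneg)
    also have "(LINT V|S. (\<Sum>i<n. \<bar>u - V i\<bar>)) = real n * ?g"
      by (simp add: Bochner_Integration.integral_sum I1 E1)
    finally show ?thesis .
  qed
  have sq: "(\<Sum>i<n. \<bar>u - V i\<bar>)\<^sup>2 = (\<Sum>i<n. \<Sum>j<n. \<bar>u - V i\<bar> * \<bar>u - V j\<bar>)" for V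
    by (simp add: power2_eq_square sum_product)
  have row: "(\<Sum>j<n. if i = j then ?h else ?g\<^sup>2) = ?h + (real n - 1) * ?g\<^sup>2" if "i < n" for i
  proof -
    have "(\<Sum>j<n. if i = j then ?h else ?g\<^sup>2) = (\<Sum>j<n. ?g\<^sup>2 + (if i = j then ?h - ?g\<^sup>2 else 0))"
      by (intro sum.cong) auto
    also have "\<dots> = real n * ?g\<^sup>2 + (?h - ?g\<^sup>2)"
      using that by (simp add: sum.distrib)
    finally show ?thesis by (simp add: algebra_simps)
  qed
  show "(\<integral>\<^sup>+V. ennreal ((\<Sum>i<n. \<bar>u - V i\<bar>)\<^sup>2) \<partial>S) = ennreal (real n * ?h + real n * (real n - 1) * ?g\<^sup>2)"
  proof -
    have "(\<integral>\<^sup>+V. ennreal ((\<Sum>i<n. \<bar>u - V i\<bar>)\<^sup>2) \<partial>S) = ennreal (LINT V|S. (\<Sum>i<n. \<bar>u - V i\<bar>)\<^sup>2)"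
      unfolding sq by (rule nn_integral_eq_integral) (auto intro!: Bochner_Integration.integrable_sum I2 sum_nonneg)
    also have "(LINT V|S. (\<Sum>i<n. \<bar>u - V i\<bar>)\<^sup>2) = (\<Sum>i<n. \<Sum>j<n. if i = j then ?h else ?g\<^sup>2)"
      unfolding sq by (simp only: Bochner_Integration.integral_sum Bochner_Integration.integrable_sum I2 E2)
    also have "\<dots> = real n * (?h + (real n - 1) * ?g\<^sup>2)"
      using row by simp
    finally show ?thesis by (simp add: algebra_simps)
  qed
qed

lemma has_moments_Theta:
  assumes lam: "0 < lam" and u: "0 \<le> u" "u \<le> 1"
  shows "has_moments (Theta_law lam u) ((u\<^sup>2 + (1 - u)\<^sup>2) / 2)
     ((u ^ 3 + (1 - u) ^ 3) / 3 / lam + ((u\<^sup>2 + (1 - u)\<^sup>2) / 2)\<^sup>2)"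
proof -
  interpret S: prob_space "unif_seq" by (rule prob_space_unif_seq)
  let ?g = "(u\<^sup>2 + (1 - u)\<^sup>2) / 2" and ?h = "(u ^ 3 + (1 - u) ^ 3) / 3"
  let ?S = "unif_seq"
  let ?T = "\<lambda>(N, V). (1 / lam) * (\<Sum>i<N. \<bar>u - V i\<bar>)"
  have pos: "0 \<le> ?g" "0 \<le> ?h" using u by auto
  have Tnn: "0 \<le> ?T w" for w using lam by (auto simp: case_prod_beta intro!: sum_nonneg divide_nonneg_pos)
  have iter: "(\<integral>\<^sup>+x. ennreal (f x) \<partial>Theta_law lam u) = (\<integral>\<^sup>+N. \<integral>\<^sup>+V. ennreal (f (?T (N, V))) \<partial>?S \<partial>measure_pmf (poisson_pmf lam))"
    if f: "f \<in> borel_measurable borel" for f :: "real \<Rightarrow> real"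
  proof -
    have m: "(\<lambda>w. ennreal (f (?T w))) \<in> borel_measurable (theta_space lam)"
      using measurable_compose[OF measurable_theta' f] by simp
    have "(\<integral>\<^sup>+x. ennreal (f x) \<partial>Theta_law lam u) = (\<integral>\<^sup>+w. ennreal (f (?T w)) \<partial>theta_space lam)"
      unfolding Theta_law_def using f by (subst nn_integral_distr[OF measurable_theta']) auto
    also have "\<dots> = (\<integral>\<^sup>+N. \<integral>\<^sup>+V. ennreal (f (?T (N, V))) \<partial>?S \<partial>measure_pmf (poisson_pmf lam))"
      by (rule S.nn_integral_fst[OF m, symmetric])
    finally show ?thesis .
  qed
  have 1: "(\<integral>\<^sup>+x. ennreal x \<partial>Theta_law lam u) = ennreal ?g"
  proof -
    have "(\<integral>\<^sup>+x. ennreal x \<partial>Theta_law lam u)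
        = (\<integral>\<^sup>+N. ennreal (?g / lam * real N + 0 * (real N * (real N - 1))) \<partial>measure_pmf (poisson_pmf lam))"
      unfolding iter[OF measurable_ident, unfolded id_def]
    proof (rule nn_integral_cong)
      fix N
      have "(\<integral>\<^sup>+V. ennreal (?T (N, V)) \<partial>?S) = (\<integral>\<^sup>+V. ennreal (1 / lam) * ennreal (\<Sum>i<N. \<bar>u - V i\<bar>) \<partial>?S)"
        using lam by (intro nn_integral_cong) (simp add: ennreal_mult[symmetric] sum_nonneg)
      also have "\<dots> = ennreal (1 / lam) * ennreal (real N * ?g)"
        unfolding Theta_path_moments(1)[OF u, symmetric]
        by (intro nn_integral_cmult measurable_compose[OF _ measurable_ennreal] borel_measurable_sum borel_measurable_abs
            borel_measurable_diff measurable_seq_component) simp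
      also have "\<dots> = ennreal (?g / lam * real N + 0 * (real N * (real N - 1)))"
        using lam pos by (simp add: ennreal_mult[symmetric] mult_ac)
      finally show "(\<integral>\<^sup>+V. ennreal (?T (N, V)) \<partial>?S) = \<dots>" .
    qed
    also have "\<dots> = ennreal (?g / lam * lam + 0 * lam\<^sup>2)"
      using lam pos by (intro poisson_factorial_moments) auto
    finally show ?thesis using lam by simp
  qed
  have 2: "(\<integral>\<^sup>+x. ennreal (x\<^sup>2) \<partial>Theta_law lam u) = ennreal (?h / lam + ?g\<^sup>2)"
  proof -
    have "(\<integral>\<^sup>+x. ennreal (x\<^sup>2) \<partial>Theta_law lam u)
        = (\<integral>\<^sup>+N. ennreal (?h / lam\<^sup>2 * real N + ?g\<^sup>2 / lam\<^sup>2 * (real N * (real N - 1))) \<partial>measure_pmf (poisson_pmf lam))"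
      unfolding iter[OF borel_measurable_power[OF measurable_ident], unfolded id_def]
    proof (rule nn_integral_cong)
      fix N
      have "(\<integral>\<^sup>+V. ennreal ((?T (N, V))\<^sup>2) \<partial>?S) = (\<integral>\<^sup>+V. ennreal (1 / lam\<^sup>2) * ennreal ((\<Sum>i<N. \<bar>u - V i\<bar>)\<^sup>2) \<partial>?S)"
        using lam by (intro nn_integral_cong) (simp add: ennreal_mult[symmetric] power_divide)
      also have "\<dots> = ennreal (1 / lam\<^sup>2) * ennreal (real N * ?h + real N * (real N - 1) * ?g\<^sup>2)"
        unfolding Theta_path_moments(2)[OF u, symmetric]
        by (intro nn_integral_cmult measurable_compose[OF _ measurable_ennreal] borel_measurable_sum borel_measurable_abs
            borel_measurable_diff measurable_seq_component borel_measurable_power) simp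
      also have "\<dots> = ennreal (?h / lam\<^sup>2 * real N + ?g\<^sup>2 / lam\<^sup>2 * (real N * (real N - 1)))"
      proof -
        have "0 \<le> real N * ?h + real N * (real N - 1) * ?g\<^sup>2"
          using pos by (cases N) auto
        then have "ennreal (1 / lam\<^sup>2) * ennreal (real N * ?h + real N * (real N - 1) * ?g\<^sup>2)
            = ennreal (1 / lam\<^sup>2 * (real N * ?h + real N * (real N - 1) * ?g\<^sup>2))"
          using lam by (intro ennreal_mult[symmetric]) auto
        also have "1 / lam\<^sup>2 * (real N * ?h + real N * (real N - 1) * ?g\<^sup>2)
            = ?h / lam\<^sup>2 * real N + ?g\<^sup>2 / lam\<^sup>2 * (real N * (real N - 1))"
        proof -
          have "1 / L * (a * b + a * (a - 1) * c) = b / L * a + c / L * (a * (a - 1))" for L a b c :: real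
            by (simp add: add_divide_distrib diff_divide_distrib algebra_simps)
          then show ?thesis .
        qed
        finally show ?thesis .
      qed
      finally show "(\<integral>\<^sup>+V. ennreal ((?T (N, V))\<^sup>2) \<partial>?S) = \<dots>" .
    qed
    also have "\<dots> = ennreal (?h / lam\<^sup>2 * lam + ?g\<^sup>2 / lam\<^sup>2 * lam\<^sup>2)"
      using lam pos by (intro poisson_factorial_moments) auto
    also have "?h / lam\<^sup>2 * lam + ?g\<^sup>2 / lam\<^sup>2 * lam\<^sup>2 = ?h / lam + ?g\<^sup>2"
      using lam by (simp add: power2_eq_square)
    finally show ?thesis .
  qed
  have "AE x in Theta_law lam u. 0 \<le> x"
    unfolding Theta_law_def
  proof (subst AE_distr_iff[OF measurable_theta'])
    show "AE w in theta_space lam. 0 \<le> ?T w" by (intro AE_I2 Tnn)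
  qed simp
  then show ?thesis
    using 1 2 pos lam real_distribution_Theta by (auto simp: has_moments_def)
qed

lemma X_part_nonneg:
  assumes "0 < lam" "w \<in> space (X_space lam')"
  shows "0 \<le> X_part K lam w"
proof -
  obtain N V u where w: "w = (N, V, u)" by (cases w)
  have "u \<in> space trees" using assms(2) by (auto simp: w X_space_eq space_pair_measure)
  from space_trees[OF this] show ?thesis
    using assms(1) by (auto simp: w X_part_def intro!: divide_nonneg_pos sum_nonneg gap_nonneg)
qed

text \<open>
  The solutions of the recursions for the first two moments of the partial sums: the second moment
  is \<open>sq_part K + var_part K / lam\<close>. The bases of the powers are the integrals over the unit interval of
  \<open>u ^ k + (1 - u) ^ k\<close>: \<open>2/3\<close> for the mean, \<open>1/2\<close> for \<open>var_part\<close>, and \<open>2/5\<close> for the homogeneous part of the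
  recursion \<open>sq_part_Suc\<close>, which is driven by \<open>mean_part\<close> and its square.
\<close>

definition mean_part :: "nat \<Rightarrow> real" where
  "mean_part K = 1 - (2 / 3) ^ K"

definition sq_part :: "nat \<Rightarrow> real" where
  "sq_part K = 13 / 12 - 9 / 4 * (2 / 3) ^ K + 3 / 2 * (4 / 9) ^ K - 1 / 3 * (2 / 5) ^ K"

definition var_part :: "nat \<Rightarrow> real" where
  "var_part K = (1 - (1 / 2) ^ K) / 3"

lemma mean_part_nonneg: "0 \<le> mean_part K"
  by (simp add: mean_part_def power_le_one)

lemma var_part_nonneg: "0 \<le> var_part K"
  by (simp add: var_part_def power_le_one)

lemma sq_part_Suc: "sq_part (Suc K) = 2 / 5 * sq_part K + (1 / 4 + mean_part K) * (7 / 15) + (mean_part K)\<^sup>2 / 15"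
proof -
  have "(4 / 9 :: real) ^ K = ((2 / 3) ^ K)\<^sup>2"
    by (simp add: power_mult_distrib[symmetric] power2_eq_square)
  then show ?thesis by (simp add: sq_part_def mean_part_def power2_eq_square field_simps)
qed

lemma sq_part_nonneg: "0 \<le> sq_part K"
proof (induction K)
  case (Suc K)
  then show ?case using mean_part_nonneg[of K] by (simp add: sq_part_Suc)
qed (simp add: sq_part_def)

lemma nn_integral_bind_unif_open:
  assumes K: "K \<in> restrict_space borel {0<..<1} \<rightarrow>\<^sub>M prob_algebra borel" and f: "f \<in> borel_measurable borel"
  shows "(\<integral>\<^sup>+x. f x \<partial>(unif_open \<bind> K)) = (\<integral>\<^sup>+u. \<integral>\<^sup>+x. f x \<partial>K u \<partial>unif_open)"
proof (rule nn_integral_bind[OF f])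
  show "K \<in> unif_open \<rightarrow>\<^sub>M subprob_algebra borel"
    unfolding measurable_unif_open_iff by (rule measurable_prob_algebraD[OF K])
qed

lemma moment_antiderivative:
  fixes a c d e x :: real
  shows "((\<lambda>u. a * (u ^ 5 / 5 - (1 - u) ^ 5 / 5) + c * (u ^ 4 / 4 - (1 - u) ^ 4 / 4)
      + d * (u ^ 5 / 5 - (1 - u) ^ 5 / 5 + 2 * (u ^ 3 / 3 - u ^ 4 / 2 + u ^ 5 / 5))
      + e * (u ^ 3 / 3 - u ^ 4 / 2 + u ^ 5 / 5)) has_real_derivative
     (a * (x ^ 4 + (1 - x) ^ 4) + c * (x ^ 3 + (1 - x) ^ 3) + d * (x\<^sup>2 + (1 - x)\<^sup>2)\<^sup>2 + e * (x\<^sup>2 * (1 - x)\<^sup>2))) (at x)"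
proof -
  have 5: "((\<lambda>u. u ^ 5 / 5 - (1 - u) ^ 5 / 5) has_real_derivative x ^ 4 + (1 - x) ^ 4) (at x)"
    by (auto intro!: derivative_eq_intros)
  have 4: "((\<lambda>u. u ^ 4 / 4 - (1 - u) ^ 4 / 4) has_real_derivative x ^ 3 + (1 - x) ^ 3) (at x)"
    by (auto intro!: derivative_eq_intros)
  have "((\<lambda>u. u ^ 3 / 3 - u ^ 4 / 2 + u ^ 5 / 5) has_real_derivative x\<^sup>2 - 2 * x ^ 3 + x ^ 4) (at x)"
    by (auto intro!: derivative_eq_intros)
  moreover have "x\<^sup>2 - 2 * x ^ 3 + x ^ 4 = x\<^sup>2 * (1 - x)\<^sup>2" by algebra
  ultimately have q: "((\<lambda>u. u ^ 3 / 3 - u ^ 4 / 2 + u ^ 5 / 5) has_real_derivative x\<^sup>2 * (1 - x)\<^sup>2) (at x)" by simp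
  have "(x\<^sup>2 + (1 - x)\<^sup>2)\<^sup>2 = x ^ 4 + (1 - x) ^ 4 + 2 * (x\<^sup>2 * (1 - x)\<^sup>2)" by algebra
  then show ?thesis by (simp only:) (intro DERIV_add DERIV_cmult 5 4 q)
qed

text \<open>
  The second moment of \<open>u\<^sup>2 X + (1 - u)\<^sup>2 X' + Theta\<close> for fixed \<open>u\<close> is a polynomial in \<open>u\<close>, since the factor
  \<open>u ^ 4\<close> absorbs the singularity of \<open>var_part K / (lam * u)\<close>.
\<close>

lemma has_moments_X_part:
  "0 < lam \<Longrightarrow> has_moments (X_part_law K lam) (mean_part K) (sq_part K + var_part K / lam)"
proof (induction K arbitrary: lam)
  case 0
  have "X_part 0 lam = (\<lambda>_. 0)" by (simp add: X_part_def fun_eq_iff)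
  then have "X_part_law 0 lam = distr (X_space lam) borel (\<lambda>_. 0)" by (simp add: X_part_law_def)
  then have "(\<integral>\<^sup>+x. ennreal (f x) \<partial>X_part_law 0 lam) = ennreal (f 0)" if "f \<in> borel_measurable borel" for f :: "real \<Rightarrow> real"
    using that prob_space.emeasure_space_1[OF prob_space_X_space] by (simp add: nn_integral_distr)
  from this[of "\<lambda>x. x"] this[of "\<lambda>x. x\<^sup>2"]
  show ?case using kernel_real_distribution[OF X_part_law_kernel[of 0] 0]
    by (auto simp: has_moments_def mean_part_def sq_part_def var_part_def X_part_law_def AE_distr_iff X_part_def)
next
  case (Suc K)
  note lam = Suc.prems
  let ?m = "mean_part K" and ?a = "sq_part K" and ?b = "var_part K"
  note nn = mean_part_nonneg[of K] sq_part_nonneg[of K] var_part_nonneg[of K]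
  note kernel = split_of_kernel[OF X_part_law_kernel[of K] lam]
  have M: "has_moments (X_part_law K (lam * v)) ?m (?a + ?b / (lam * v))" if "0 < v" for v
    using that lam by (intro Suc.IH) auto
  have 1: "(\<integral>\<^sup>+x. ennreal x \<partial>X_part_law (Suc K) lam) = ennreal (mean_part (Suc K))"
  proof -
    have "(\<integral>\<^sup>+x. ennreal x \<partial>X_part_law (Suc K) lam) = (\<integral>\<^sup>+u. \<integral>\<^sup>+x. ennreal x \<partial>split_of (X_part_law K) lam u \<partial>unif_open)"
      unfolding X_part_law_Suc[OF lam] by (rule nn_integral_bind_unif_open[OF kernel]) simp
    also have "\<dots> = (\<integral>\<^sup>+u. ennreal ((?m + 1 / 2) * (u\<^sup>2 + (1 - u)\<^sup>2)) \<partial>unif_open)"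
    proof (rule nn_integral_cong)
      fix u assume "u \<in> space unif_open"
      then have u: "0 < u" "u < 1" by (auto simp: space_restrict_space)
      have v: "0 < 1 - u" using u by simp
      have "(\<integral>\<^sup>+x. ennreal x \<partial>split_of (X_part_law K) lam u) = ennreal (u\<^sup>2 * ?m + (1 - u)\<^sup>2 * ?m + (u\<^sup>2 + (1 - u)\<^sup>2) / 2)"
        unfolding split_of_def using u
        by (intro moments_sum3(1)[OF M[OF u(1)] M[OF v] has_moments_Theta[OF lam]]) auto
      also have "u\<^sup>2 * ?m + (1 - u)\<^sup>2 * ?m + (u\<^sup>2 + (1 - u)\<^sup>2) / 2 = (?m + 1 / 2) * (u\<^sup>2 + (1 - u)\<^sup>2)"
        by (simp only: distrib_left distrib_right add_divide_distrib) simp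
      finally show "(\<integral>\<^sup>+x. ennreal x \<partial>split_of (X_part_law K) lam u) = ennreal ((?m + 1 / 2) * (u\<^sup>2 + (1 - u)\<^sup>2))" .
    qed
    also have "\<dots> = ennreal ((?m + 1 / 2) * (1 ^ 3 / 3 - (1 - 1) ^ 3 / 3) - (?m + 1 / 2) * (0 ^ 3 / 3 - (1 - 0) ^ 3 / 3))"
      by (intro nn_integral_unif_open has_integral_of_derivative)
         (use nn in \<open>auto intro!: derivative_eq_intros simp: power2_eq_square\<close>)
    also have "(?m + 1 / 2) * (1 ^ 3 / 3 - (1 - 1) ^ 3 / 3) - (?m + 1 / 2) * (0 ^ 3 / 3 - (1 - 0) ^ 3 / 3) = mean_part (Suc K)"
      by (simp add: mean_part_def field_simps)
    finally show ?thesis .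
  qed
  let ?q = "\<lambda>u::real. u ^ 3 / 3 - u ^ 4 / 2 + u ^ 5 / 5"
  let ?F = "\<lambda>u::real. ?a * (u ^ 5 / 5 - (1 - u) ^ 5 / 5) + (?b + 1 / 3) / lam * (u ^ 4 / 4 - (1 - u) ^ 4 / 4)
      + (1 / 4 + ?m) * (u ^ 5 / 5 - (1 - u) ^ 5 / 5 + 2 * ?q u) + 2 * ?m\<^sup>2 * ?q u"
  let ?f = "\<lambda>u::real. ?a * (u ^ 4 + (1 - u) ^ 4) + (?b + 1 / 3) / lam * (u ^ 3 + (1 - u) ^ 3)
      + (1 / 4 + ?m) * (u\<^sup>2 + (1 - u)\<^sup>2)\<^sup>2 + 2 * ?m\<^sup>2 * (u\<^sup>2 * (1 - u)\<^sup>2)"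
  have 2: "(\<integral>\<^sup>+x. ennreal (x\<^sup>2) \<partial>X_part_law (Suc K) lam) = ennreal (sq_part (Suc K) + var_part (Suc K) / lam)"
  proof -
    have "(\<integral>\<^sup>+x. ennreal (x\<^sup>2) \<partial>X_part_law (Suc K) lam) = (\<integral>\<^sup>+u. \<integral>\<^sup>+x. ennreal (x\<^sup>2) \<partial>split_of (X_part_law K) lam u \<partial>unif_open)"
      unfolding X_part_law_Suc[OF lam] by (rule nn_integral_bind_unif_open[OF kernel]) simp
    also have "\<dots> = (\<integral>\<^sup>+u. ennreal (?f u) \<partial>unif_open)"
    proof (rule nn_integral_cong)
      fix u assume "u \<in> space unif_open"
      then have u: "0 < u" "u < 1" by (auto simp: space_restrict_space)
      have v: "0 < 1 - u" using u by simp
      let ?v = "1 - u"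
      have c: "(w\<^sup>2)\<^sup>2 * (?a + ?b / (lam * w)) = ?a * w ^ 4 + ?b / lam * w ^ 3" if "0 < w" for w
        using that lam by (simp add: field_simps power2_eq_square power3_eq_cube power4_eq_xxxx)
      have "(\<integral>\<^sup>+x. ennreal (x\<^sup>2) \<partial>split_of (X_part_law K) lam u)
        = ennreal ((u\<^sup>2)\<^sup>2 * (?a + ?b / (lam * u)) + (?v\<^sup>2)\<^sup>2 * (?a + ?b / (lam * ?v))
          + ((u ^ 3 + ?v ^ 3) / 3 / lam + ((u\<^sup>2 + ?v\<^sup>2) / 2)\<^sup>2) + 2 * u\<^sup>2 * ?v\<^sup>2 * ?m * ?m
          + 2 * (u\<^sup>2 * ?m + ?v\<^sup>2 * ?m) * ((u\<^sup>2 + ?v\<^sup>2) / 2))"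
        unfolding split_of_def using u
        by (intro moments_sum3(2)[OF M[OF u(1)] M[OF v] has_moments_Theta[OF lam]]) auto
      also have "\<dots> = ennreal (?f u)"
        unfolding c[OF u(1)] c[OF v]
      proof (rule arg_cong[where f = ennreal])
        have quad: "((p + q) / 2)\<^sup>2 + 2 * p * q * m * m + 2 * (p * m + q * m) * ((p + q) / 2)
            = (1 / 4 + m) * (p + q)\<^sup>2 + 2 * m\<^sup>2 * (p * q)" for p q m :: real
          by (simp add: power2_eq_square field_simps)
        have cube: "b / l * w + b / l * z + (w + z) / 3 / l = (b + 1 / 3) / l * (w + z)" for b l w z :: real
          by (simp add: add_divide_distrib distrib_left distrib_right)
        show "?a * u ^ 4 + ?b / lam * u ^ 3 + (?a * ?v ^ 4 + ?b / lam * ?v ^ 3)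
          + ((u ^ 3 + ?v ^ 3) / 3 / lam + ((u\<^sup>2 + ?v\<^sup>2) / 2)\<^sup>2) + 2 * u\<^sup>2 * ?v\<^sup>2 * ?m * ?m
          + 2 * (u\<^sup>2 * ?m + ?v\<^sup>2 * ?m) * ((u\<^sup>2 + ?v\<^sup>2) / 2) = ?f u"
          using quad[of "u\<^sup>2" "?v\<^sup>2" ?m] cube[of ?b lam "u ^ 3" "?v ^ 3"] distrib_left[of ?a "u ^ 4" "?v ^ 4"]
          by linarith
      qed
      finally show "(\<integral>\<^sup>+x. ennreal (x\<^sup>2) \<partial>split_of (X_part_law K) lam u) = ennreal (?f u)" .
    qed
    also have "\<dots> = ennreal (?F 1 - ?F 0)"
    proof (intro nn_integral_unif_open has_integral_of_derivative)
      fix x :: real assume "0 < x" "x < 1"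
      then show "0 \<le> ?f x" using nn lam by (intro add_nonneg_nonneg mult_nonneg_nonneg divide_nonneg_pos) auto
    next
      fix x :: real
      show "(?F has_real_derivative ?f x) (at x)"
        by (rule moment_antiderivative)
    qed simp
    also have "?F 1 - ?F 0 = sq_part (Suc K) + var_part (Suc K) / lam"
      using lam by (simp add: sq_part_Suc var_part_def field_simps)
    finally show ?thesis .
  qed
  have "AE x in X_part_law (Suc K) lam. 0 \<le> x"
    unfolding X_part_law_def using X_part_nonneg[OF lam] by (subst AE_distr_iff) auto
  then show ?case
    using 1 2 kernel_real_distribution[OF X_part_law_kernel[of "Suc K"] lam] mean_part_nonneg[of "Suc K"]
      sq_part_nonneg[of "Suc K"] var_part_nonneg[of "Suc K"] lam
    by (simp add: has_moments_def)
qed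

section \<open>Passage to the limit\<close>

lemma (in prob_space) distr_pair_snd:
  assumes "sigma_finite_measure N"
  shows "distr (M \<Otimes>\<^sub>M N) N snd = N"
proof (intro measure_eqI)
  interpret N: sigma_finite_measure N by fact
  fix A assume A: "A \<in> sets (distr (M \<Otimes>\<^sub>M N) N snd)"
  then have "emeasure (distr (M \<Otimes>\<^sub>M N) N snd) A = emeasure (M \<Otimes>\<^sub>M N) (space M \<times> A)"
    by (auto simp: emeasure_distr space_pair_measure dest: sets.sets_into_space intro!: arg_cong2[where f = emeasure])
  with A show "emeasure (distr (M \<Otimes>\<^sub>M N) N snd) A = emeasure N A"
    by (simp add: N.emeasure_pair_measure_Times emeasure_space_1)
qed simp

lemma AE_unif01_interior: "AE x in unif01. 0 < x \<and> x < 1"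
proof -
  have "AE x in lborel. x \<noteq> (0::real)" "AE x in lborel. x \<noteq> (1::real)" by (rule AE_lborel_singleton)+
  then have "AE x in lborel. x \<in> {0..1} \<longrightarrow> 0 < x \<and> x < (1::real)"
    by eventually_elim auto
  then show ?thesis by (subst AE_restrict_space_iff) auto
qed

lemma AE_trees_interior: "AE u in trees. \<forall>i\<in>tree_idx. 0 < u i \<and> u i < 1"
proof (subst AE_ball_countable)
  show "countable tree_idx" by (rule countableI_type)
  show "\<forall>i\<in>tree_idx. AE u in trees. 0 < u i \<and> u i < 1"
    by (intro ballI AE_PiM_component[OF prob_space_unif01] AE_unif01_interior) auto
qed

lemma AE_marks_interior: "AE V in marks. \<forall>i\<in>{1..} \<times> UNIV. 0 < V i \<and> V i < 1"
proof (subst AE_ball_countable)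
  show "countable ({1..} \<times> UNIV :: (nat \<times> nat) set)" by (rule countableI_type)
  show "\<forall>i\<in>{1..} \<times> UNIV. AE V in marks. 0 < V i \<and> V i < 1"
    by (intro ballI AE_PiM_component[OF prob_space_unif01] AE_unif01_interior) auto
qed

lemma AE_X_space_interior:
  "AE (N, V, u) in X_space lam. (\<forall>i\<in>{1..} \<times> UNIV. 0 < V i \<and> V i < 1) \<and> (\<forall>i\<in>tree_idx. 0 < u i \<and> u i < 1)"
proof -
  interpret C: prob_space "counts lam" by (rule prob_space_counts)
  interpret VT: pair_prob_space marks trees ..
  let ?VT = "marks \<Otimes>\<^sub>M trees"
  let ?P = "\<lambda>V. \<forall>i\<in>{1..} \<times> UNIV. 0 < V i \<and> V i < (1::real)"
  let ?Q = "\<lambda>u. \<forall>i\<in>tree_idx. 0 < u i \<and> u i < (1::real)"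
  have "AE V in distr ?VT marks fst. ?P V"
    unfolding trees.distr_pair_fst by (rule AE_marks_interior)
  note P = AE_distrD[OF measurable_fst this]
  have "AE u in distr ?VT trees snd. ?Q u"
    unfolding marks.distr_pair_snd[OF trees.sigma_finite_measure_axioms] by (rule AE_trees_interior)
  note Q = AE_distrD[OF measurable_snd this]
  have "AE w in distr (counts lam \<Otimes>\<^sub>M ?VT) ?VT snd. ?P (fst w) \<and> ?Q (snd w)"
    unfolding C.distr_pair_snd[OF VT.sigma_finite_measure_axioms]
    using P Q by eventually_elim (rule conjI)
  from AE_distrD[OF measurable_snd this]
  have "AE w in X_space lam. ?P (fst (snd w)) \<and> ?Q (snd (snd w))"
    unfolding X_space_eq .
  then show ?thesis by (simp add: case_prod_beta)
qed

lemma X_part_mono: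
  assumes "0 < lam" "w \<in> space (X_space lam')"
  shows "mono (\<lambda>K. X_part K lam w)"
proof -
  obtain N V u where w: "w = (N, V, u)" by (cases w)
  have "u \<in> space trees" using assms(2) by (auto simp: w X_space_eq space_pair_measure)
  note nn = gap_nonneg[OF space_trees[OF this]]
  show ?thesis
  proof (rule monoI)
    fix K K' :: nat assume "K \<le> K'"
    then have "(\<Sum>k<K. \<Sum>i<N (Suc k). gap k u (V (Suc k, i))) \<le> (\<Sum>k<K'. \<Sum>i<N (Suc k). gap k u (V (Suc k, i)))"
      by (intro sum_mono2) (auto intro!: sum_nonneg nn)
    then show "X_part K lam w \<le> X_part K' lam w"
      using assms(1) by (simp add: w X_part_def divide_right_mono)
  qed
qed

lemma X_part_moments_space:
  assumes lam: "0 < lam"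
  shows "(\<integral>\<^sup>+w. ennreal (X_part K lam w) \<partial>X_space lam) = ennreal (mean_part K)"
    and "(\<integral>\<^sup>+w. ennreal ((X_part K lam w)\<^sup>2) \<partial>X_space lam) = ennreal (sq_part K + var_part K / lam)"
  using has_moments_X_part[OF lam, of K]
  by (auto simp: has_moments_def X_part_law_def nn_integral_distr)

text \<open>
  The mean of the supremum of the partial sums is at most 1, hence it is finite almost surely.
  Where moreover all division points and marks are interior, \<open>gap\<close> agrees with the distances in the
  definition of \<open>X_var\<close>.
\<close>

lemma AE_X_part_convergent:
  assumes lam: "0 < lam"
  shows "AE w in X_space lam. (\<lambda>K. X_part K lam w) \<longlonglongrightarrow> X_var lam w"
proof -
  have "(\<integral>\<^sup>+w. (SUP K. ennreal (X_part K lam w)) \<partial>X_space lam) = (SUP K. \<integral>\<^sup>+w. ennreal (X_part K lam w) \<partial>X_space lam)"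
    using X_part_mono[OF lam]
    by (intro nn_integral_monotone_convergence_SUP_AE AE_I2) (auto intro!: ennreal_leI simp: mono_def)
  also have "\<dots> \<le> 1"
    unfolding X_part_moments_space(1)[OF lam]
    by (intro SUP_least) (simp add: mean_part_def ennreal_le_1)
  finally have "(\<integral>\<^sup>+w. (SUP K. ennreal (X_part K lam w)) \<partial>X_space lam) \<noteq> \<infinity>" by (auto simp: top_unique)
  then have "AE w in X_space lam. (SUP K. ennreal (X_part K lam w)) \<noteq> \<infinity>"
    by (intro nn_integral_PInf_AE) auto
  moreover note AE_X_space_interior[of lam]
  ultimately show ?thesis
  proof (eventually_elim, clarify)
    fix N V u
    assume fin: "(SUP K. ennreal (X_part K lam (N, V, u))) \<noteq> \<infinity>"
      and V: "\<forall>i\<in>{1..} \<times> UNIV. 0 < V i \<and> V i < 1"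
      and u: "\<forall>i\<in>tree_idx. 0 < u i \<and> u i < 1"
    let ?c = "\<lambda>k. \<Sum>i<N (Suc k). gap k u (V (Suc k, i))"
    have gap: "\<bar>V (Suc k, i) - Ypt u (Suc k) (Jidx u (Suc k) (V (Suc k, i)))\<bar> = gap k u (V (Suc k, i))" for k i
      using V by (intro Jidx_gap[OF u]) (auto simp: less_imp_le)
    have nn: "0 \<le> ?c k" for k
      using u by (intro sum_nonneg gap_nonneg) (auto simp: less_imp_le)
    obtain B where B: "(SUP K. ennreal (X_part K lam (N, V, u))) = ennreal B" "0 \<le> B"
      using fin by (cases "SUP K. ennreal (X_part K lam (N, V, u))") auto
    have "(\<Sum>k<K. ?c k) \<le> lam * B" for K
    proof -
      have "ennreal (X_part K lam (N, V, u)) \<le> ennreal B"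
        unfolding B(1)[symmetric] by (rule SUP_upper) simp
      then have "X_part K lam (N, V, u) \<le> B" using B(2) by (simp add: ennreal_le_iff)
      then show ?thesis using lam by (simp add: X_part_def field_simps)
    qed
    then have "summable ?c" by (intro summableI_nonneg_bounded[OF nn])
    then have "(\<lambda>K. (1 / lam) * (\<Sum>k<K. ?c k)) \<longlonglongrightarrow> (1 / lam) * (\<Sum>k. ?c k)"
      by (intro tendsto_mult_left summable_LIMSEQ)
    then show "(\<lambda>K. X_part K lam (N, V, u)) \<longlonglongrightarrow> X_var lam (N, V, u)"
      by (simp only: X_part_def X_var_def prod.case gap)
  qed
qed

lemma mean_part_lim: "mean_part \<longlonglongrightarrow> 1"
proof -
  have "(\<lambda>K. 1 - (2 / 3 :: real) ^ K) \<longlonglongrightarrow> 1 - 0"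
    by (intro tendsto_intros LIMSEQ_realpow_zero) auto
  then show ?thesis by (simp add: mean_part_def[abs_def])
qed

lemma sq_part_lim: "(\<lambda>K. sq_part K + var_part K / lam) \<longlonglongrightarrow> 13 / 12 + 1 / 3 / lam"
proof -
  have "(\<lambda>K. 13 / 12 - 9 / 4 * (2 / 3 :: real) ^ K + 3 / 2 * (4 / 9) ^ K - 1 / 3 * (2 / 5) ^ K)
      \<longlonglongrightarrow> 13 / 12 - 9 / 4 * 0 + 3 / 2 * 0 - 1 / 3 * 0"
    by (intro tendsto_add tendsto_diff tendsto_mult tendsto_const LIMSEQ_realpow_zero) auto
  moreover have "(\<lambda>K. (1 - (1 / 2 :: real) ^ K) * (1 / 3 / lam)) \<longlonglongrightarrow> (1 - 0) * (1 / 3 / lam)"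
    by (intro tendsto_diff tendsto_mult tendsto_const LIMSEQ_realpow_zero) auto
  ultimately have "(\<lambda>K. (13 / 12 - 9 / 4 * (2 / 3 :: real) ^ K + 3 / 2 * (4 / 9) ^ K - 1 / 3 * (2 / 5) ^ K)
      + (1 - (1 / 2 :: real) ^ K) * (1 / 3 / lam)) \<longlonglongrightarrow> (13 / 12 - 9 / 4 * 0 + 3 / 2 * 0 - 1 / 3 * 0) + (1 - 0) * (1 / 3 / lam)"
    by (rule tendsto_add)
  then show ?thesis by (simp add: sq_part_def var_part_def)
qed

text \<open>
  The partial sums and their squares increase to their limits almost surely, so monotone convergence
  applies to both.
\<close>

lemma X_var_moments:
  assumes lam: "0 < lam"
  shows "prob_space.expectation (X_space lam) (X_var lam) = 1"
    and "prob_space.variance (X_space lam) (X_var lam) = 1 / 12 + 1 / (3 * lam)"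
proof -
  interpret X: prob_space "X_space lam" by (rule prob_space_X_space)
  let ?M = "X_space lam"
  have nn: "AE w in ?M. 0 \<le> X_part K lam w" for K
    using X_part_nonneg[OF lam] by (intro AE_I2)
  have fin1: "integrable ?M (X_part K lam)" "(LINT w|?M. X_part K lam w) = mean_part K" for K
    using X_part_moments_space(1)[OF lam, of K] nn mean_part_nonneg[of K]
    by (auto intro!: integrableI_nn_integral_finite simp: integral_eq_nn_integral)
  have fin2: "integrable ?M (\<lambda>w. (X_part K lam w)\<^sup>2)" "(LINT w|?M. (X_part K lam w)\<^sup>2) = sq_part K + var_part K / lam" for K
  proof -
    have c: "0 \<le> sq_part K + var_part K / lam" using sq_part_nonneg[of K] var_part_nonneg[of K] lam by simp
    show "integrable ?M (\<lambda>w. (X_part K lam w)\<^sup>2)"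
      by (rule integrableI_nn_integral_finite[OF _ _ X_part_moments_space(2)[OF lam]]) auto
    show "(LINT w|?M. (X_part K lam w)\<^sup>2) = sq_part K + var_part K / lam"
      by (subst integral_eq_nn_integral) (auto simp only: X_part_moments_space(2)[OF lam] enn2real_ennreal[OF c], auto)
  qed
  have mono: "AE w in ?M. mono (\<lambda>K. X_part K lam w)"
    using X_part_mono[OF lam] by (intro AE_I2)
  have mono2: "AE w in ?M. mono (\<lambda>K. (X_part K lam w)\<^sup>2)"
    using mono AE_all_countable[THEN iffD2, OF allI[OF nn]]
    by eventually_elim (auto simp: mono_def intro!: power_mono)
  have lim1: "(\<lambda>K. LINT w|?M. X_part K lam w) \<longlonglongrightarrow> 1" unfolding fin1 by (rule mean_part_lim)
  have lim2: "(\<lambda>K. LINT w|?M. (X_part K lam w)\<^sup>2) \<longlonglongrightarrow> 13 / 12 + 1 / 3 / lam" unfolding fin2 by (rule sq_part_lim)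
  have conv2: "AE w in ?M. (\<lambda>K. (X_part K lam w)\<^sup>2) \<longlonglongrightarrow> (X_var lam w)\<^sup>2"
    using AE_X_part_convergent[OF lam] by eventually_elim (intro tendsto_power)
  have m2: "(\<lambda>w. (X_var lam w)\<^sup>2) \<in> borel_measurable ?M" by measurable
  note I1 = integrable_monotone_convergence[OF fin1(1) mono AE_X_part_convergent[OF lam] lim1 measurable_X_var_single]
    integral_monotone_convergence[OF fin1(1) mono AE_X_part_convergent[OF lam] lim1 measurable_X_var_single]
  note I2 = integrable_monotone_convergence[OF fin2(1) mono2 conv2 lim2 m2]
    integral_monotone_convergence[OF fin2(1) mono2 conv2 lim2 m2]
  show "X.expectation (X_var lam) = 1" by (rule I1(2))
  have "X.variance (X_var lam) = 13 / 12 + 1 / 3 / lam - 1\<^sup>2"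
    using X.variance_eq[OF I1(1) I2(1)] by (simp only: I1(2) I2(2))
  then show "X.variance (X_var lam) = 1 / 12 + 1 / (3 * lam)" by simp
qed

lemma char_X_part_tendsto:
  assumes lam: "0 < lam"
  shows "(\<lambda>K. char (X_part_law K lam) t) \<longlonglongrightarrow> char (X_law lam) t"
proof -
  interpret X: prob_space "X_space lam" by (rule prob_space_X_space)
  have "(\<lambda>K. LINT w|X_space lam. iexp (t * X_part K lam w)) \<longlonglongrightarrow> (LINT w|X_space lam. iexp (t * X_var lam w))"
  proof (rule integral_dominated_convergence[where w = "\<lambda>_. 1"])
    show "AE w in X_space lam. (\<lambda>K. iexp (t * X_part K lam w)) \<longlonglongrightarrow> iexp (t * X_var lam w)"
      using AE_X_part_convergent[OF lam] by eventually_elim (intro tendsto_intros)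
  qed (auto simp del: of_real_mult)
  then show ?thesis
    unfolding char_def X_part_law_def X_law_def by (subst (1 2) integral_distr) (auto simp del: of_real_mult)
qed

text \<open>
  The value at \<open>l = 0\<close> is that of the functions \<open>Phi K\<close>; it makes the recursion \<open>Phi_lim_rec\<close> meaningful at
  the end points of the unit interval.
\<close>

definition Phi_lim :: "real \<Rightarrow> real \<Rightarrow> complex" where
  "Phi_lim l s = (if l = 0 then 1 else char (X_law l) (s * l))"

lemma Phi_tendsto:
  assumes "0 \<le> l"
  shows "(\<lambda>K. Phi K l s) \<longlonglongrightarrow> Phi_lim l s"
proof (cases "l = 0")
  case True
  then show ?thesis by (simp add: Phi_def Phi_lim_def trees.prob_space)
next
  case False
  then have l: "0 < l" using assms by simp
  have "char (X_part_law K l) (s * l) = Phi K l s" for K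
    using l by (simp add: char_X_part_Phi)
  then show ?thesis using char_X_part_tendsto[OF l, of "s * l"] l by (simp add: Phi_lim_def)
qed

lemma step_integral_tendsto:
  assumes M: "prob_space M" "space M \<subseteq> {0..1}" "\<And>f :: real \<Rightarrow> complex. f \<in> borel_measurable borel \<Longrightarrow> f \<in> borel_measurable M"
    and lam: "0 \<le> lam"
  shows "(\<lambda>K. LINT a|M. step_integrand (Phi K) lam s a) \<longlonglongrightarrow> (LINT a|M. step_integrand Phi_lim lam s a)"
proof -
  interpret prob_space M by fact
  have lim: "(\<lambda>K. step_integrand (Phi K) lam s a) \<longlonglongrightarrow> step_integrand Phi_lim lam s a" if "a \<in> space M" for a
  proof -
    have "0 \<le> a" "a \<le> 1" using that M(2) by auto
    then show ?thesis
      unfolding step_integrand_def using lam by (intro tendsto_intros Phi_tendsto) auto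
  qed
  have meas: "step_integrand (Phi K) lam s \<in> borel_measurable M" for K
    by (intro M(3) measurable_step_integrand)
  show ?thesis
  proof (rule integral_dominated_convergence[where w = "\<lambda>_. 1"])
    show "step_integrand Phi_lim lam s \<in> borel_measurable M"
      by (rule borel_measurable_LIMSEQ_metric[OF meas lim])
    show "AE a in M. (\<lambda>K. step_integrand (Phi K) lam s a) \<longlonglongrightarrow> step_integrand Phi_lim lam s a"
      by (intro AE_I2 lim)
    show "AE a in M. norm (step_integrand (Phi K) lam s a) \<le> 1" for K
    proof (rule AE_I2)
      fix a assume "a \<in> space M"
      then have a: "0 \<le> a" "a \<le> 1" using M(2) by auto
      have "cmod (exp (lam * dist_exponent s a)) \<le> 1"
        using Re_mult_dist_exponent_le[OF lam, of s a] by simp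
      then show "norm (step_integrand (Phi K) lam s a) \<le> 1"
        unfolding step_integrand_def norm_mult using a lam
        by (intro mult_le_one cmod_Phi_le mult_nonneg_nonneg) auto
    qed
  qed (use meas in auto)
qed

text \<open>
  The two versions differ by a null set. The closed interval is convenient for Riemann sums, the open
  one for the families of laws, which are defined for positive parameters.
\<close>

lemma Phi_lim_rec:
  assumes lam: "0 \<le> lam"
  shows "Phi_lim lam s = (LINT a|unif01. step_integrand Phi_lim lam s a)"
    and "Phi_lim lam s = (LINT a|unif_open. step_integrand Phi_lim lam s a)"
proof -
  have "(\<lambda>K. Phi (Suc K) lam s) \<longlonglongrightarrow> Phi_lim lam s"
    using Phi_tendsto[OF lam] by (rule LIMSEQ_Suc)
  moreover have "(\<lambda>K. Phi (Suc K) lam s) \<longlonglongrightarrow> (LINT a|unif01. step_integrand Phi_lim lam s a)"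
    unfolding Phi_Suc'[OF lam]
    by (intro step_integral_tendsto prob_space_unif01 unif01_measurableI lam) (auto simp: space_restrict_space)
  moreover have "(\<lambda>K. Phi (Suc K) lam s) \<longlonglongrightarrow> (LINT a|unif_open. step_integrand Phi_lim lam s a)"
    unfolding Phi_Suc'[OF lam] integral_unif_open_eq[OF measurable_step_integrand, symmetric]
    by (intro step_integral_tendsto prob_space_unif_open lam)
       (auto simp: space_restrict_space intro!: measurable_restrict_space1)
  ultimately show "Phi_lim lam s = (LINT a|unif01. step_integrand Phi_lim lam s a)"
    and "Phi_lim lam s = (LINT a|unif_open. step_integrand Phi_lim lam s a)"
    using LIMSEQ_unique by blast+
qed

lemma X_law_split:
  assumes lam: "0 < lam"
  shows "X_law lam = unif_open \<bind> split_law lam"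
  unfolding split_law_eq
proof (rule splits_eqI[OF X_law_kernel lam kernel_real_distribution[OF X_law_kernel lam]])
  fix t
  have "char (X_law lam) t = Phi_lim lam (t / lam)" using lam by (simp add: Phi_lim_def)
  also have "\<dots> = (LINT u|unif_open. step_integrand Phi_lim lam (t / lam) u)"
    using lam by (intro Phi_lim_rec) auto
  also have "\<dots> = (LINT u|unif_open. char (X_law (lam * u)) (u\<^sup>2 * t) * char (X_law (lam * (1 - u))) ((1 - u)\<^sup>2 * t)
     * exp (lam * dist_exponent (t / lam) u))"
  proof (intro Bochner_Integration.integral_cong refl)
    fix u assume "u \<in> space unif_open"
    then have u: "0 < u" "0 < 1 - u" by (auto simp: space_restrict_space)
    have c: "Phi_lim (lam * v) (t / lam * v) = char (X_law (lam * v)) (v\<^sup>2 * t)" if "0 < v" for v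
    proof -
      have "t / lam * v * (lam * v) = v\<^sup>2 * t" using lam by (simp add: power2_eq_square)
      then show ?thesis using that lam by (simp only: Phi_lim_def) simp
    qed
    show "step_integrand Phi_lim lam (t / lam) u = char (X_law (lam * u)) (u\<^sup>2 * t) * char (X_law (lam * (1 - u))) ((1 - u)\<^sup>2 * t)
     * exp (lam * dist_exponent (t / lam) u)"
      unfolding step_integrand_def c[OF u(1)] c[OF u(2)] by (simp only: mult_ac)
  qed
  finally show "char (X_law lam) t = \<dots>" .
qed

section \<open>Weak convergence\<close>

lemma cmod_integral_unif01_le:
  fixes f :: "real \<Rightarrow> complex"
  assumes f: "f \<in> borel_measurable unif01"
    and le: "\<And>u. 0 \<le> u \<Longrightarrow> u \<le> 1 \<Longrightarrow> cmod (f u) \<le> a + b * (u\<^sup>2 + (1 - u)\<^sup>2)"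
  shows "cmod (LINT u|unif01. f u) \<le> a + 2 / 3 * b"
proof -
  have I: "(LINT u|unif01. a + b * (u\<^sup>2 + (1 - u)\<^sup>2)) = a + 2 / 3 * b"
  proof -
    have "((\<lambda>u. a + b * (u\<^sup>2 + (1 - u)\<^sup>2)) has_integral
        ((a * 1 + b * (1 ^ 3 / 3 - (1 - 1) ^ 3 / 3)) - (a * 0 + b * (0 ^ 3 / 3 - (1 - 0) ^ 3 / 3)))) {0..1}"
      by (intro has_integral_of_derivative) (auto intro!: derivative_eq_intros simp: power2_eq_square)
    from integral_unique[OF this] show ?thesis
      by (subst integral_unif01_eq) (auto intro!: continuous_intros)
  qed
  have sq: "0 \<le> u\<^sup>2 + (1 - u)\<^sup>2 \<and> u\<^sup>2 + (1 - u)\<^sup>2 \<le> 2" if "0 \<le> u" "u \<le> 1" for u :: real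
    using that power_le_one[of u 2] power_le_one[of "1 - u" 2] by simp
  have bd: "\<bar>a + b * (u\<^sup>2 + (1 - u)\<^sup>2)\<bar> \<le> \<bar>a\<bar> + \<bar>b\<bar> * 2" if u: "0 \<le> u" "u \<le> 1" for u
  proof -
    have "\<bar>a + b * (u\<^sup>2 + (1 - u)\<^sup>2)\<bar> \<le> \<bar>a\<bar> + \<bar>b\<bar> * (u\<^sup>2 + (1 - u)\<^sup>2)"
      using sq[OF u] by (intro order.trans[OF abs_triangle_ineq]) (simp add: abs_mult)
    also have "\<dots> \<le> \<bar>a\<bar> + \<bar>b\<bar> * 2" using sq[OF u] by (intro add_left_mono mult_left_mono) auto
    finally show ?thesis .
  qed
  have i1: "integrable unif01 (\<lambda>u. a + b * (u\<^sup>2 + (1 - u)\<^sup>2))"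
    using bd by (intro unif01.integrable_const_bound[where B = "\<bar>a\<bar> + \<bar>b\<bar> * 2"] AE_I2 unif01_measurableI)
      (auto simp: space_restrict_space)
  have i2: "integrable unif01 f"
    using le by (intro Bochner_Integration.integrable_bound[OF i1 f] AE_I2)
      (auto simp: space_restrict_space intro: order.trans[OF _ abs_ge_self])
  have "cmod (LINT u|unif01. f u) \<le> (LINT u|unif01. cmod (f u))" by (rule integral_norm_bound)
  also have "\<dots> \<le> (LINT u|unif01. a + b * (u\<^sup>2 + (1 - u)\<^sup>2))"
    using i1 i2 le by (intro integral_mono) (auto simp: space_restrict_space)
  finally show ?thesis by (simp only: I)
qed

lemma cmod_dist_exponent_le:
  assumes "0 \<le> u" "u \<le> 1"
  shows "cmod (dist_exponent s u) \<le> \<bar>s\<bar>" and "cmod (dist_exponent s u - dist_exponent r u) \<le> \<bar>s - r\<bar>"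
proof -
  have 2: "cmod (dist_exponent s u - dist_exponent r u) \<le> \<bar>s - r\<bar>" for s r
  proof (rule dist_exponent_diff_le)
    fix x :: real assume x: "x \<in> {0..1}"
    have "\<bar>s * \<bar>x - u\<bar> - r * \<bar>x - u\<bar>\<bar> = \<bar>s - r\<bar> * \<bar>x - u\<bar>" by (simp flip: left_diff_distrib add: abs_mult)
    also have "\<dots> \<le> \<bar>s - r\<bar> * 1" using x assms by (intro mult_left_mono) auto
    finally show "\<bar>s * \<bar>x - u\<bar> - r * \<bar>x - u\<bar>\<bar> \<le> \<bar>s - r\<bar>" by simp
  qed
  show "cmod (dist_exponent s u - dist_exponent r u) \<le> \<bar>s - r\<bar>" by (rule 2)
  show "cmod (dist_exponent s u) \<le> \<bar>s\<bar>"
    using 2[of s 0] by (simp add: dist_exponent_def)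
qed

text \<open>
  The value at \<open>s\<close> of the characteristic function of \<open>l\<^sup>2\<close> times the partial sum for the parameter \<open>l\<close>.
  In this scaling the argument \<open>s\<close> is the same on both sides of the recursion.
\<close>

definition Psi_part :: "nat \<Rightarrow> real \<Rightarrow> real \<Rightarrow> complex" where
  "Psi_part K s l = Phi K l (s * l)"

lemma Psi_part_Suc:
  "0 \<le> l \<Longrightarrow> Psi_part (Suc K) s l
     = (LINT u|unif01. theta_char s l u * Psi_part K s (l * u) * Psi_part K s (l * (1 - u)))"
  by (simp only: Psi_part_def Phi_Suc theta_char_def mult.assoc)

lemma measurable_Psi_part_integrand:
  "(\<lambda>u. theta_char s l u * Psi_part K s (l * u) * Psi_part K s (l * (1 - u))) \<in> borel_measurable unif01"
proof (intro unif01_measurableI)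
  note [measurable] = measurable_dist_exponent
  show "(\<lambda>u. theta_char s l u * Psi_part K s (l * u) * Psi_part K s (l * (1 - u))) \<in> borel_measurable borel"
    unfolding theta_char_def Psi_part_def by measurable
qed

lemma cmod_Psi_part_le: "0 \<le> l \<Longrightarrow> cmod (Psi_part K s l) \<le> 1"
  by (simp add: Psi_part_def cmod_Phi_le)

lemma Psi_part_integrable:
  assumes l: "0 \<le> l"
  shows "integrable unif01 (\<lambda>u. theta_char s l u * Psi_part K s (l * u) * Psi_part K s (l * (1 - u)))"
proof (rule unif01.integrable_const_bound[where B = 1])
  show "AE u in unif01. norm (theta_char s l u * Psi_part K s (l * u) * Psi_part K s (l * (1 - u))) \<le> 1"
    unfolding norm_mult using l
    by (intro AE_I2 mult_le_one cmod_theta_char_le cmod_Psi_part_le) (auto simp: space_restrict_space)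
qed (rule measurable_Psi_part_integrand)

text \<open>
  The constant solves \<open>c = 1 + 2/3 * c\<close>, where 1 bounds the contribution of the root.
\<close>

lemma Psi_part_near_one: "0 \<le> l \<Longrightarrow> cmod (Psi_part K s l - 1) \<le> 3 * \<bar>s\<bar> * l\<^sup>2"
proof (induction K arbitrary: l)
  case (Suc K)
  let ?F = "\<lambda>u. theta_char s l u * Psi_part K s (l * u) * Psi_part K s (l * (1 - u))"
  have "Psi_part (Suc K) s l - 1 = (LINT u|unif01. ?F u - 1)"
    using Psi_part_integrable[OF Suc.prems]
    by (simp add: Psi_part_Suc[OF Suc.prems] space_restrict_space)
  also have "cmod \<dots> \<le> \<bar>s\<bar> * l\<^sup>2 + 2 / 3 * (3 * \<bar>s\<bar> * l\<^sup>2)"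
  proof (rule cmod_integral_unif01_le)
    show "(\<lambda>u. ?F u - 1) \<in> borel_measurable unif01"
      using measurable_Psi_part_integrand by (intro borel_measurable_diff) auto
    fix u :: real assume u: "0 \<le> u" "u \<le> 1"
    have "cmod (?F u - 1 * 1 * 1) \<le> cmod (theta_char s l u - 1) + cmod (Psi_part K s (l * u) - 1) + cmod (Psi_part K s (l * (1 - u)) - 1)"
      using u Suc.prems by (intro cmod_mult3_diff_le cmod_theta_char_le cmod_Psi_part_le) auto
    also have "cmod (theta_char s l u - 1) \<le> \<bar>s\<bar> * l\<^sup>2"
    proof -
      let ?I = "dist_exponent (s * l) u"
      have "cmod (exp (l * ?I) - exp 0) \<le> cmod (l * ?I - 0)"
        using Suc.prems by (intro cmod_exp_diff_le Re_mult_dist_exponent_le) auto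
      also have "\<dots> \<le> l * (\<bar>s * l\<bar>)"
        using cmod_dist_exponent_le(1)[OF u, of "s * l"] Suc.prems by (simp add: norm_mult mult_left_mono)
      finally show ?thesis using Suc.prems by (simp add: theta_char_def abs_mult power2_eq_square mult_ac)
    qed
    also have "cmod (Psi_part K s (l * u) - 1) \<le> 3 * \<bar>s\<bar> * (l * u)\<^sup>2"
      using u Suc.prems by (intro Suc.IH) auto
    also have "cmod (Psi_part K s (l * (1 - u)) - 1) \<le> 3 * \<bar>s\<bar> * (l * (1 - u))\<^sup>2"
      using u Suc.prems by (intro Suc.IH) auto
    finally show "cmod (?F u - 1) \<le> \<bar>s\<bar> * l\<^sup>2 + 3 * \<bar>s\<bar> * l\<^sup>2 * (u\<^sup>2 + (1 - u)\<^sup>2)"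
      by (simp add: power_mult_distrib distrib_left mult_ac)
  qed
  finally show ?case by simp
qed (simp add: Psi_part_def)

text \<open>
  Since the bound contains the factor \<open>M\<close>, both factors of \<open>M * (difference of the parameters)\<close> are
  multiplied by \<open>u\<close> on passing to the left subtree. So again \<open>u\<^sup>2 + (1 - u)\<^sup>2\<close> appears, and the constant
  solves \<open>c = 2 + 2/3 * c\<close>; a Lipschitz bound without the factor \<open>M\<close> would not be preserved.
\<close>

lemma Psi_part_lipschitz:
  "0 \<le> l \<Longrightarrow> l \<le> M \<Longrightarrow> 0 \<le> l' \<Longrightarrow> l' \<le> M \<Longrightarrow> cmod (Psi_part K s l - Psi_part K s l') \<le> 6 * \<bar>s\<bar> * M * \<bar>l - l'\<bar>"
proof (induction K arbitrary: l l' M)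
  case (Suc K)
  note l = Suc.prems
  have M: "0 \<le> M" using l by simp
  let ?F = "\<lambda>l u. theta_char s l u * Psi_part K s (l * u) * Psi_part K s (l * (1 - u))"
  let ?d = "\<bar>l - l'\<bar>"
  have "Psi_part (Suc K) s l - Psi_part (Suc K) s l' = (LINT u|unif01. ?F l u - ?F l' u)"
    using Psi_part_integrable l by (simp add: Psi_part_Suc)
  also have "cmod \<dots> \<le> 2 * \<bar>s\<bar> * M * ?d + 2 / 3 * (6 * \<bar>s\<bar> * M * ?d)"
  proof (rule cmod_integral_unif01_le)
    show "(\<lambda>u. ?F l u - ?F l' u) \<in> borel_measurable unif01"
      using measurable_Psi_part_integrand by (intro borel_measurable_diff)
    fix u :: real assume u: "0 \<le> u" "u \<le> 1"
    have "cmod (?F l u - ?F l' u) \<le> cmod (theta_char s l u - theta_char s l' u)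
        + cmod (Psi_part K s (l * u) - Psi_part K s (l' * u)) + cmod (Psi_part K s (l * (1 - u)) - Psi_part K s (l' * (1 - u)))"
      using u l by (intro cmod_mult3_diff_le cmod_theta_char_le cmod_Psi_part_le) auto
    also have "cmod (theta_char s l u - theta_char s l' u) \<le> 2 * \<bar>s\<bar> * M * ?d"
    proof -
      let ?I = "\<lambda>l. dist_exponent (s * l) u"
      have "cmod (theta_char s l u - theta_char s l' u) \<le> cmod (l * ?I l - l' * ?I l')"
        unfolding theta_char_def using l by (intro cmod_exp_diff_le Re_mult_dist_exponent_le)
      also have "l * ?I l - l' * ?I l' = of_real (l - l') * ?I l + of_real l' * (?I l - ?I l')"
        by (simp only: of_real_diff left_diff_distrib right_diff_distrib) simp
      also have "cmod \<dots> \<le> ?d * cmod (?I l) + l' * cmod (?I l - ?I l')"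
        using l by (intro order.trans[OF norm_triangle_ineq]) (simp add: norm_mult flip: of_real_diff)
      also have "\<dots> \<le> ?d * \<bar>s * l\<bar> + l' * \<bar>s * l - s * l'\<bar>"
        using l by (intro add_mono mult_left_mono cmod_dist_exponent_le u) auto
      also have "\<dots> = \<bar>s\<bar> * ?d * l + \<bar>s\<bar> * ?d * l'"
      proof -
        have "\<bar>s * l - s * l'\<bar> = \<bar>s\<bar> * ?d" by (metis abs_mult right_diff_distrib)
        then show ?thesis using l by (simp add: abs_mult mult_ac)
      qed
      also have "\<dots> \<le> \<bar>s\<bar> * ?d * M + \<bar>s\<bar> * ?d * M"
        using l by (intro add_mono mult_left_mono) auto
      finally show ?thesis by (simp add: mult_ac)
    qed
    also have "cmod (Psi_part K s (l * u) - Psi_part K s (l' * u)) \<le> 6 * \<bar>s\<bar> * (M * u) * \<bar>l * u - l' * u\<bar>"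
      using u l by (intro Suc.IH mult_right_mono) auto
    also have "cmod (Psi_part K s (l * (1 - u)) - Psi_part K s (l' * (1 - u))) \<le> 6 * \<bar>s\<bar> * (M * (1 - u)) * \<bar>l * (1 - u) - l' * (1 - u)\<bar>"
      using u l by (intro Suc.IH mult_right_mono) auto
    also have "\<bar>l * (1 - u) - l' * (1 - u)\<bar> = ?d * (1 - u)"
      using u by (simp flip: left_diff_distrib add: abs_mult)
    also have "\<bar>l * u - l' * u\<bar> = ?d * u"
      using u by (simp flip: left_diff_distrib add: abs_mult)
    finally show "cmod (?F l u - ?F l' u) \<le> 2 * \<bar>s\<bar> * M * ?d + 6 * \<bar>s\<bar> * M * ?d * (u\<^sup>2 + (1 - u)\<^sup>2)"
      by (simp only: power2_eq_square distrib_left mult_ac add.assoc)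
  qed
  finally show ?case by (simp add: mult_ac)
qed (simp add: Psi_part_def)

definition Psi :: "real \<Rightarrow> real \<Rightarrow> complex" where
  "Psi s l = Phi_lim l (s * l)"

lemma Psi_tendsto: "0 \<le> l \<Longrightarrow> (\<lambda>K. Psi_part K s l) \<longlonglongrightarrow> Psi s l"
  unfolding Psi_part_def Psi_def by (rule Phi_tendsto)

lemma Psi_eq_char: "0 < l \<Longrightarrow> Psi s l = char (X_law l) (s * l\<^sup>2)"
  by (simp add: Psi_def Phi_lim_def power2_eq_square mult.assoc)

lemma cmod_Psi_le: "0 \<le> l \<Longrightarrow> cmod (Psi s l) \<le> 1"
  using tendsto_norm[OF Psi_tendsto[of l s]] cmod_Psi_part_le by (intro LIMSEQ_le_const2) auto

lemma Psi_near_one: "0 \<le> l \<Longrightarrow> cmod (Psi s l - 1) \<le> 3 * \<bar>s\<bar> * l\<^sup>2"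
  using tendsto_norm[OF tendsto_diff[OF Psi_tendsto[of l s] tendsto_const[of 1]]] Psi_part_near_one
  by (intro LIMSEQ_le_const2) auto

lemma Psi_lipschitz:
  assumes "0 \<le> l" "l \<le> M" "0 \<le> l'" "l' \<le> M"
  shows "cmod (Psi s l - Psi s l') \<le> 6 * \<bar>s\<bar> * M * \<bar>l - l'\<bar>"
  using tendsto_norm[OF tendsto_diff[OF Psi_tendsto[of l s] Psi_tendsto[of l' s]]] Psi_part_lipschitz[OF assms] assms
  by (intro LIMSEQ_le_const2) auto

lemma Psi_rec:
  "0 \<le> l \<Longrightarrow> Psi s l = (LINT u|unif01. theta_char s l u * Psi s (l * u) * Psi s (l * (1 - u)))"
  unfolding Psi_def theta_char_def
  using Phi_lim_rec(1)[of l "s * l"] by (simp only: step_integrand_def mult.assoc)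

lemma inv_char_Psi:
  fixes n :: nat and p :: real
  assumes "0 < p" "p \<le> 1 / 24" "n * p \<le> Lam"
  shows "cmod (inv_char s p n - Psi s (n * p))
     \<le> (5 / 6) ^ K * (12 * \<bar>s\<bar> + 3 * \<bar>s\<bar>) * (n * p)\<^sup>2 + (2 ^ K - 1) * step_const s Lam (6 * \<bar>s\<bar> * Lam) * p"
proof -
  have Lam: "0 \<le> Lam" using assms by (meson mult_nonneg_nonneg of_nat_0_le_iff less_imp_le order.trans)
  show ?thesis
    by (rule inv_char_approx[where Psi = "Psi s" and Lam = Lam])
       (use assms Lam in \<open>auto intro: cmod_Psi_le Psi_lipschitz Psi_near_one Psi_rec\<close>)
qed

lemma char_normalized_inversions_law:
  fixes A :: "'a::linorder set"
  assumes "finite A" "card A = n" "0 < n" "0 < p"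
  shows "char (normalized_inversions_law A p) t = inv_char (t / (n * p)\<^sup>2) p n"
proof -
  have "char (normalized_inversions_law A p) t
      = measure_pmf.expectation (inversions_pmf A p) (\<lambda>k. iexp (t * (real k / ((real n)\<^sup>2 * p))))"
    unfolding char_def normalized_inversions_law_def assms(2) by (subst integral_distr) auto
  also have "inversions_pmf A p = inversions_pmf {..<n} p"
    using inversions_pmf_card[OF assms(1)] assms(2) by simp
  also have "(\<lambda>k. iexp (t * (real k / ((real n)\<^sup>2 * p)))) = (\<lambda>k. iexp (t / (n * p)\<^sup>2 * p * real k))"
  proof
    fix k
    have "t * (real k / ((real n)\<^sup>2 * p)) = t / (n * p)\<^sup>2 * p * real k"
      using assms(3,4) by (simp add: power2_eq_square)
    then show "iexp (t * (real k / ((real n)\<^sup>2 * p))) = iexp (t / (n * p)\<^sup>2 * p * real k)" by (simp only:)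
  qed
  finally show ?thesis by (simp only: inv_char_def)
qed

lemma real_distribution_normalized: "real_distribution (normalized_inversions_law A p)"
proof -
  have "prob_space (normalized_inversions_law A p)"
    unfolding normalized_inversions_law_def by (rule measure_pmf.prob_space_distr) simp
  moreover have "sets (normalized_inversions_law A p) = sets borel"
    by (simp add: normalized_inversions_law_def)
  ultimately show ?thesis by (simp add: real_distribution_def real_distribution_axioms_def)
qed

text \<open>
  First \<open>m\<close> tends to infinity for a fixed depth \<open>K\<close> of the recursion, then \<open>K\<close> does.
\<close>

lemma tendsto_zero_of_bounds:
  fixes f :: "nat \<Rightarrow> real"
  assumes "\<And>K. eventually (\<lambda>m. f m \<le> B K m) sequentially" "\<And>K. (B K) \<longlonglongrightarrow> b K" "b \<longlonglongrightarrow> 0" "\<And>m. 0 \<le> f m"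
  shows "f \<longlonglongrightarrow> 0"
proof (rule LIMSEQ_I)
  fix e :: real assume "0 < e"
  then obtain K where K: "b K < e"
    using order_tendstoD(2)[OF assms(3)] by (metis eventually_sequentially order_refl)
  have "eventually (\<lambda>m. B K m < e) sequentially" by (rule order_tendstoD(2)[OF assms(2) K])
  with assms(1)[of K] have "eventually (\<lambda>m. norm (f m - 0) < e) sequentially"
    by eventually_elim (use assms(4) in \<open>auto simp: abs_of_nonneg\<close>)
  then show "\<exists>no. \<forall>n\<ge>no. norm (f n - 0) < e" by (simp add: eventually_sequentially)
qed

text \<open>
  The characteristic function at \<open>t\<close> of the quotient by \<open>n\<^sup>2 p\<close> is that of \<open>p\<close> times the number of
  inversions at \<open>t / (n p)\<^sup>2\<close>. These arguments converge to \<open>t / lam\<^sup>2\<close>, so the bounds of \<open>inv_char_Psi\<close>, which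
  are continuous in \<open>s\<close>, remain controlled.
\<close>

lemma normalized_inversions_weak_conv:
  fixes lam :: real and n :: "nat \<Rightarrow> nat" and p :: "nat \<Rightarrow> real" and A :: "nat \<Rightarrow> 'a::linorder set"
  assumes lam: "0 < lam" and p: "\<And>m. 0 < p m"
    and A: "\<And>m. finite (A m)" "\<And>m. card (A m) = n m"
    and p0: "p \<longlonglongrightarrow> 0" and np: "(\<lambda>m. real (n m) * p m) \<longlonglongrightarrow> lam"
  shows "weak_conv_m (\<lambda>m. normalized_inversions_law (A m) (p m)) (X_law lam)"
proof (rule levy_continuity[OF real_distribution_normalized kernel_real_distribution[OF X_law_kernel lam]])
  fix t
  interpret X: real_distribution "X_law lam" by (rule kernel_real_distribution[OF X_law_kernel lam])
  let ?l = "\<lambda>m. real (n m) * p m"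
  define S where "S m = t / (?l m)\<^sup>2" for m
  \<comment> \<open>Eventually \<open>?l m < ?L\<close>. The three parts of \<open>?B\<close> bound the distance from the algorithm to the limit
    variable for the parameter \<open>?l m\<close>, from there to the parameter \<open>lam\<close>, and the change of the argument of
    the characteristic function.\<close>
  let ?L = "lam + 1"
  let ?B = "\<lambda>K m. ((5 / 6) ^ K * (12 * \<bar>S m\<bar> + 3 * \<bar>S m\<bar>) * (?l m)\<^sup>2 + (2 ^ K - 1) * step_const (S m) ?L (6 * \<bar>S m\<bar> * ?L) * p m)
      + 6 * \<bar>S m\<bar> * ?L * \<bar>?l m - lam\<bar> + cmod (char (X_law lam) (S m * lam\<^sup>2) - char (X_law lam) t)"
  have s: "S \<longlonglongrightarrow> t / lam\<^sup>2" unfolding S_def using lam by (intro tendsto_intros np) auto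
  have "(\<lambda>m. cmod (char (normalized_inversions_law (A m) (p m)) t - char (X_law lam) t)) \<longlonglongrightarrow> 0"
  proof (rule tendsto_zero_of_bounds[where B = ?B and b = "\<lambda>K. (5 / 6) ^ K * (12 * \<bar>t / lam\<^sup>2\<bar> + 3 * \<bar>t / lam\<^sup>2\<bar>) * lam\<^sup>2"])
    fix K
    have ev: "eventually (\<lambda>m. p m < 1 / 24) sequentially" "eventually (\<lambda>m. ?l m < ?L) sequentially" "eventually (\<lambda>m. 0 < ?l m) sequentially"
      using order_tendstoD(2)[OF p0, of "1 / 24"] order_tendstoD[OF np] lam by auto
    then show "eventually (\<lambda>m. cmod (char (normalized_inversions_law (A m) (p m)) t - char (X_law lam) t) \<le> ?B K m) sequentially"
    proof eventually_elim
      fix m assume m: "p m < 1 / 24" "?l m < ?L" "0 < ?l m"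
      have n: "0 < n m" using m(3) by (cases "n m") auto
      have c1: "char (normalized_inversions_law (A m) (p m)) t = inv_char (S m) (p m) (n m)"
        unfolding S_def by (rule char_normalized_inversions_law[OF A n p])
      have c2: "Psi (S m) lam = char (X_law lam) (S m * lam\<^sup>2)" by (rule Psi_eq_char[OF lam])
      have tri: "cmod (inv_char (S m) (p m) (n m) - char (X_law lam) t)
          \<le> cmod (inv_char (S m) (p m) (n m) - Psi (S m) (?l m)) + cmod (Psi (S m) (?l m) - Psi (S m) lam)
            + cmod (Psi (S m) lam - char (X_law lam) t)"
        using norm_triangle_ineq[of "inv_char (S m) (p m) (n m) - Psi (S m) (?l m)" "Psi (S m) (?l m) - Psi (S m) lam"]
          norm_triangle_ineq[of "inv_char (S m) (p m) (n m) - Psi (S m) lam" "Psi (S m) lam - char (X_law lam) t"] by simp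
      have a1: "cmod (inv_char (S m) (p m) (n m) - Psi (S m) (?l m)) \<le> (5 / 6) ^ K * (12 * \<bar>S m\<bar> + 3 * \<bar>S m\<bar>) * (?l m)\<^sup>2
          + (2 ^ K - 1) * step_const (S m) ?L (6 * \<bar>S m\<bar> * ?L) * p m"
        by (rule inv_char_Psi[OF p less_imp_le[OF m(1)] less_imp_le[OF m(2)]])
      have a2: "cmod (Psi (S m) (?l m) - Psi (S m) lam) \<le> 6 * \<bar>S m\<bar> * ?L * \<bar>?l m - lam\<bar>"
        using m lam by (intro Psi_lipschitz) auto
      show "cmod (char (normalized_inversions_law (A m) (p m)) t - char (X_law lam) t) \<le> ?B K m"
        unfolding c1 c2[symmetric] by (rule order.trans[OF tri add_mono[OF add_mono[OF a1 a2] order.refl]])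
    qed
    have c: "(\<lambda>m. char (X_law lam) (S m * lam\<^sup>2)) \<longlonglongrightarrow> char (X_law lam) t"
    proof (rule isCont_tendsto_compose[OF X.isCont_char])
      have "(\<lambda>m. S m * lam\<^sup>2) \<longlonglongrightarrow> t / lam\<^sup>2 * lam\<^sup>2" by (intro tendsto_intros s)
      then show "(\<lambda>m. S m * lam\<^sup>2) \<longlonglongrightarrow> t" using lam by simp
    qed
    have st: "(\<lambda>m. step_const (S m) ?L (6 * \<bar>S m\<bar> * ?L)) \<longlonglongrightarrow> step_const (t / lam\<^sup>2) ?L (6 * \<bar>t / lam\<^sup>2\<bar> * ?L)"
      unfolding step_const_def by (intro tendsto_add tendsto_mult tendsto_const tendsto_rabs s)
    have "?B K \<longlonglongrightarrow> ((5 / 6) ^ K * (12 * \<bar>t / lam\<^sup>2\<bar> + 3 * \<bar>t / lam\<^sup>2\<bar>) * lam\<^sup>2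
        + (2 ^ K - 1) * step_const (t / lam\<^sup>2) ?L (6 * \<bar>t / lam\<^sup>2\<bar> * ?L) * 0)
      + 6 * \<bar>t / lam\<^sup>2\<bar> * ?L * \<bar>lam - lam\<bar> + cmod (char (X_law lam) t - char (X_law lam) t)"
      by (intro tendsto_add tendsto_mult tendsto_diff tendsto_rabs tendsto_norm tendsto_power tendsto_const st s np p0 c)
    then show "?B K \<longlonglongrightarrow> (5 / 6) ^ K * (12 * \<bar>t / lam\<^sup>2\<bar> + 3 * \<bar>t / lam\<^sup>2\<bar>) * lam\<^sup>2"
      by (simp only: mult_zero_right add_0_right diff_self abs_zero norm_zero)
  next
    have "(\<lambda>K. (5 / 6) ^ K * (12 * \<bar>t / lam\<^sup>2\<bar> + 3 * \<bar>t / lam\<^sup>2\<bar>) * lam\<^sup>2) \<longlonglongrightarrow> 0 * (12 * \<bar>t / lam\<^sup>2\<bar> + 3 * \<bar>t / lam\<^sup>2\<bar>) * lam\<^sup>2"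
      by (intro tendsto_mult tendsto_const LIMSEQ_realpow_zero) auto
    then show "(\<lambda>K. (5 / 6) ^ K * (12 * \<bar>t / lam\<^sup>2\<bar> + 3 * \<bar>t / lam\<^sup>2\<bar>) * lam\<^sup>2) \<longlonglongrightarrow> 0" by simp
  qed simp
  from LIM_zero_cancel[OF tendsto_norm_zero_cancel[OF this]]
  show "(\<lambda>m. char (normalized_inversions_law (A m) (p m)) t) \<longlonglongrightarrow> char (X_law lam) t" .
qed

theorem theorem2p4:
  shows
    "(\<forall>(lam::real) (n :: nat \<Rightarrow> nat) (p :: nat \<Rightarrow> real) (A :: nat \<Rightarrow> real set).
        0 < lam \<longrightarrow>
        (\<forall>m. 0 < p m \<and> p m \<le> 1) \<longrightarrow>
        (\<forall>m. finite (A m) \<and> card (A m) = n m) \<longrightarrow>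
        p \<longlonglongrightarrow> 0 \<longrightarrow>
        (\<lambda>m. real (n m) * p m) \<longlonglongrightarrow> lam \<longrightarrow>
        weak_conv_m (\<lambda>m. normalized_inversions_law (A m) (p m)) (X_law lam))
     \<and> X_law \<in> restrict_space borel {0<..} \<rightarrow>\<^sub>M prob_algebra borel
     \<and> (\<forall>lam>0. split_law lam \<in> restrict_space borel {0<..<1} \<rightarrow>\<^sub>M prob_algebra borel
              \<and> X_law lam = unif_open \<bind> split_law lam)
     \<and> (\<forall>lam>0. prob_space.expectation (X_space lam) (X_var lam) = 1
              \<and> prob_space.variance (X_space lam) (X_var lam) = 1 / 12 + 1 / (3 * lam))"
proof (intro conjI allI impI)
  fix lam :: real and n :: "nat \<Rightarrow> nat" and p :: "nat \<Rightarrow> real" and A :: "nat \<Rightarrow> real set"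
  assume "0 < lam" "\<forall>m. 0 < p m \<and> p m \<le> 1" "\<forall>m. finite (A m) \<and> card (A m) = n m"
    "p \<longlonglongrightarrow> 0" "(\<lambda>m. real (n m) * p m) \<longlonglongrightarrow> lam"
  then show "weak_conv_m (\<lambda>m. normalized_inversions_law (A m) (p m)) (X_law lam)"
    by (intro normalized_inversions_weak_conv[where n = n]) auto
next
  fix lam :: real
  assume lam: "0 < lam"
  show "split_law lam \<in> restrict_space borel {0<..<1} \<rightarrow>\<^sub>M prob_algebra borel"
    unfolding split_law_eq by (rule split_of_kernel[OF X_law_kernel lam])
  show "X_law lam = unif_open \<bind> split_law lam"
    by (rule X_law_split[OF lam])
  show "prob_space.expectation (X_space lam) (X_var lam) = 1"
    "prob_space.variance (X_space lam) (X_var lam) = 1 / 12 + 1 / (3 * lam)"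
    by (rule X_var_moments[OF lam])+
qed (fact X_law_kernel)

end
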